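(* Let $G$ be a finite group, let $\mathcal S$ be a set of subgroups of $G$ containing at most one representative from each conjugacy class of subgroups, and let $$R=\prod_{H\in\mathcal S}\mathrm{Coind}_H^G R_H$$ where each $R_H$ is a clarified $H$-Tambara functor. Then every automorphism $\phi$ of the $G$-Tambara functor $R$ is diagonal with respect to this decomposition: for each $H\in\mathcal S$, the composite of $\phi$ with the projection $R\to \mathrm{Coind}_H^G R_H$ factors through the projection $R\to\mathrm{Coind}_H^G R_H$, i.e. $\phi=\prod_{H\in\mathcal S}\phi_H$ for $G$-Tambara functor morphisms $\phi_H:\mathrm{Coind}_H^G R_H\to\mathrm{Coind}_H^G R_H$.
   Context: Rings are commutative with unit; a $G$-ring is a ring with an action of $G$ by ring automorphisms. Let $\mathrm{bispan}(G\text{-}\mathrm{Set}^{\mathrm{fin}})$ be the category whose objects are finite $G$-sets and whose morphisms from $X$ to $Y$ are isomorphism classes of diagrams $X\leftarrow A\to B\to Y$ of finite $G$-sets, with the usual composition of bispans (polynomials), defined via pullbacks and exponential diagrams. A $G$-Tambara functor is a product-preserving functor $R:\mathrm{bispan}(G\text{-}\mathrm{Set}^{\mathrm{fin}})\to \mathrm{Set}$ such that the additive monoid $R(X)$ is a group for each finite $G$-set $X$; morphisms are natural transformations. Transfer (image of $X\sqcup X= X\sqcup X= X\sqcup X\to X$) and norm (image of $X\sqcup X= X\sqcup X\to X= X$) along the fold map give addition and multiplication, making $R(X)$ a commutative ring. $R(G/e)$ is a $G$-ring via $\mathrm{Aut}_G(G/e)\cong G$. Products of Tambara functors are computed levelwise.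 The same definitions apply to every finite group. For $H\subset G$ and an $H$-Tambara functor $T$, $\mathrm{Coind}_H^G T := T\circ \mathrm{res}_H^G$, i.e. $(\mathrm{Coind}_H^G T)(X)=T(\mathrm{res}_H^G X)$, where $\mathrm{res}_H^G$ sends a $G$-set to its underlying $H$-set. An idempotent $d$ of a $G$-ring is of type $K$ ($K\subset G$ a subgroup) if its isotropy group is $K$ and $d\cdot gd=0$ whenever $g\notin K$. A $G$-ring is clarified if it contains no idempotent of type $K$ for any proper subgroup $K$ of $G$; a $G$-Tambara functor $R$ is clarified if $R(G/e)$ is (and similarly with $H$ in place of $G$). *)

theory Defs
  imports "HOL-Algebra.Group_Action" "HOL-Algebra.Ring" "HOL-Library.Countable_Set" "HOL-Library.Nat_Bijection"
begin

section \<open>Categories and set-valued functors\<close>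

record ('o, 'm) cat =
  Ob :: "'o set"
  Hom :: "'o \<Rightarrow> 'o \<Rightarrow> 'm set"
  Ident :: "'o \<Rightarrow> 'm"
  Comp :: "'m \<Rightarrow> 'm \<Rightarrow> 'm"

text \<open>\<open>Comp C g f\<close> is ``g after f''.\<close>

definition is_terminal :: "('o, 'm) cat \<Rightarrow> 'o \<Rightarrow> bool" where
  "is_terminal C T \<longleftrightarrow> T \<in> Ob C \<and> (\<forall>Z\<in>Ob C. \<exists>!h. h \<in> Hom C Z T)"

definition is_product ::
    "('o, 'm) cat \<Rightarrow> 'o \<Rightarrow> 'o \<Rightarrow> 'o \<Rightarrow> 'm \<Rightarrow> 'm \<Rightarrow> bool" where
  "is_product C X Y P p q \<longleftrightarrow>
     X \<in> Ob C \<and> Y \<in> Ob C \<and> P \<in> Ob C \<and> p \<in> Hom C P X \<and> q \<in> Hom C P Y \<and>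
     (\<forall>Z\<in>Ob C. \<forall>f\<in>Hom C Z X. \<forall>g\<in>Hom C Z Y.
        \<exists>!h. h \<in> Hom C Z P \<and> Comp C p h = f \<and> Comp C q h = g)"

text \<open>
  Values on morphisms are relevant only on the value of the source object; the same holds
  for the components of natural transformations below.
\<close>

record ('o, 'm, 'r) set_functor =
  obj :: "'o \<Rightarrow> 'r set"
  mor :: "'m \<Rightarrow> 'r \<Rightarrow> 'r"

definition is_set_functor :: "('o, 'm) cat \<Rightarrow> ('o, 'm, 'r) set_functor \<Rightarrow> bool" where
  "is_set_functor C F \<longleftrightarrow>
     (\<forall>X\<in>Ob C. \<forall>Y\<in>Ob C. \<forall>f\<in>Hom C X Y. mor F f \<in> obj F X \<rightarrow> obj F Y) \<and>
     (\<forall>X\<in>Ob C. \<forall>x\<in>obj F X. mor F (Ident C X) x = x) \<and>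
     (\<forall>X\<in>Ob C. \<forall>Y\<in>Ob C. \<forall>Z\<in>Ob C. \<forall>f\<in>Hom C X Y. \<forall>g\<in>Hom C Y Z. \<forall>x\<in>obj F X.
        mor F (Comp C g f) x = mor F g (mor F f x))"

definition preserves_products :: "('o, 'm) cat \<Rightarrow> ('o, 'm, 'r) set_functor \<Rightarrow> bool" where
  "preserves_products C F \<longleftrightarrow>
     (\<forall>T. is_terminal C T \<longrightarrow> (\<exists>t. obj F T = {t})) \<and>
     (\<forall>X Y P p q. is_product C X Y P p q \<longrightarrow>
        bij_betw (\<lambda>z. (mor F p z, mor F q z)) (obj F P) (obj F X \<times> obj F Y))"

definition is_nat_trans ::
    "('o, 'm) cat \<Rightarrow> ('o, 'm, 'r) set_functor \<Rightarrow> ('o, 'm, 'r) set_functor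
      \<Rightarrow> ('o \<Rightarrow> 'r \<Rightarrow> 'r) \<Rightarrow> bool" where
  "is_nat_trans C F F' \<phi> \<longleftrightarrow>
     (\<forall>X\<in>Ob C. \<phi> X \<in> obj F X \<rightarrow> obj F' X) \<and>
     (\<forall>X\<in>Ob C. \<forall>Y\<in>Ob C. \<forall>f\<in>Hom C X Y. \<forall>x\<in>obj F X.
        \<phi> Y (mor F f x) = mor F' f (\<phi> X x))"

definition is_nat_aut ::
    "('o, 'm) cat \<Rightarrow> ('o, 'm, 'r) set_functor \<Rightarrow> ('o \<Rightarrow> 'r \<Rightarrow> 'r) \<Rightarrow> bool" where
  "is_nat_aut C F \<phi> \<longleftrightarrow>
     is_nat_trans C F F \<phi> \<and>
     (\<exists>\<psi>. is_nat_trans C F F \<psi> \<and>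
        (\<forall>X\<in>Ob C. \<forall>x\<in>obj F X. \<psi> X (\<phi> X x) = x \<and> \<phi> X (\<psi> X x) = x))"


section \<open>Finite G-sets\<close>

text \<open>
  HOL has no type of all finite sets, so the finite \<open>G\<close>-sets are those whose points are
  natural numbers.  Every finite \<open>G\<close>-set is isomorphic to one of these, so they form a full
  subcategory equivalent to the category of all finite \<open>G\<close>-sets.  Actions and maps are
  extensional, so that equality of records is equality of \<open>G\<close>-sets.
\<close>

record 'g gset =
  points :: "nat set"
  act :: "'g \<Rightarrow> nat \<Rightarrow> nat"

definition is_gset :: "('g, 'b) monoid_scheme \<Rightarrow> 'g gset \<Rightarrow> bool" where
  "is_gset G X \<longleftrightarrow>
     finite (points X) \<and> group_action G (points X) (act X) \<and> act X \<in> extensional (carrier G)"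

definition gmaps :: "('g, 'b) monoid_scheme \<Rightarrow> 'g gset \<Rightarrow> 'g gset \<Rightarrow> (nat \<Rightarrow> nat) set" where
  "gmaps G X Y = {f \<in> points X \<rightarrow>\<^sub>E points Y.
     \<forall>g\<in>carrier G. \<forall>x\<in>points X. f (act X g x) = act Y g (f x)}"

definition gid :: "'g gset \<Rightarrow> nat \<Rightarrow> nat" where
  "gid X = (\<lambda>x\<in>points X. x)"

definition gset_empty :: "('g, 'b) monoid_scheme \<Rightarrow> 'g gset" where
  "gset_empty G = \<lparr>points = {}, act = (\<lambda>g\<in>carrier G. \<lambda>x\<in>{}. x)\<rparr>"

definition gset_inl :: "'g gset \<Rightarrow> nat \<Rightarrow> nat" where
  "gset_inl X = (\<lambda>x\<in>points X. sum_encode (Inl x))"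

definition gset_inr :: "'g gset \<Rightarrow> nat \<Rightarrow> nat" where
  "gset_inr Y = (\<lambda>y\<in>points Y. sum_encode (Inr y))"

definition gset_sum :: "('g, 'b) monoid_scheme \<Rightarrow> 'g gset \<Rightarrow> 'g gset \<Rightarrow> 'g gset" where
  "gset_sum G X Y =
     \<lparr>points = sum_encode ` (points X <+> points Y),
      act = (\<lambda>g\<in>carrier G. \<lambda>n\<in>sum_encode ` (points X <+> points Y).
               sum_encode (map_sum (act X g) (act Y g) (sum_decode n)))\<rparr>"

definition gset_fold :: "'g gset \<Rightarrow> nat \<Rightarrow> nat" where
  "gset_fold X = (\<lambda>n\<in>sum_encode ` (points X <+> points X). case_sum id id (sum_decode n))"

text \<open>The \<open>G\<close>-set \<open>G/e\<close>, i.e. \<open>G\<close> acting on itself by left multiplication, transported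
  along an enumeration of \<open>G\<close>; the right multiplications are its automorphisms.\<close>

definition free_orbit :: "('g, 'b) monoid_scheme \<Rightarrow> 'g gset" where
  "free_orbit G =
     \<lparr>points = to_nat_on (carrier G) ` carrier G,
      act = (\<lambda>g\<in>carrier G. \<lambda>n\<in>to_nat_on (carrier G) ` carrier G.
               to_nat_on (carrier G) (g \<otimes>\<^bsub>G\<^esub> from_nat_into (carrier G) n))\<rparr>"

definition free_orbit_rmult :: "('g, 'b) monoid_scheme \<Rightarrow> 'g \<Rightarrow> nat \<Rightarrow> nat" where
  "free_orbit_rmult G g =
     (\<lambda>n\<in>to_nat_on (carrier G) ` carrier G.
        to_nat_on (carrier G) (from_nat_into (carrier G) n \<otimes>\<^bsub>G\<^esub> g))"


section \<open>Pullbacks and exponential diagrams\<close>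

text \<open>\<open>P\<close>, with projections \<open>a : P \<rightarrow> X\<close> and \<open>b : P \<rightarrow> Y\<close>, is a pullback of
  \<open>f : X \<rightarrow> Z\<close> and \<open>g : Y \<rightarrow> Z\<close>.\<close>

definition is_pullback ::
    "('g, 'b) monoid_scheme \<Rightarrow> 'g gset \<Rightarrow> (nat \<Rightarrow> nat) \<Rightarrow> (nat \<Rightarrow> nat)
      \<Rightarrow> 'g gset \<Rightarrow> (nat \<Rightarrow> nat) \<Rightarrow> 'g gset \<Rightarrow> (nat \<Rightarrow> nat) \<Rightarrow> bool" where
  "is_pullback G P a b X f Y g \<longleftrightarrow>
     is_gset G P \<and> a \<in> gmaps G P X \<and> b \<in> gmaps G P Y \<and>
     bij_betw (\<lambda>w. (a w, b w)) (points P) {(x, y) \<in> points X \<times> points Y. f x = g y}"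

text \<open>
  For \<open>h : P \<rightarrow> C\<close> and \<open>p : C \<rightarrow> D\<close>, an exponential diagram is a diagram isomorphic to
  \<open>C \<leftarrow> P \<leftarrow> C \<times>\<^sub>D E \<rightarrow> E \<rightarrow> D\<close>, where \<open>E\<close> is the set of pairs \<open>(d, s)\<close> with \<open>d \<in> D\<close> and
  \<open>s\<close> a section of \<open>h\<close> over the fibre of \<open>p\<close> at \<open>d\<close>, and \<open>C \<times>\<^sub>D E \<rightarrow> P\<close> is evaluation of
  sections.  Below \<open>W\<close> plays the role of \<open>C \<times>\<^sub>D E\<close>, with projections \<open>u : W \<rightarrow> C\<close> and
  \<open>v : W \<rightarrow> E\<close>, and \<open>ev : W \<rightarrow> P\<close> is the evaluation; an element \<open>e\<close> of \<open>E\<close> determines the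
  section \<open>u w \<mapsto> ev w\<close> (for \<open>v w = e\<close>), and every section must arise from exactly one \<open>e\<close>.
\<close>

definition is_exponential ::
    "('g, 'b) monoid_scheme \<Rightarrow> 'g gset \<Rightarrow> (nat \<Rightarrow> nat) \<Rightarrow> 'g gset \<Rightarrow> (nat \<Rightarrow> nat) \<Rightarrow> 'g gset
      \<Rightarrow> 'g gset \<Rightarrow> (nat \<Rightarrow> nat) \<Rightarrow> 'g gset \<Rightarrow> (nat \<Rightarrow> nat) \<Rightarrow> (nat \<Rightarrow> nat) \<Rightarrow> (nat \<Rightarrow> nat)
      \<Rightarrow> bool" where
  "is_exponential G P h C p D E r W u v ev \<longleftrightarrow>
     is_gset G E \<and> r \<in> gmaps G E D \<and>
     is_pullback G W u v C p E r \<and>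
     ev \<in> gmaps G W P \<and> (\<forall>w\<in>points W. h (ev w) = u w) \<and>
     (\<forall>d\<in>points D. \<forall>s \<in> (\<Pi>\<^sub>E c\<in>{c\<in>points C. p c = d}. {x\<in>points P. h x = c}).
        \<exists>!e. e \<in> points E \<and> r e = d \<and> (\<forall>w\<in>points W. v w = e \<longrightarrow> ev w = s (u w)))"


section \<open>The category of bispans\<close>

text \<open>The diagram \<open>src \<leftarrow> top \<rightarrow> mid \<rightarrow> tgt\<close> with maps \<open>lmap\<close>, \<open>mmap\<close>, \<open>rmap\<close>.\<close>

record 'g bispan =
  src :: "'g gset"
  top :: "'g gset"
  mid :: "'g gset"
  tgt :: "'g gset"
  lmap :: "nat \<Rightarrow> nat"
  mmap :: "nat \<Rightarrow> nat"
  rmap :: "nat \<Rightarrow> nat"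

hide_const (open) top

definition is_bispan :: "('g, 'b) monoid_scheme \<Rightarrow> 'g bispan \<Rightarrow> bool" where
  "is_bispan G D \<longleftrightarrow>
     is_gset G (src D) \<and> is_gset G (bispan.top D) \<and> is_gset G (mid D) \<and> is_gset G (tgt D) \<and>
     lmap D \<in> gmaps G (bispan.top D) (src D) \<and>
     mmap D \<in> gmaps G (bispan.top D) (mid D) \<and>
     rmap D \<in> gmaps G (mid D) (tgt D)"

definition bispan_iso :: "('g, 'b) monoid_scheme \<Rightarrow> 'g bispan rel" where
  "bispan_iso G = {(D, D').
     is_bispan G D \<and> is_bispan G D' \<and> src D = src D' \<and> tgt D = tgt D' \<and>
     (\<exists>a b. a \<in> gmaps G (bispan.top D) (bispan.top D') \<and>
            bij_betw a (points (bispan.top D)) (points (bispan.top D')) \<and>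
            b \<in> gmaps G (mid D) (mid D') \<and>
            bij_betw b (points (mid D)) (points (mid D')) \<and>
            (\<forall>x\<in>points (bispan.top D). lmap D' (a x) = lmap D x) \<and>
            (\<forall>x\<in>points (bispan.top D). mmap D' (a x) = b (mmap D x)) \<and>
            (\<forall>y\<in>points (mid D). rmap D' (b y) = rmap D y))}"

definition bispan_class :: "('g, 'b) monoid_scheme \<Rightarrow> 'g bispan \<Rightarrow> 'g bispan set" where
  "bispan_class G D = bispan_iso G `` {D}"

text \<open>
  For \<open>S = (X \<leftarrow> A \<rightarrow> B \<rightarrow> Y)\<close> and \<open>T = (Y \<leftarrow> C \<rightarrow> D \<rightarrow> Z)\<close>, form the pullback
  \<open>P = B \<times>\<^sub>Y C\<close>, an exponential diagram \<open>C \<leftarrow> P \<leftarrow> W \<rightarrow> E \<rightarrow> D\<close> for \<open>P \<rightarrow> C \<rightarrow> D\<close>, and the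
  pullback \<open>A \<times>\<^sub>B W\<close> along \<open>W \<rightarrow> P \<rightarrow> B\<close>; the composite is
  \<open>X \<leftarrow> A \<times>\<^sub>B W \<rightarrow> E \<rightarrow> Z\<close>.  It is only defined up to isomorphism, so it is given as a
  relation: \<open>U\<close> is a composite of \<open>S\<close> followed by \<open>T\<close>.
\<close>

definition is_composite ::
    "('g, 'b) monoid_scheme \<Rightarrow> 'g bispan \<Rightarrow> 'g bispan \<Rightarrow> 'g bispan \<Rightarrow> bool" where
  "is_composite G S T U \<longleftrightarrow>
     is_bispan G S \<and> is_bispan G T \<and> is_bispan G U \<and>
     tgt S = src T \<and> src U = src S \<and> tgt U = tgt T \<and>
     (\<exists>P \<pi>\<^sub>B \<pi>\<^sub>C r W u v ev s t.
        is_pullback G P \<pi>\<^sub>B \<pi>\<^sub>C (mid S) (rmap S) (bispan.top T) (lmap T) \<and>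
        is_exponential G P \<pi>\<^sub>C (bispan.top T) (mmap T) (mid T) (mid U) r W u v ev \<and>
        is_pullback G (bispan.top U) s t
          (bispan.top S) (mmap S) W (compose (points W) \<pi>\<^sub>B ev) \<and>
        lmap U = compose (points (bispan.top U)) (lmap S) s \<and>
        mmap U = compose (points (bispan.top U)) v t \<and>
        rmap U = compose (points (mid U)) (rmap T) r)"

definition bispan_cat :: "('g, 'b) monoid_scheme \<Rightarrow> ('g gset, 'g bispan set) cat" where
  "bispan_cat G =
     \<lparr>Ob = {X. is_gset G X},
      Hom = (\<lambda>X Y. {D. is_bispan G D \<and> src D = X \<and> tgt D = Y} // bispan_iso G),
      Ident = (\<lambda>X. bispan_class G
              \<lparr>src = X, top = X, mid = X, tgt = X, lmap = gid X, mmap = gid X, rmap = gid X\<rparr>),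
      Comp = (\<lambda>d c. {U. \<exists>S\<in>c. \<exists>T\<in>d. is_composite G S T U})\<rparr>"

text \<open>For a map \<open>f : X \<rightarrow> Y\<close>: the restriction \<open>Y \<leftarrow> X = X = X\<close>, the transfer
  \<open>X = X = X \<rightarrow> Y\<close> and the norm \<open>X = X \<rightarrow> Y = Y\<close>.\<close>

definition restriction ::
    "('g, 'b) monoid_scheme \<Rightarrow> 'g gset \<Rightarrow> 'g gset \<Rightarrow> (nat \<Rightarrow> nat) \<Rightarrow> 'g bispan set" where
  "restriction G X Y f = bispan_class G
     \<lparr>src = Y, top = X, mid = X, tgt = X, lmap = f, mmap = gid X, rmap = gid X\<rparr>"

definition transfer_map ::
    "('g, 'b) monoid_scheme \<Rightarrow> 'g gset \<Rightarrow> 'g gset \<Rightarrow> (nat \<Rightarrow> nat) \<Rightarrow> 'g bispan set" where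
  "transfer_map G X Y f = bispan_class G
     \<lparr>src = X, top = X, mid = X, tgt = Y, lmap = gid X, mmap = gid X, rmap = f\<rparr>"

definition norm_map ::
    "('g, 'b) monoid_scheme \<Rightarrow> 'g gset \<Rightarrow> 'g gset \<Rightarrow> (nat \<Rightarrow> nat) \<Rightarrow> 'g bispan set" where
  "norm_map G X Y f = bispan_class G
     \<lparr>src = X, top = X, mid = Y, tgt = Y, lmap = gid X, mmap = f, rmap = gid Y\<rparr>"


section \<open>Tambara functors\<close>

type_synonym ('g, 'r) tambara = "('g gset, 'g bispan set, 'r) set_functor"

text \<open>The element of \<open>R(X \<squnion> X)\<close> corresponding to a pair of elements of \<open>R(X)\<close>, and the
  element of \<open>R(\<emptyset>)\<close>.  Both are well defined when \<open>R\<close> preserves products, because \<open>X \<squnion> X\<close>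
  with the restrictions along the two inclusions is a product, and \<open>\<emptyset>\<close> is terminal, in the
  category of bispans.\<close>

definition tambara_pair ::
    "('g, 'b) monoid_scheme \<Rightarrow> ('g, 'r) tambara \<Rightarrow> 'g gset \<Rightarrow> 'r \<Rightarrow> 'r \<Rightarrow> 'r" where
  "tambara_pair G R X x y =
     (THE z. z \<in> obj R (gset_sum G X X) \<and>
        mor R (restriction G X (gset_sum G X X) (gset_inl X)) z = x \<and>
        mor R (restriction G X (gset_sum G X X) (gset_inr X)) z = y)"

definition tambara_pt :: "('g, 'b) monoid_scheme \<Rightarrow> ('g, 'r) tambara \<Rightarrow> 'r" where
  "tambara_pt G R = (THE z. z \<in> obj R (gset_empty G))"

definition tambara_ring ::
    "('g, 'b) monoid_scheme \<Rightarrow> ('g, 'r) tambara \<Rightarrow> 'g gset \<Rightarrow> 'r ring" where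
  "tambara_ring G R X =
     \<lparr>carrier = obj R X,
      mult = (\<lambda>x y. mor R (norm_map G (gset_sum G X X) X (gset_fold X)) (tambara_pair G R X x y)),
      one = mor R (norm_map G (gset_empty G) X (gid (gset_empty G))) (tambara_pt G R),
      zero = mor R (transfer_map G (gset_empty G) X (gid (gset_empty G))) (tambara_pt G R),
      add = (\<lambda>x y. mor R (transfer_map G (gset_sum G X X) X (gset_fold X))
               (tambara_pair G R X x y))\<rparr>"

definition is_tambara :: "('g, 'b) monoid_scheme \<Rightarrow> ('g, 'r) tambara \<Rightarrow> bool" where
  "is_tambara G R \<longleftrightarrow>
     is_set_functor (bispan_cat G) R \<and> preserves_products (bispan_cat G) R \<and>
     (\<forall>X. is_gset G X \<longrightarrow> group (add_monoid (tambara_ring G R X)))"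

definition tambara_hom ::
    "('g, 'b) monoid_scheme \<Rightarrow> ('g, 'r) tambara \<Rightarrow> ('g, 'r) tambara
      \<Rightarrow> ('g gset \<Rightarrow> 'r \<Rightarrow> 'r) \<Rightarrow> bool" where
  "tambara_hom G R R' \<phi> \<longleftrightarrow> is_nat_trans (bispan_cat G) R R' \<phi>"

definition tambara_aut ::
    "('g, 'b) monoid_scheme \<Rightarrow> ('g, 'r) tambara \<Rightarrow> ('g gset \<Rightarrow> 'r \<Rightarrow> 'r) \<Rightarrow> bool" where
  "tambara_aut G R \<phi> \<longleftrightarrow> is_nat_aut (bispan_cat G) R \<phi>"

text \<open>The product of a family of Tambara functors indexed by \<open>I\<close>, and the product of a
  family of morphisms.\<close>

definition tambara_prod :: "'i set \<Rightarrow> ('i \<Rightarrow> ('g, 'r) tambara) \<Rightarrow> ('g, 'i \<Rightarrow> 'r) tambara" where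
  "tambara_prod I F =
     \<lparr>obj = (\<lambda>X. \<Pi>\<^sub>E i\<in>I. obj (F i) X),
      mor = (\<lambda>c r. \<lambda>i\<in>I. mor (F i) c (r i))\<rparr>"

definition tambara_prod_hom ::
    "'i set \<Rightarrow> ('i \<Rightarrow> 'g gset \<Rightarrow> 'r \<Rightarrow> 'r) \<Rightarrow> 'g gset \<Rightarrow> ('i \<Rightarrow> 'r) \<Rightarrow> ('i \<Rightarrow> 'r)" where
  "tambara_prod_hom I \<Phi> X r = (\<lambda>i\<in>I. \<Phi> i X (r i))"


section \<open>Coinduction\<close>

definition res_gset :: "'g set \<Rightarrow> 'g gset \<Rightarrow> 'g gset" where
  "res_gset H X = \<lparr>points = points X, act = restrict (act X) H\<rparr>"

definition res_bispan :: "'g set \<Rightarrow> 'g bispan \<Rightarrow> 'g bispan" where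
  "res_bispan H D =
     \<lparr>src = res_gset H (src D), top = res_gset H (bispan.top D),
      mid = res_gset H (mid D), tgt = res_gset H (tgt D),
      lmap = lmap D, mmap = mmap D, rmap = rmap D\<rparr>"

text \<open>On isomorphism classes, restriction sends the class of \<open>D\<close> to the \<open>H\<close>-isomorphism
  class of \<open>res_bispan H D\<close>.\<close>

definition res_class ::
    "('g, 'b) monoid_scheme \<Rightarrow> 'g set \<Rightarrow> 'g bispan set \<Rightarrow> 'g bispan set" where
  "res_class G H c = bispan_iso (G\<lparr>carrier := H\<rparr>) `` (res_bispan H ` c)"

definition coind ::
    "('g, 'b) monoid_scheme \<Rightarrow> 'g set \<Rightarrow> ('g, 'r) tambara \<Rightarrow> ('g, 'r) tambara" where
  "coind G H T =
     \<lparr>obj = (\<lambda>X. obj T (res_gset H X)),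
      mor = (\<lambda>c. mor T (res_class G H c))\<rparr>"


section \<open>Clarified G-rings and Tambara functors\<close>

text \<open>A \<open>G\<close>-ring is given by a ring \<open>A\<close> and the action \<open>\<alpha>\<close> of \<open>G\<close> on its carrier.\<close>

definition idempotent_of_type ::
    "('g, 'b) monoid_scheme \<Rightarrow> ('r, 'c) ring_scheme \<Rightarrow> ('g \<Rightarrow> 'r \<Rightarrow> 'r) \<Rightarrow> 'g set \<Rightarrow> 'r \<Rightarrow> bool"
  where
  "idempotent_of_type G A \<alpha> K d \<longleftrightarrow>
     d \<in> carrier A \<and> d \<otimes>\<^bsub>A\<^esub> d = d \<and> stabilizer G \<alpha> d = K \<and>
     (\<forall>g \<in> carrier G - K. d \<otimes>\<^bsub>A\<^esub> \<alpha> g d = \<zero>\<^bsub>A\<^esub>)"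

definition clarified_gring ::
    "('g, 'b) monoid_scheme \<Rightarrow> ('r, 'c) ring_scheme \<Rightarrow> ('g \<Rightarrow> 'r \<Rightarrow> 'r) \<Rightarrow> bool" where
  "clarified_gring G A \<alpha> \<longleftrightarrow>
     (\<forall>K. subgroup K G \<and> K \<noteq> carrier G \<longrightarrow> \<not> (\<exists>d. idempotent_of_type G A \<alpha> K d))"

text \<open>
  The action of \<open>G\<close> on \<open>R(G/e)\<close>: the element \<open>g\<close> acts by restriction along right
  multiplication by \<open>g\<close>.  Since \<open>g \<mapsto> (x \<mapsto> x g)\<close> reverses products and restriction is
  contravariant, this is a left action.
\<close>

definition bottom_act :: "('g, 'b) monoid_scheme \<Rightarrow> ('g, 'r) tambara \<Rightarrow> 'g \<Rightarrow> 'r \<Rightarrow> 'r" where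
  "bottom_act G R g =
     mor R (restriction G (free_orbit G) (free_orbit G) (free_orbit_rmult G g))"

definition clarified :: "('g, 'b) monoid_scheme \<Rightarrow> ('g, 'r) tambara \<Rightarrow> bool" where
  "clarified G R \<longleftrightarrow> clarified_gring G (tambara_ring G R (free_orbit G)) (bottom_act G R)"

end

theory Submission
  imports Defs
begin

text \<open>
  Write \<open>F\<close> for the \<open>G\<close>-set \<open>G/e\<close>.  The factor \<open>Coind R\<^sub>L\<close> has the value \<open>R\<^sub>L(res\<^sub>L G)\<close> at \<open>F\<close>, and
  \<open>res\<^sub>L G\<close> is a disjoint union of free \<open>L\<close>-orbits \<open>La\<close>.  An element \<open>r\<close> of \<open>R(F)\<close> is therefore
  determined by its values \<open>val L a r\<close> in the \<open>L\<close>-rings \<open>R\<^sub>L(L/e)\<close>, the restrictions along \<open>l \<mapsto> la\<close>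
  (lemma \<open>val_eqI\<close>).

  Let \<open>d\<^sub>H\<close> be the element of \<open>R(F)\<close> that is \<open>1\<close> on the orbit \<open>H\<close> in the factor \<open>H\<close> and \<open>0\<close> elsewhere.
  It is idempotent, fixed by \<open>H\<close> and orthogonal to its translates by elements outside \<open>H\<close>.  If \<open>\<phi>\<close> is any endomorphism of \<open>R\<close>, then \<open>val L a (\<phi> d\<^sub>H)\<close> is an
  idempotent of \<open>R\<^sub>L(L/e)\<close> that is fixed by \<open>K = {l \<in> L. a\<^sup>-\<^sup>1la \<in> H}\<close> and orthogonal to its translates by
  the other elements of \<open>L\<close>; if it is not \<open>0\<close>, it is of type \<open>K\<close>, and \<open>K = L\<close> because \<open>R\<^sub>L\<close> is
  clarified.  So \<open>\<phi> d\<^sub>H\<close> vanishes in the factor \<open>L\<close> unless \<open>L\<close> is conjugate to a subgroup of \<open>H\<close>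
  (\<open>end_indicator_null\<close>).

  Now let \<open>\<phi>\<close> have the inverse \<open>\<psi>\<close>.  The previous statement for \<open>\<psi>\<close> says that \<open>\<psi> d\<^sub>L\<close> vanishes in the
  factor \<open>H\<close> unless \<open>H\<close> is conjugate to a subgroup of \<open>L\<close>, and vanishing for \<open>\<psi>\<close> turns into vanishing
  for \<open>\<phi>\<close>: if \<open>\<psi> d\<^sub>L\<close> is orthogonal to all translates of an element \<open>c\<close>, then applying \<open>\<phi>\<close> shows that
  \<open>d\<^sub>L\<close> is orthogonal to all translates of \<open>\<phi> c\<close>, so \<open>\<phi> c\<close> vanishes in the factor \<open>L\<close>
  (\<open>end_null_of_orthogonal\<close>).  Different members of \<open>\<S>\<close> cannot both be conjugate to subgroups of each
  other, so \<open>\<phi> d\<^sub>H\<close> vanishes in all factors \<open>L \<noteq> H\<close> (\<open>aut_indicator_null\<close>).  The same principle, with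
  \<open>c = 1 - e\<^sub>H\<close> for the unit \<open>e\<^sub>H\<close> of the factor \<open>H\<close>, shows that \<open>\<phi> c\<close> vanishes in the factor \<open>H\<close>, hence
  that \<open>\<phi> e\<^sub>H\<close> is \<open>1\<close> there (\<open>aut_fixes_factor_unit\<close>).

  To pass from \<open>F\<close> to any \<open>X\<close>, take the norm of \<open>e\<^sub>H\<close> to the one-point set and restrict it to \<open>X\<close>.
  Norms along surjections preserve \<open>0\<close> and \<open>1\<close>, so the result \<open>u\<close> is the unit of the factor \<open>H\<close> of
  \<open>R(X)\<close>, and \<open>\<phi> u\<close> is \<open>1\<close> in the factor \<open>H\<close>.  Therefore \<open>\<phi> x\<close> and \<open>\<phi> (x u)\<close> agree in the factor \<open>H\<close>;
  the latter depends only on the component of \<open>x\<close> at \<open>H\<close> (\<open>aut_component\<close>).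

  The argument needs little of the ring structure: restrictions are multiplicative, \<open>0\<close> and \<open>1\<close> are
  neutral or absorbing as usual, and disjoint unions become products.  All of this follows from
  identities between bispans.  Since composition is defined up to isomorphism by a universal property,
  the first part of the theory replaces the intermediate pullbacks and the exponential diagram by
  an elementwise description of composites (\<open>composite_via\<close>) and shows that it determines the composite
  (\<open>Comp_bispan_class\<close>).
\<close>

section \<open>Finite G-sets\<close>

context group
begin

lemma is_gset_iff:
  "is_gset G X \<longleftrightarrow> finite (points X) \<and> act X \<in> extensional (carrier G) \<and>
     (\<forall>g\<in>carrier G. act X g \<in> points X \<rightarrow>\<^sub>E points X) \<and>
     (\<forall>x\<in>points X. act X \<one> x = x) \<and>
     (\<forall>g\<in>carrier G. \<forall>h\<in>carrier G. \<forall>x\<in>points X. act X (g \<otimes> h) x = act X g (act X h x))"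
  (is "?L \<longleftrightarrow> ?R")
proof
  assume L: ?L
  then interpret group_action G "points X" "act X" by (simp add: is_gset_def)
  have "act X \<one> x = x" if "x \<in> points X" for x
    using id_eq_one that by (metis restrict_apply')
  moreover have "act X g \<in> points X \<rightarrow>\<^sub>E points X" if "g \<in> carrier G" for g
    using bij_prop0[OF that] by (auto simp: Bij_def bij_betw_def PiE_def)
  ultimately show ?R
    using L composition_rule by (simp add: is_gset_def)
next
  assume R: ?R
  have bij: "act X g \<in> Bij (points X)" if g: "g \<in> carrier G" for g
  proof -
    have "bij_betw (act X g) (points X) (points X)"
    proof (rule bij_betw_byWitness[where f' = "act X (inv g)"])
      show "\<forall>x\<in>points X. act X (inv g) (act X g x) = x"
        using R g by (metis inv_closed l_inv)
      show "\<forall>x\<in>points X. act X g (act X (inv g) x) = x"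
        using R g by (metis inv_closed r_inv)
    qed (use R g inv_closed[OF g] in \<open>auto simp: PiE_def Pi_def\<close>)
    then show ?thesis using R g by (auto simp: Bij_def PiE_def)
  qed
  have "group_hom G (BijGroup (points X)) (act X)"
  proof (rule group_hom.intro)
    show "group_hom_axioms G (BijGroup (points X)) (act X)"
      unfolding group_hom_axioms_def hom_def
    proof (safe)
      fix g assume "g \<in> carrier G"
      then show "act X g \<in> carrier (BijGroup (points X))" using bij by (simp add: BijGroup_def)
    next
      fix g h assume gh: "g \<in> carrier G" "h \<in> carrier G"
      then have "act X (g \<otimes> h) = compose (points X) (act X g) (act X h)"
        using R by (intro extensionalityI[where A = "points X"]) (auto simp: compose_def PiE_def)
      then show "act X (g \<otimes> h) = act X g \<otimes>\<^bsub>BijGroup (points X)\<^esub> act X h"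
        using gh bij by (simp add: BijGroup_def)
    qed
  qed (simp_all add: is_group group_BijGroup)
  then show ?L using R by (simp add: is_gset_def group_action_def)
qed

lemma gset_finite: "is_gset G X \<Longrightarrow> finite (points X)"
  and gset_act_closed: "is_gset G X \<Longrightarrow> g \<in> carrier G \<Longrightarrow> x \<in> points X \<Longrightarrow> act X g x \<in> points X"
  and gset_act_one: "is_gset G X \<Longrightarrow> x \<in> points X \<Longrightarrow> act X \<one> x = x"
  and gset_act_mult: "is_gset G X \<Longrightarrow> g \<in> carrier G \<Longrightarrow> h \<in> carrier G \<Longrightarrow> x \<in> points X
    \<Longrightarrow> act X (g \<otimes> h) x = act X g (act X h x)"
  by (auto simp: is_gset_iff)

lemma gset_act_inv:
  assumes "is_gset G X" "g \<in> carrier G" "x \<in> points X"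
  shows "act X (inv g) (act X g x) = x" "act X g (act X (inv g) x) = x"
  using assms gset_act_mult[of X "inv g" g x] gset_act_mult[of X g "inv g" x]
  by (auto simp: gset_act_one)

lemma is_gsetI:
  assumes "finite (points X)" "act X \<in> extensional (carrier G)"
    and "\<And>g. g \<in> carrier G \<Longrightarrow> act X g \<in> extensional (points X)"
    and "\<And>g x. g \<in> carrier G \<Longrightarrow> x \<in> points X \<Longrightarrow> act X g x \<in> points X"
    and "\<And>x. x \<in> points X \<Longrightarrow> act X \<one> x = x"
    and "\<And>g h x. g \<in> carrier G \<Longrightarrow> h \<in> carrier G \<Longrightarrow> x \<in> points X
          \<Longrightarrow> act X (g \<otimes> h) x = act X g (act X h x)"
  shows "is_gset G X"
  using assms by (auto simp: is_gset_iff PiE_def)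

lemma gmapsI:
  assumes "f \<in> extensional (points X)" "\<And>x. x \<in> points X \<Longrightarrow> f x \<in> points Y"
    and "\<And>g x. g \<in> carrier G \<Longrightarrow> x \<in> points X \<Longrightarrow> f (act X g x) = act Y g (f x)"
  shows "f \<in> gmaps G X Y"
  using assms by (auto simp: gmaps_def PiE_def)

lemma gmaps_closed: "f \<in> gmaps G X Y \<Longrightarrow> x \<in> points X \<Longrightarrow> f x \<in> points Y"
  and gmaps_equivariant: "f \<in> gmaps G X Y \<Longrightarrow> g \<in> carrier G \<Longrightarrow> x \<in> points X
        \<Longrightarrow> f (act X g x) = act Y g (f x)"
  and gmaps_extensional: "f \<in> gmaps G X Y \<Longrightarrow> f \<in> extensional (points X)"
  by (auto simp: gmaps_def PiE_def)

lemma gmaps_eqI: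
  assumes "f \<in> gmaps G X Y" "f' \<in> gmaps G X Y'" "\<And>x. x \<in> points X \<Longrightarrow> f x = f' x"
  shows "f = f'"
  using assms by (metis extensionalityI gmaps_extensional)

lemma gid_gmaps: "is_gset G X \<Longrightarrow> gid X \<in> gmaps G X X"
  by (rule gmapsI) (auto simp: gid_def gset_act_closed)

lemma compose_gmaps:
  assumes "is_gset G X" "f \<in> gmaps G X Y" "g \<in> gmaps G Y Z"
  shows "compose (points X) g f \<in> gmaps G X Z"
  using assms by (intro gmapsI) (auto simp: compose_def gmaps_closed gmaps_equivariant gset_act_closed)

lemma restrict_gmaps:
  assumes "is_gset G X" "\<And>x. x \<in> points X \<Longrightarrow> f x \<in> points Y"
    and "\<And>g x. g \<in> carrier G \<Longrightarrow> x \<in> points X \<Longrightarrow> f (act X g x) = act Y g (f x)"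
  shows "restrict f (points X) \<in> gmaps G X Y"
  using assms by (intro gmapsI) (auto simp: gset_act_closed)

lemma inverse_gmaps:
  assumes X: "is_gset G X" and Y: "is_gset G Y" and f: "f \<in> gmaps G X Y"
    and bij: "bij_betw f (points X) (points Y)"
  shows "restrict (inv_into (points X) f) (points Y) \<in> gmaps G Y X"
proof (rule restrict_gmaps[OF Y])
  show c: "inv_into (points X) f y \<in> points X" if "y \<in> points Y" for y
    using bij that by (metis bij_betw_imp_surj_on inv_into_into)
  fix g y assume g: "g \<in> carrier G" and y: "y \<in> points Y"
  have "f (act X g (inv_into (points X) f y)) = act Y g y"
    using f g c[OF y] y bij by (simp add: gmaps_equivariant bij_betw_inv_into_right)
  then show "inv_into (points X) f (act Y g y) = act X g (inv_into (points X) f y)"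
    using bij by (metis X c g gset_act_closed bij_betw_inv_into_left y)
qed

definition sub_gset :: "'a gset \<Rightarrow> nat set \<Rightarrow> 'a gset" where
  "sub_gset X Y = \<lparr>points = Y, act = (\<lambda>g\<in>carrier G. \<lambda>x\<in>Y. act X g x)\<rparr>"

lemma points_sub_gset [simp]: "points (sub_gset X Y) = Y"
  and act_sub_gset [simp]: "g \<in> carrier G \<Longrightarrow> x \<in> Y \<Longrightarrow> act (sub_gset X Y) g x = act X g x"
  by (auto simp: sub_gset_def)

lemma sub_gset:
  assumes "is_gset G X" "Y \<subseteq> points X"
    and "\<And>g y. g \<in> carrier G \<Longrightarrow> y \<in> Y \<Longrightarrow> act X g y \<in> Y"
  shows "is_gset G (sub_gset X Y)"
proof -
  have "finite Y" using assms gset_finite finite_subset by blast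
  then show ?thesis using assms
    by (intro is_gsetI)
       (auto simp: sub_gset_def gset_act_one gset_act_mult subsetD)
qed

lemma gid_sub_gset_gmaps:
  assumes "Y \<subseteq> points X" "\<And>g y. g \<in> carrier G \<Longrightarrow> y \<in> Y \<Longrightarrow> act X g y \<in> Y"
  shows "gid (sub_gset X Y) \<in> gmaps G (sub_gset X Y) X"
  using assms by (intro gmapsI) (auto simp: gid_def)

lemma gset_empty: "is_gset G (gset_empty G)"
  by (rule is_gsetI) (auto simp: gset_empty_def)

lemma points_gset_empty [simp]: "points (gset_empty G) = {}"
  by (simp add: gset_empty_def)

lemma gid_gset_empty_gmaps: "gid (gset_empty G) \<in> gmaps G (gset_empty G) X"
  by (rule gmapsI) (auto simp: gid_def)

lemma gset_with_no_points:
  assumes "is_gset G X" "points X = {}"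
  shows "X = gset_empty G"
proof -
  have "act X = act (gset_empty G)"
  proof (rule extensionalityI[where A = "carrier G"])
    fix g assume "g \<in> carrier G"
    then have "act X g \<in> {} \<rightarrow>\<^sub>E {}" using assms unfolding is_gset_iff by (metis)
    then show "act X g = act (gset_empty G) g"
      using \<open>g \<in> carrier G\<close> by (auto simp: gset_empty_def)
  qed (use assms gset_empty in \<open>auto simp: is_gset_iff\<close>)
  then show ?thesis using assms(2) by (intro gset.equality) auto
qed

lemma points_gset_sum: "points (gset_sum G X Y) = sum_encode ` (points X <+> points Y)"
  by (simp add: gset_sum_def)

lemma act_gset_sum:
  assumes "g \<in> carrier G"
  shows "x \<in> points X \<Longrightarrow>
      act (gset_sum G X Y) g (sum_encode (Inl x)) = sum_encode (Inl (act X g x))"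
    and "y \<in> points Y \<Longrightarrow>
      act (gset_sum G X Y) g (sum_encode (Inr y)) = sum_encode (Inr (act Y g y))"
  using assms by (auto simp: gset_sum_def)

lemma gset_sum_cases:
  assumes "n \<in> points (gset_sum G X Y)"
  obtains (inl) x where "x \<in> points X" "n = sum_encode (Inl x)"
    | (inr) y where "y \<in> points Y" "n = sum_encode (Inr y)"
  using assms by (auto simp: points_gset_sum)

lemma gset_sum:
  assumes "is_gset G X" "is_gset G Y"
  shows "is_gset G (gset_sum G X Y)"
proof (rule is_gsetI)
  show "finite (points (gset_sum G X Y))"
    using assms by (simp add: points_gset_sum gset_finite)
  show "act (gset_sum G X Y) \<in> extensional (carrier G)"
    by (simp add: gset_sum_def)
  show "act (gset_sum G X Y) g \<in> extensional (points (gset_sum G X Y))" if "g \<in> carrier G" for g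
    using that by (simp add: gset_sum_def)
  show "act (gset_sum G X Y) g n \<in> points (gset_sum G X Y)"
    if "g \<in> carrier G" "n \<in> points (gset_sum G X Y)" for g n
    using that(2) assms that(1)
    by (cases rule: gset_sum_cases) (auto simp: act_gset_sum points_gset_sum gset_act_closed)
  show "act (gset_sum G X Y) \<one> n = n" if "n \<in> points (gset_sum G X Y)" for n
    using that assms
    by (cases rule: gset_sum_cases) (auto simp: act_gset_sum gset_act_one)
  show "act (gset_sum G X Y) (g \<otimes> h) n = act (gset_sum G X Y) g (act (gset_sum G X Y) h n)"
    if "g \<in> carrier G" "h \<in> carrier G" "n \<in> points (gset_sum G X Y)" for g h n
    using that(3) assms that(1,2)
    by (cases rule: gset_sum_cases) (auto simp: act_gset_sum gset_act_mult gset_act_closed)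
qed

lemma gset_inl_apply [simp]: "x \<in> points X \<Longrightarrow> gset_inl X x = sum_encode (Inl x)"
  and gset_inr_apply [simp]: "y \<in> points Y \<Longrightarrow> gset_inr Y y = sum_encode (Inr y)"
  by (auto simp: gset_inl_def gset_inr_def)

lemma gset_fold_apply [simp]:
  "x \<in> points X \<Longrightarrow> gset_fold X (sum_encode (Inl x)) = x"
  "x \<in> points X \<Longrightarrow> gset_fold X (sum_encode (Inr x)) = x"
  by (auto simp: gset_fold_def)

lemma gset_inl_gmaps: "is_gset G X \<Longrightarrow> gset_inl X \<in> gmaps G X (gset_sum G X Y)"
  by (rule gmapsI)
     (auto simp: points_gset_sum act_gset_sum gset_act_closed, simp add: gset_inl_def)

lemma gset_inr_gmaps: "is_gset G Y \<Longrightarrow> gset_inr Y \<in> gmaps G Y (gset_sum G X Y)"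
  by (rule gmapsI)
     (auto simp: points_gset_sum act_gset_sum gset_act_closed, simp add: gset_inr_def)

definition sum_case_map :: "'a gset \<Rightarrow> 'a gset \<Rightarrow> (nat \<Rightarrow> nat) \<Rightarrow> (nat \<Rightarrow> nat) \<Rightarrow> nat \<Rightarrow> nat" where
  "sum_case_map X Y f h = (\<lambda>n\<in>points (gset_sum G X Y). case_sum f h (sum_decode n))"

lemma sum_case_map_apply [simp]:
  "x \<in> points X \<Longrightarrow> sum_case_map X Y f h (sum_encode (Inl x)) = f x"
  "y \<in> points Y \<Longrightarrow> sum_case_map X Y f h (sum_encode (Inr y)) = h y"
  by (auto simp: sum_case_map_def points_gset_sum)

lemma sum_case_map_gmaps:
  assumes "is_gset G X" "is_gset G Y" "f \<in> gmaps G X Z" "h \<in> gmaps G Y Z"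
  shows "sum_case_map X Y f h \<in> gmaps G (gset_sum G X Y) Z"
proof (rule gmapsI)
  show "sum_case_map X Y f h \<in> extensional (points (gset_sum G X Y))"
    by (simp add: sum_case_map_def)
  show "sum_case_map X Y f h n \<in> points Z" if "n \<in> points (gset_sum G X Y)" for n
    using that assms by (cases rule: gset_sum_cases) (auto simp: gmaps_closed)
  show "sum_case_map X Y f h (act (gset_sum G X Y) g n) = act Z g (sum_case_map X Y f h n)"
    if "g \<in> carrier G" "n \<in> points (gset_sum G X Y)" for g n
    using that(2) assms that(1)
    by (cases rule: gset_sum_cases) (auto simp: act_gset_sum gmaps_equivariant gset_act_closed)
qed

lemma gset_fold_eq: "gset_fold X = sum_case_map X X (gid X) (gid X)"
  by (auto simp: gset_fold_def sum_case_map_def points_gset_sum gid_def fun_eq_iff split: sum.split)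

lemma gset_fold_gmaps: "is_gset G X \<Longrightarrow> gset_fold X \<in> gmaps G (gset_sum G X X) X"
  by (simp add: gset_fold_eq sum_case_map_gmaps gid_gmaps)

text \<open>
  A set \<open>Q\<close> of pairs with the diagonal action.  Pairs are coded as numbers because the points of a
  \<open>G\<close>-set are numbers.
\<close>

definition pair_gset :: "'a gset \<Rightarrow> 'a gset \<Rightarrow> (nat \<times> nat) set \<Rightarrow> 'a gset" where
  "pair_gset X Y Q = \<lparr>points = prod_encode ` Q,
     act = (\<lambda>g\<in>carrier G. \<lambda>n\<in>prod_encode ` Q.
              prod_encode (map_prod (act X g) (act Y g) (prod_decode n)))\<rparr>"

lemma points_pair_gset: "points (pair_gset X Y Q) = prod_encode ` Q"
  and act_pair_gset: "g \<in> carrier G \<Longrightarrow> (x, y) \<in> Q \<Longrightarrow>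
        act (pair_gset X Y Q) g (prod_encode (x, y)) = prod_encode (act X g x, act Y g y)"
  by (auto simp: pair_gset_def)

lemma pair_gset:
  assumes "is_gset G X" "is_gset G Y" "Q \<subseteq> points X \<times> points Y"
    and "\<And>g x y. g \<in> carrier G \<Longrightarrow> (x, y) \<in> Q \<Longrightarrow> (act X g x, act Y g y) \<in> Q"
  shows "is_gset G (pair_gset X Y Q)"
proof -
  have "finite Q" using assms gset_finite by (meson finite_SigmaI finite_subset)
  moreover have "x \<in> points X \<and> y \<in> points Y" if "(x, y) \<in> Q" for x y using assms(3) that by auto
  ultimately show ?thesis using assms(1,2,4)
    by (intro is_gsetI)
       (auto simp: points_pair_gset act_pair_gset gset_act_one gset_act_mult,
        auto simp: pair_gset_def)
qed

definition pair_fst :: "(nat \<times> nat) set \<Rightarrow> nat \<Rightarrow> nat" where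
  "pair_fst Q = (\<lambda>n\<in>prod_encode ` Q. fst (prod_decode n))"

definition pair_snd :: "(nat \<times> nat) set \<Rightarrow> nat \<Rightarrow> nat" where
  "pair_snd Q = (\<lambda>n\<in>prod_encode ` Q. snd (prod_decode n))"

lemma pair_fst_apply [simp]: "(x, y) \<in> Q \<Longrightarrow> pair_fst Q (prod_encode (x, y)) = x"
  and pair_snd_apply [simp]: "(x, y) \<in> Q \<Longrightarrow> pair_snd Q (prod_encode (x, y)) = y"
  by (auto simp: pair_fst_def pair_snd_def)

lemma pair_projections_gmaps:
  assumes "Q \<subseteq> points X \<times> points Y"
    and "\<And>g x y. g \<in> carrier G \<Longrightarrow> (x, y) \<in> Q \<Longrightarrow> (act X g x, act Y g y) \<in> Q"
  shows "pair_fst Q \<in> gmaps G (pair_gset X Y Q) X" "pair_snd Q \<in> gmaps G (pair_gset X Y Q) Y"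
proof -
  show "pair_fst Q \<in> gmaps G (pair_gset X Y Q) X"
    using assms by (intro gmapsI)
      (auto simp: points_pair_gset act_pair_gset, auto simp: pair_fst_def)
  show "pair_snd Q \<in> gmaps G (pair_gset X Y Q) Y"
    using assms by (intro gmapsI)
      (auto simp: points_pair_gset act_pair_gset, auto simp: pair_snd_def)
qed

lemma pair_gset_pullback:
  assumes X: "is_gset G X" and Y: "is_gset G Y" and f: "f \<in> gmaps G X Z" and h: "h \<in> gmaps G Y Z"
  defines "Q \<equiv> {(x, y) \<in> points X \<times> points Y. f x = h y}"
  shows "is_pullback G (pair_gset X Y Q) (pair_fst Q) (pair_snd Q) X f Y h"
proof -
  have Q: "Q \<subseteq> points X \<times> points Y"
    and st: "\<And>g x y. g \<in> carrier G \<Longrightarrow> (x, y) \<in> Q \<Longrightarrow> (act X g x, act Y g y) \<in> Q"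
    using assms by (auto simp: Q_def gset_act_closed gmaps_equivariant)
  have "bij_betw (\<lambda>w. (pair_fst Q w, pair_snd Q w)) (points (pair_gset X Y Q)) Q"
    by (rule bij_betw_byWitness[where f' = prod_encode]) (auto simp: points_pair_gset)
  then show ?thesis
    unfolding is_pullback_def
    using pair_gset[OF X Y Q st] pair_projections_gmaps[OF Q st] by (simp add: Q_def)
qed

end

section \<open>Isomorphisms and composites of bispans\<close>

abbreviation tops :: "'g bispan \<Rightarrow> nat set" where "tops D \<equiv> points (bispan.top D)"
abbreviation mids :: "'g bispan \<Rightarrow> nat set" where "mids D \<equiv> points (mid D)"

definition bispan_hom ::
    "('g, 'b) monoid_scheme \<Rightarrow> 'g bispan \<Rightarrow> 'g bispan \<Rightarrow> (nat \<Rightarrow> nat) \<Rightarrow> (nat \<Rightarrow> nat) \<Rightarrow> bool" where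
  "bispan_hom G D D' a b \<longleftrightarrow>
     src D = src D' \<and> tgt D = tgt D' \<and>
     a \<in> gmaps G (bispan.top D) (bispan.top D') \<and> b \<in> gmaps G (mid D) (mid D') \<and>
     (\<forall>x\<in>tops D. lmap D' (a x) = lmap D x) \<and>
     (\<forall>x\<in>tops D. mmap D' (a x) = b (mmap D x)) \<and>
     (\<forall>y\<in>mids D. rmap D' (b y) = rmap D y)"

lemma bispan_iso_iff:
  "(D, D') \<in> bispan_iso G \<longleftrightarrow> is_bispan G D \<and> is_bispan G D' \<and>
     (\<exists>a b. bispan_hom G D D' a b \<and> bij_betw a (tops D) (tops D') \<and>
            bij_betw b (mids D) (mids D'))"
  unfolding bispan_iso_def bispan_hom_def by auto

context group
begin

lemma bispan_closed:
  assumes "is_bispan G D"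
  shows "is_gset G (src D)" "is_gset G (bispan.top D)" "is_gset G (mid D)" "is_gset G (tgt D)"
    "lmap D \<in> gmaps G (bispan.top D) (src D)" "mmap D \<in> gmaps G (bispan.top D) (mid D)"
    "rmap D \<in> gmaps G (mid D) (tgt D)"
  using assms by (auto simp: is_bispan_def)

lemma bispan_points_closed:
  assumes "is_bispan G D"
  shows "x \<in> tops D \<Longrightarrow> lmap D x \<in> points (src D)"
    "x \<in> tops D \<Longrightarrow> mmap D x \<in> mids D"
    "y \<in> mids D \<Longrightarrow> rmap D y \<in> points (tgt D)"
  using bispan_closed[OF assms] by (auto simp: gmaps_closed)

lemma bispan_equivariant:
  assumes "is_bispan G D" "g \<in> carrier G"
  shows "x \<in> tops D \<Longrightarrow> lmap D (act (bispan.top D) g x) = act (src D) g (lmap D x)"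
    "x \<in> tops D \<Longrightarrow> mmap D (act (bispan.top D) g x) = act (mid D) g (mmap D x)"
    "y \<in> mids D \<Longrightarrow> rmap D (act (mid D) g y) = act (tgt D) g (rmap D y)"
    "x \<in> tops D \<Longrightarrow> act (bispan.top D) g x \<in> tops D"
    "y \<in> mids D \<Longrightarrow> act (mid D) g y \<in> mids D"
  using bispan_closed[OF assms(1)] assms(2) by (auto simp: gmaps_equivariant gset_act_closed)

lemma bispan_homD:
  assumes "bispan_hom G D D' a b"
  shows "src D = src D'" "tgt D = tgt D'"
    "a \<in> gmaps G (bispan.top D) (bispan.top D')" "b \<in> gmaps G (mid D) (mid D')"
    "x \<in> tops D \<Longrightarrow> lmap D' (a x) = lmap D x"
    "x \<in> tops D \<Longrightarrow> mmap D' (a x) = b (mmap D x)"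
    "y \<in> mids D \<Longrightarrow> rmap D' (b y) = rmap D y"
    "x \<in> tops D \<Longrightarrow> a x \<in> tops D'"
    "y \<in> mids D \<Longrightarrow> b y \<in> mids D'"
    "g \<in> carrier G \<Longrightarrow> x \<in> tops D
       \<Longrightarrow> a (act (bispan.top D) g x) = act (bispan.top D') g (a x)"
    "g \<in> carrier G \<Longrightarrow> y \<in> mids D \<Longrightarrow> b (act (mid D) g y) = act (mid D') g (b y)"
  using assms by (auto simp: bispan_hom_def gmaps_closed gmaps_equivariant)

lemma gid_apply: "x \<in> points X \<Longrightarrow> gid X x = x"
  by (simp add: gid_def)

lemma bispan_iso_refl: "is_bispan G D \<Longrightarrow> (D, D) \<in> bispan_iso G"
  unfolding bispan_iso_iff bispan_hom_def
  by (intro conjI exI[where x = "gid (bispan.top D)"] exI[where x = "gid (mid D)"])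
     (auto simp: gid_gmaps bispan_closed bispan_points_closed gid_apply bij_betw_def inj_on_def)

lemma bispan_iso_sym:
  assumes "(D, D') \<in> bispan_iso G"
  shows "(D', D) \<in> bispan_iso G"
proof -
  let ?A = "tops D" and ?A' = "tops D'"
  let ?B = "mids D" and ?B' = "mids D'"
  from assms obtain a b where D: "is_bispan G D" "is_bispan G D'" and h: "bispan_hom G D D' a b"
    and a: "bij_betw a ?A ?A'" and b: "bij_betw b ?B ?B'"
    by (auto simp: bispan_iso_iff)
  let ?a = "restrict (inv_into ?A a) ?A'" and ?b = "restrict (inv_into ?B b) ?B'"
  note hD = bispan_homD[OF h]
  have a': "inv_into ?A a x \<in> ?A" "a (inv_into ?A a x) = x" if "x \<in> ?A'" for x
    using a that by (metis bij_betw_def inv_into_into, metis bij_betw_inv_into_right)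
  have b': "inv_into ?B b y \<in> ?B" "b (inv_into ?B b y) = y" if "y \<in> ?B'" for y
    using b that by (metis bij_betw_def inv_into_into, metis bij_betw_inv_into_right)
  have "bispan_hom G D' D ?a ?b"
    unfolding bispan_hom_def
  proof (intro conjI ballI)
    show "?a \<in> gmaps G (bispan.top D') (bispan.top D)" "?b \<in> gmaps G (mid D') (mid D)"
      using inverse_gmaps D a b hD by (auto simp: bispan_closed)
    fix x assume x: "x \<in> ?A'"
    show "lmap D (?a x) = lmap D' x"
      using hD(5)[OF a'(1)[OF x]] a'[OF x] x by simp
    have "b (mmap D (inv_into ?A a x)) = mmap D' x"
      using hD(6)[OF a'(1)[OF x]] a'[OF x] by simp
    moreover have "mmap D (inv_into ?A a x) \<in> ?B"
      using a'(1)[OF x] D(1) by (simp add: bispan_points_closed)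
    ultimately have "mmap D (inv_into ?A a x) = inv_into ?B b (mmap D' x)"
      using b by (metis bij_betw_inv_into_left)
    then show "mmap D (?a x) = ?b (mmap D' x)"
      using x D(2) by (simp add: bispan_points_closed)
  next
    fix y assume y: "y \<in> ?B'"
    show "rmap D (?b y) = rmap D' y"
      using hD(7)[OF b'(1)[OF y]] b'[OF y] y by simp
  qed (use hD in auto)
  moreover have "bij_betw ?a ?A' ?A" "bij_betw ?b ?B' ?B"
    using a b by (simp_all add: bij_betw_inv_into)
  ultimately show ?thesis using D unfolding bispan_iso_iff by blast
qed

lemma bispan_iso_trans:
  assumes "(D, D') \<in> bispan_iso G" "(D', D'') \<in> bispan_iso G"
  shows "(D, D'') \<in> bispan_iso G"
proof -
  from assms obtain a b a' b' where D: "is_bispan G D" "is_bispan G D'" "is_bispan G D''"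
    and h: "bispan_hom G D D' a b" "bispan_hom G D' D'' a' b'"
    and bij: "bij_betw a (tops D) (tops D')"
      "bij_betw b (mids D) (mids D')"
      "bij_betw a' (tops D') (tops D'')"
      "bij_betw b' (mids D') (mids D'')"
    by (auto simp: bispan_iso_iff)
  let ?a = "compose (tops D) a' a" and ?b = "compose (mids D) b' b"
  have "bispan_hom G D D'' ?a ?b"
    unfolding bispan_hom_def
  proof (intro conjI ballI)
    show "?a \<in> gmaps G (bispan.top D) (bispan.top D'')" "?b \<in> gmaps G (mid D) (mid D'')"
      using bispan_homD(3,4)[OF h(1)] bispan_homD(3,4)[OF h(2)] D
      by (auto intro: compose_gmaps simp: bispan_closed)
  qed (use bispan_homD[OF h(1)] bispan_homD[OF h(2)] D in
        \<open>auto simp: bispan_points_closed compose_eq\<close>)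
  moreover have "bij_betw ?a (tops D) (tops D'')"
    "bij_betw ?b (mids D) (mids D'')"
    using bij by (meson bij_betw_compose)+
  ultimately show ?thesis using D unfolding bispan_iso_iff by blast
qed

lemma bispan_class_eq: "(D, D') \<in> bispan_iso G \<Longrightarrow> bispan_class G D = bispan_class G D'"
  unfolding bispan_class_def using bispan_iso_sym bispan_iso_trans by blast

lemma bispan_class_self: "is_bispan G D \<Longrightarrow> D \<in> bispan_class G D"
  by (simp add: bispan_class_def bispan_iso_refl)

lemma bispan_class_eq_iff:
  "is_bispan G D \<Longrightarrow> bispan_class G D' = bispan_class G D \<longleftrightarrow> (D', D) \<in> bispan_iso G"
  using bispan_class_self[of D] bispan_class_eq[of D' D] by (auto simp: bispan_class_def)

lemma Hom_bispan_cat: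
  "c \<in> Hom (bispan_cat G) X Y \<longleftrightarrow>
     (\<exists>D. is_bispan G D \<and> src D = X \<and> tgt D = Y \<and> c = bispan_class G D)"
  by (auto simp: bispan_cat_def quotient_def bispan_class_def)

lemma Ob_bispan_cat [simp]: "X \<in> Ob (bispan_cat G) \<longleftrightarrow> is_gset G X"
  by (simp add: bispan_cat_def)

text \<open>
  Injections in opposite directions between finite sets are bijective.  This turns a one-sided
  construction of injective comparison maps, applied in both directions, into an isomorphism.
\<close>

lemma bispan_iso_antisym:
  assumes D: "is_bispan G D" "is_bispan G D'"
    and h: "bispan_hom G D D' a b" and inj: "inj_on a (tops D)" "inj_on b (mids D)"
    and h': "bispan_hom G D' D a' b'"
      and inj': "inj_on a' (tops D')" "inj_on b' (mids D')"
  shows "(D, D') \<in> bispan_iso G"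
proof -
  have bij: "bij_betw f A B"
    if "finite A" "finite B" "inj_on f A" "f ` A \<subseteq> B" "inj_on f' B" "f' ` B \<subseteq> A"
    for f f' :: "nat \<Rightarrow> nat" and A B
    using that by (metis bij_betw_def card_image card_mono card_subset_eq order_antisym)
  have "bij_betw a (tops D) (tops D')"
    by (rule bij[OF _ _ inj(1) _ inj'(1)])
       (use D bispan_homD[OF h] bispan_homD[OF h'] in \<open>auto simp: bispan_closed gset_finite\<close>)
  moreover have "bij_betw b (mids D) (mids D')"
    by (rule bij[OF _ _ inj(2) _ inj'(2)])
       (use D bispan_homD[OF h] bispan_homD[OF h'] in \<open>auto simp: bispan_closed gset_finite\<close>)
  ultimately show ?thesis using D h unfolding bispan_iso_iff by blast
qed

end

text \<open>
  For bispans \<open>S\<close> from \<open>X\<close> to \<open>Y\<close> and \<open>T\<close> from \<open>Y\<close> to \<open>Z\<close>, the middle set of the composite consists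
  of the pairs of a point \<open>d\<close> of \<open>mid T\<close> and a section over the fibre at \<open>d\<close> of the pullback of
  \<open>mid S\<close> and \<open>top T\<close> over \<open>Y\<close>.  Such a section is the same as a map \<open>c \<mapsto> b\<close> from the fibre to
  \<open>mid S\<close> such that \<open>b\<close> and \<open>c\<close> have the same image in \<open>Y\<close>, so the pullback itself can be left out.
\<close>

definition fibre :: "'g bispan \<Rightarrow> nat \<Rightarrow> nat set" where
  "fibre D d = {c \<in> tops D. mmap D c = d}"

definition sections :: "'g bispan \<Rightarrow> 'g bispan \<Rightarrow> nat \<Rightarrow> (nat \<Rightarrow> nat) set" where
  "sections S T d = (\<Pi>\<^sub>E c\<in>fibre T d. {b \<in> mids S. rmap S b = lmap T c})"

text \<open>
  The bispan \<open>U\<close> is a composite of \<open>S\<close> followed by \<open>T\<close>, where the point \<open>e\<close> of \<open>mid U\<close> stands for the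
  pair of \<open>r e\<close> and the section \<open>\<sigma> e\<close>, and the point \<open>t\<close> of \<open>top U\<close> stands for the triple of
  \<open>s t \<in> top S\<close>, \<open>k t \<in> top T\<close> and \<open>mmap U t \<in> mid U\<close>: the composite contains exactly the triples
  \<open>(x, c, e)\<close> with \<open>c\<close> in the fibre at \<open>r e\<close> and \<open>mmap S x = \<sigma> e c\<close>.
\<close>

definition composite_via ::
    "('g, 'b) monoid_scheme \<Rightarrow> 'g bispan \<Rightarrow> 'g bispan \<Rightarrow> 'g bispan
      \<Rightarrow> (nat \<Rightarrow> nat) \<Rightarrow> (nat \<Rightarrow> nat \<Rightarrow> nat) \<Rightarrow> (nat \<Rightarrow> nat) \<Rightarrow> (nat \<Rightarrow> nat) \<Rightarrow> bool" where
  "composite_via G S T U r \<sigma> s k \<longleftrightarrow>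
     is_bispan G S \<and> is_bispan G T \<and> is_bispan G U \<and>
     tgt S = src T \<and> src U = src S \<and> tgt U = tgt T \<and>
     r \<in> gmaps G (mid U) (mid T) \<and>
     (\<forall>e\<in>mids U. \<sigma> e \<in> sections S T (r e)) \<and>
     (\<forall>d\<in>mids T. \<forall>\<tau>\<in>sections S T d. \<exists>!e. e \<in> mids U \<and> r e = d \<and> \<sigma> e = \<tau>) \<and>
     (\<forall>g\<in>carrier G. \<forall>e\<in>mids U. \<forall>c\<in>fibre T (r e).
        \<sigma> (act (mid U) g e) (act (bispan.top T) g c) = act (mid S) g (\<sigma> e c)) \<and>
     s \<in> gmaps G (bispan.top U) (bispan.top S) \<and> k \<in> gmaps G (bispan.top U) (bispan.top T) \<and>
     (\<forall>t\<in>tops U.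
        mmap T (k t) = r (mmap U t) \<and> mmap S (s t) = \<sigma> (mmap U t) (k t)) \<and>
     (\<forall>x\<in>tops S. \<forall>e\<in>mids U. \<forall>c\<in>fibre T (r e). mmap S x = \<sigma> e c \<longrightarrow>
        (\<exists>!t. t \<in> tops U \<and> s t = x \<and> k t = c \<and> mmap U t = e)) \<and>
     (\<forall>t\<in>tops U. lmap U t = lmap S (s t)) \<and>
     (\<forall>e\<in>mids U. rmap U e = rmap T (r e))"

context group
begin

lemma composite_viaD:
  assumes "composite_via G S T U r \<sigma> s k"
  shows "is_bispan G S" "is_bispan G T" "is_bispan G U"
    "tgt S = src T" "src U = src S" "tgt U = tgt T"
    "r \<in> gmaps G (mid U) (mid T)"
    "e \<in> mids U \<Longrightarrow> \<sigma> e \<in> sections S T (r e)"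
    "d \<in> mids T \<Longrightarrow> \<tau> \<in> sections S T d \<Longrightarrow> \<exists>!e. e \<in> mids U \<and> r e = d \<and> \<sigma> e = \<tau>"
    "g \<in> carrier G \<Longrightarrow> e \<in> mids U \<Longrightarrow> c \<in> fibre T (r e) \<Longrightarrow>
        \<sigma> (act (mid U) g e) (act (bispan.top T) g c) = act (mid S) g (\<sigma> e c)"
    "s \<in> gmaps G (bispan.top U) (bispan.top S)" "k \<in> gmaps G (bispan.top U) (bispan.top T)"
    "t \<in> tops U \<Longrightarrow> mmap T (k t) = r (mmap U t)"
    "t \<in> tops U \<Longrightarrow> mmap S (s t) = \<sigma> (mmap U t) (k t)"
    "x \<in> tops S \<Longrightarrow> e \<in> mids U \<Longrightarrow> c \<in> fibre T (r e) \<Longrightarrow> mmap S x = \<sigma> e c \<Longrightarrow>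
        \<exists>!t. t \<in> tops U \<and> s t = x \<and> k t = c \<and> mmap U t = e"
    "t \<in> tops U \<Longrightarrow> lmap U t = lmap S (s t)"
    "e \<in> mids U \<Longrightarrow> rmap U e = rmap T (r e)"
  using assms unfolding composite_via_def by blast+

text \<open>
  Isomorphisms \<open>S \<cong> S'\<close> and \<open>T \<cong> T'\<close> carry sections to sections, and thereby pairs and triples for
  \<open>U\<close> to pairs and triples for \<open>U'\<close>.  By \<open>bispan_iso_antisym\<close> it suffices that the resulting map is
  injective.
\<close>

lemma composite_via_comparison:
  assumes v: "composite_via G S T U r \<sigma> s k" and v': "composite_via G S' T' U' r' \<sigma>' s' k'"
    and S: "(S, S') \<in> bispan_iso G" and T: "(T, T') \<in> bispan_iso G"
  shows "\<exists>a b. bispan_hom G U U' a b \<and> inj_on a (tops U) \<and> inj_on b (mids U)"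
proof -
  note c = composite_viaD[OF v] and c' = composite_viaD[OF v']
  from S obtain aS bS where hS: "bispan_hom G S S' aS bS"
    and aS: "bij_betw aS (tops S) (tops S')"
    and bS: "bij_betw bS (mids S) (mids S')"
    by (auto simp: bispan_iso_iff)
  from T obtain aT bT where hT: "bispan_hom G T T' aT bT"
    and aT: "bij_betw aT (tops T) (tops T')"
    and bT: "bij_betw bT (mids T) (mids T')"
    by (auto simp: bispan_iso_iff)
  note hS' = bispan_homD[OF hS] and hT' = bispan_homD[OF hT]
  define iT where "iT = inv_into (tops T) aT"
  have iT: "iT (aT x) = x" if "x \<in> tops T" for x
    using aT that by (simp add: iT_def bij_betw_inv_into_left)
  have fib: "fibre T' (bT d) = aT ` fibre T d" if "d \<in> mids T" for d
  proof
    show "aT ` fibre T d \<subseteq> fibre T' (bT d)" using hT' by (auto simp: fibre_def)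
    show "fibre T' (bT d) \<subseteq> aT ` fibre T d"
    proof
      fix x assume x: "x \<in> fibre T' (bT d)"
      then obtain z where z: "z \<in> tops T" "x = aT z"
        using aT by (auto simp: fibre_def bij_betw_def)
      then have "bT (mmap T z) = bT d" using x hT' by (simp add: fibre_def)
      then have "mmap T z = d"
        using bT that z(1) c(2) by (metis bij_betw_def bispan_points_closed(2) inj_onD)
      then show "x \<in> aT ` fibre T d" using z by (auto simp: fibre_def)
    qed
  qed
  \<comment> \<open>The section \<open>\<sigma> e\<close> transported along the isomorphisms.\<close>
  define \<tau> where "\<tau> e = (\<lambda>y\<in>fibre T' (bT (r e)). bS (\<sigma> e (iT y)))" for e
  have re: "r e \<in> mids T" if "e \<in> mids U" for e
    using c(7) that by (rule gmaps_closed)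
  have \<sigma>: "\<sigma> e z \<in> mids S" "rmap S (\<sigma> e z) = lmap T z"
    if "e \<in> mids U" "z \<in> fibre T (r e)" for e z
    using c(8)[OF that(1)] that(2) by (auto simp: sections_def)
  have \<tau>_apply: "\<tau> e (aT z) = bS (\<sigma> e z)" if "e \<in> mids U" "z \<in> fibre T (r e)" for e z
    using fib[OF re[OF that(1)]] that by (auto simp: \<tau>_def iT fibre_def)
  have \<tau>: "\<tau> e \<in> sections S' T' (bT (r e))" if e: "e \<in> mids U" for e
    unfolding sections_def
  proof (rule PiE_I)
    fix y assume "y \<in> fibre T' (bT (r e))"
    then obtain z where z: "z \<in> fibre T (r e)" "y = aT z" using fib[OF re[OF e]] by auto
    then have zt: "z \<in> tops T" by (simp add: fibre_def)
    show "\<tau> e y \<in> {b \<in> mids S'. rmap S' b = lmap T' y}"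
      using z zt e hS' hT' \<sigma>[OF e z(1)] by (simp add: \<tau>_apply)
  qed (simp add: \<tau>_def)
  define b where "b = (\<lambda>e\<in>mids U.
    THE e'. e' \<in> mids U' \<and> r' e' = bT (r e) \<and> \<sigma>' e' = \<tau> e)"
  have ex_b: "\<exists>!e'. e' \<in> mids U' \<and> r' e' = bT (r e) \<and> \<sigma>' e' = \<tau> e"
    if "e \<in> mids U" for e
    using c'(9)[OF _ \<tau>[OF that]] re[OF that] hT' by simp
  have b: "b e \<in> mids U'" "r' (b e) = bT (r e)" "\<sigma>' (b e) = \<tau> e"
    if "e \<in> mids U" for e
    using theI'[OF ex_b[OF that]] that by (simp_all add: b_def)
  have b_unique: "b e = e'" if "e \<in> mids U" "e' \<in> mids U'" "r' e' = bT (r e)" "\<sigma>' e' = \<tau> e"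
    for e e' using ex_b[OF that(1)] b[OF that(1)] that by blast
  have ge: "act (mid U) g e \<in> mids U" "r (act (mid U) g e) = act (mid T) g (r e)"
    if "g \<in> carrier G" "e \<in> mids U" for g e
    using that c(3,7) by (auto simp: gmaps_equivariant bispan_equivariant)
  have b_gmap: "b \<in> gmaps G (mid U) (mid U')"
  proof (rule gmapsI)
    fix g e assume g: "g \<in> carrier G" and e: "e \<in> mids U"
    let ?e = "act (mid U) g e" and ?e' = "act (mid U') g (b e)"
    have e'_in: "?e' \<in> mids U'" using b(1)[OF e] c'(3) g by (simp add: bispan_equivariant)
    have r_eq: "r' ?e' = bT (r ?e)"
      using g e b[OF e] c'(7) re[OF e] ge[OF g e] hT' by (simp add: gmaps_equivariant)
    have "\<sigma>' ?e' = \<tau> ?e"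
    proof (rule extensionalityI[where A = "fibre T' (bT (r ?e))"])
      show "\<sigma>' ?e' \<in> extensional (fibre T' (bT (r ?e)))"
        using c'(8)[OF e'_in] r_eq by (simp add: sections_def PiE_def)
      show "\<tau> ?e \<in> extensional (fibre T' (bT (r ?e)))" by (simp add: \<tau>_def)
      fix y assume "y \<in> fibre T' (bT (r ?e))"
      then obtain z where z: "z \<in> fibre T (r ?e)" "y = aT z" using fib[OF re[OF ge(1)[OF g e]]] by auto
      let ?z = "act (bispan.top T) (inv g) z"
      have gi: "inv g \<in> carrier G" using g by simp
      have zt: "z \<in> tops T" using z by (simp add: fibre_def)
      have zz: "?z \<in> tops T" "act (bispan.top T) g ?z = z"
        using zt gi g c(2) by (auto simp: bispan_equivariant gset_act_inv bispan_closed)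
      have "mmap T ?z = act (mid T) (inv g) (mmap T z)"
        using zt gi c(2) by (simp add: bispan_equivariant)
      also have "mmap T z = act (mid T) g (r e)" using z(1) ge[OF g e] by (simp add: fibre_def)
      finally have "mmap T ?z = r e" using g re[OF e] c(2) by (simp add: gset_act_inv bispan_closed)
      then have zf: "?z \<in> fibre T (r e)" using zz by (simp add: fibre_def)
      have "\<tau> ?e y = bS (\<sigma> ?e (act (bispan.top T) g ?z))"
        using \<tau>_apply[OF ge(1)[OF g e] z(1)] z(2) zz by simp
      also have "\<dots> = act (mid S') g (\<tau> e (aT ?z))"
        using c(10)[OF g e zf] \<sigma>[OF e zf] hS' g \<tau>_apply[OF e zf] by simp
      also have "\<dots> = \<sigma>' ?e' (act (bispan.top T') g (aT ?z))"
      proof -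
        have "aT ?z \<in> fibre T' (r' (b e))" using fib[OF re[OF e]] zf b[OF e] by auto
        from c'(10)[OF g b(1)[OF e] this] show ?thesis using b(3)[OF e] by simp
      qed
      also have "act (bispan.top T') g (aT ?z) = y"
        using hT'(10)[OF g zz(1)] zz(2) z(2) by simp
      finally show "\<sigma>' ?e' y = \<tau> ?e y" by simp
    qed
    then show "b ?e = ?e'" using b_unique[OF ge(1)[OF g e] e'_in r_eq] by simp
  qed (use b in \<open>auto simp: b_def\<close>)
  have b_inj: "inj_on b (mids U)"
  proof (rule inj_onI)
    fix e1 e2 assume e: "e1 \<in> mids U" "e2 \<in> mids U" and eq: "b e1 = b e2"
    have "bT (r e1) = bT (r e2)" using b(2)[OF e(1)] b(2)[OF e(2)] eq by simp
    then have r_eq: "r e1 = r e2" using bT re[OF e(1)] re[OF e(2)] by (metis bij_betw_def inj_onD)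
    have "\<tau> e1 = \<tau> e2" using b(3)[OF e(1)] b(3)[OF e(2)] eq by simp
    then have "bS (\<sigma> e1 z) = bS (\<sigma> e2 z)" if "z \<in> fibre T (r e1)" for z
      using \<tau>_apply[OF e(1) that] \<tau>_apply[OF e(2)] that r_eq by simp
    then have "\<sigma> e1 z = \<sigma> e2 z" if z: "z \<in> fibre T (r e1)" for z
    proof -
      have "\<sigma> e1 z \<in> mids S" "\<sigma> e2 z \<in> mids S"
        using \<sigma>(1)[OF e(1) z] \<sigma>(1)[OF e(2)] z r_eq by simp_all
      with \<open>\<And>z. z \<in> fibre T (r e1) \<Longrightarrow> bS (\<sigma> e1 z) = bS (\<sigma> e2 z)\<close>[OF z] bS
      show ?thesis by (meson bij_betw_def inj_onD)
    qed
    then have \<sigma>_eq: "\<sigma> e1 = \<sigma> e2"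
      using c(8)[OF e(1)] c(8)[OF e(2)] r_eq unfolding sections_def by (intro PiE_ext) simp_all
    note ex = c(9)[OF re[OF e(1)] c(8)[OF e(1)]]
    show "e1 = e2"
      using the1_equality[OF ex, of e1] the1_equality[OF ex, of e2] e r_eq \<sigma>_eq by simp
  qed
  have su: "s t \<in> tops S" and ku: "k t \<in> tops T"
    and mu: "mmap U t \<in> mids U" and kf: "k t \<in> fibre T (r (mmap U t))"
    if "t \<in> tops U" for t
    using gmaps_closed[OF c(11) that] gmaps_closed[OF c(12) that] c(13)[OF that]
      bispan_points_closed(2)[OF c(3) that] by (simp_all add: fibre_def)
  define a where "a = (\<lambda>t\<in>tops U.
    THE t'. t' \<in> tops U' \<and> s' t' = aS (s t) \<and> k' t' = aT (k t) \<and> mmap U' t' = b (mmap U t))"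
  have ex_a: "\<exists>!t'. t' \<in> tops U' \<and> s' t' = aS (s t) \<and> k' t' = aT (k t) \<and>
      mmap U' t' = b (mmap U t)" if t: "t \<in> tops U" for t
  proof (rule c'(15))
    show "aS (s t) \<in> tops S'" using su[OF t] hS' by simp
    show "b (mmap U t) \<in> mids U'" using b mu[OF t] by simp
    show "aT (k t) \<in> fibre T' (r' (b (mmap U t)))"
      using b(2)[OF mu[OF t]] fib[OF re[OF mu[OF t]]] kf[OF t] by auto
    show "mmap S' (aS (s t)) = \<sigma>' (b (mmap U t)) (aT (k t))"
      using hS'(6)[OF su[OF t]] b(3)[OF mu[OF t]] \<tau>_apply[OF mu[OF t] kf[OF t]] c(14)[OF t] by simp
  qed
  have a: "a t \<in> tops U'" "s' (a t) = aS (s t)" "k' (a t) = aT (k t)"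
    "mmap U' (a t) = b (mmap U t)" if "t \<in> tops U" for t
    using theI'[OF ex_a[OF that]] that by (simp_all add: a_def)
  have a_gmap: "a \<in> gmaps G (bispan.top U) (bispan.top U')"
  proof (rule gmapsI)
    fix g t assume g: "g \<in> carrier G" and t: "t \<in> tops U"
    let ?t = "act (bispan.top U) g t" and ?t' = "act (bispan.top U') g (a t)"
    have tt: "?t \<in> tops U" using t g c(3) by (simp add: bispan_equivariant)
    have "?t' \<in> tops U'" using a(1)[OF t] g c'(3) by (simp add: bispan_equivariant)
    moreover have "s' ?t' = aS (s ?t)"
      using a[OF t] g t c(11) c'(11) su[OF t] hS' by (simp add: gmaps_equivariant)
    moreover have "k' ?t' = aT (k ?t)"
      using a[OF t] g t c(12) c'(12) ku[OF t] hT' by (simp add: gmaps_equivariant)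
    moreover have "mmap U' ?t' = b (mmap U ?t)"
      using a[OF t] g t c(3) c'(3) mu[OF t] b_gmap by (simp add: gmaps_equivariant bispan_equivariant)
    ultimately show "a ?t = ?t'" using ex_a[OF tt] a[OF tt] by blast
  qed (use a in \<open>auto simp: a_def\<close>)
  have a_inj: "inj_on a (tops U)"
  proof (rule inj_onI)
    fix t1 t2 assume t: "t1 \<in> tops U" "t2 \<in> tops U" and eq: "a t1 = a t2"
    have "s t1 = s t2"
      using a(2)[OF t(1)] a(2)[OF t(2)] eq su[OF t(1)] su[OF t(2)] aS by (metis bij_betw_def inj_onD)
    moreover have "k t1 = k t2"
      using a(3)[OF t(1)] a(3)[OF t(2)] eq ku[OF t(1)] ku[OF t(2)] aT by (metis bij_betw_def inj_onD)
    moreover have "mmap U t1 = mmap U t2"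
      using a(4)[OF t(1)] a(4)[OF t(2)] eq mu[OF t(1)] mu[OF t(2)] b_inj by (metis inj_onD)
    moreover note ex = c(15)[OF su[OF t(1)] mu[OF t(1)] kf[OF t(1)] c(14)[OF t(1)]]
    ultimately show "t1 = t2"
      using the1_equality[OF ex, of t1] the1_equality[OF ex, of t2] t by simp
  qed
  have "bispan_hom G U U' a b"
    unfolding bispan_hom_def
  proof (intro conjI ballI)
    show "src U = src U'" "tgt U = tgt U'" using c(5,6) c'(5,6) hS'(1) hT'(2) by simp_all
  next
    fix t assume t: "t \<in> tops U"
    show "lmap U' (a t) = lmap U t"
      using c'(16)[OF a(1)[OF t]] a(2)[OF t] hS'(5)[OF su[OF t]] c(16)[OF t] by simp
  next
    fix e assume e: "e \<in> mids U"
    show "rmap U' (b e) = rmap U e"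
      using c'(17)[OF b(1)[OF e]] b(2)[OF e] hT'(7)[OF re[OF e]] c(17)[OF e] by simp
  qed (use a_gmap b_gmap a(4) in auto)
  then show ?thesis using a_inj b_inj by blast
qed

lemma composite_unique:
  assumes "composite_via G S T U r \<sigma> s k" "composite_via G S' T' U' r' \<sigma>' s' k'"
    and "(S, S') \<in> bispan_iso G" "(T, T') \<in> bispan_iso G"
  shows "(U, U') \<in> bispan_iso G"
proof -
  obtain a b where "bispan_hom G U U' a b"
    "inj_on a (tops U)" "inj_on b (mids U)"
    using composite_via_comparison[OF assms] by blast
  moreover obtain a' b' where "bispan_hom G U' U a' b'"
    "inj_on a' (tops U')" "inj_on b' (mids U')"
    using composite_via_comparison[OF assms(2,1) assms(3,4)[THEN bispan_iso_sym]] by blast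
  ultimately show ?thesis
    using bispan_iso_antisym composite_viaD(3)[OF assms(1)] composite_viaD(3)[OF assms(2)] by blast
qed

lemma composite_via_iso:
  assumes v: "composite_via G S T U r \<sigma> s k" and U: "(U, U') \<in> bispan_iso G"
  shows "\<exists>r' \<sigma>' s' k'. composite_via G S T U' r' \<sigma>' s' k'"
proof -
  note c = composite_viaD[OF v]
  from bispan_iso_sym[OF U] obtain a b where U': "is_bispan G U'" and h: "bispan_hom G U' U a b"
    and a: "bij_betw a (tops U') (tops U)"
    and b: "bij_betw b (mids U') (mids U)"
    by (auto simp: bispan_iso_iff)
  note h' = bispan_homD[OF h]
  have "composite_via G S T U' (compose (mids U') r b) (\<lambda>e. \<sigma> (b e))
     (compose (tops U') s a) (compose (tops U') k a)"
    unfolding composite_via_def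
  proof (intro conjI ballI impI)
    show "compose (mids U') r b \<in> gmaps G (mid U') (mid T)"
      "compose (tops U') s a \<in> gmaps G (bispan.top U') (bispan.top S)"
      "compose (tops U') k a \<in> gmaps G (bispan.top U') (bispan.top T)"
      using U' h'(3,4) c(7,11,12) by (auto intro!: compose_gmaps simp: bispan_closed)
  next
    fix d \<tau> assume d: "d \<in> mids T" and \<tau>: "\<tau> \<in> sections S T d"
    obtain e where e: "e \<in> mids U" "r e = d" "\<sigma> e = \<tau>"
      and un: "\<And>f. f \<in> mids U \<Longrightarrow> r f = d \<Longrightarrow> \<sigma> f = \<tau> \<Longrightarrow> f = e"
      using c(9)[OF d \<tau>] by blast
    obtain e' where e': "e' \<in> mids U'" "b e' = e"
      using b e(1) by (metis bij_betw_imp_surj_on imageE)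
    show "\<exists>!e. e \<in> mids U' \<and> compose (mids U') r b e = d \<and> \<sigma> (b e) = \<tau>"
    proof (rule ex1I[of _ e'])
      fix f assume f: "f \<in> mids U' \<and> compose (mids U') r b f = d \<and> \<sigma> (b f) = \<tau>"
      then have "b f = e" by (intro un) (auto simp: compose_eq h'(9))
      then show "f = e'" using b e' f by (metis bij_betw_def inj_onD)
    qed (use e e' in \<open>simp add: compose_eq\<close>)
  next
    fix x e' d assume x: "x \<in> tops S" and e': "e' \<in> mids U'"
      and d: "d \<in> fibre T (compose (mids U') r b e')" and eq: "mmap S x = \<sigma> (b e') d"
    obtain t where t: "t \<in> tops U" "s t = x" "k t = d" "mmap U t = b e'"
      and un: "\<And>f. f \<in> tops U \<Longrightarrow> s f = x \<Longrightarrow> k f = d \<Longrightarrow> mmap U f = b e' \<Longrightarrow> f = t"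
      using c(15)[OF x h'(9)[OF e'] d[unfolded compose_eq[OF e']] eq] by blast
    obtain t' where t': "t' \<in> tops U'" "a t' = t"
      using a t(1) by (metis bij_betw_imp_surj_on imageE)
    show "\<exists>!t. t \<in> tops U' \<and> compose (tops U') s a t = x \<and>
       compose (tops U') k a t = d \<and> mmap U' t = e'"
    proof (rule ex1I[of _ t'])
      have "b (mmap U' t') = b e'" using h'(6)[OF t'(1)] t t' by simp
      then have "mmap U' t' = e'"
        using b e' t' U' by (metis bij_betw_def inj_onD bispan_points_closed(2))
      then show "t' \<in> tops U' \<and> compose (tops U') s a t' = x \<and>
       compose (tops U') k a t' = d \<and> mmap U' t' = e'"
        using t t' by (simp add: compose_eq)
      fix f assume f: "f \<in> tops U' \<and> compose (tops U') s a f = x \<and>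
       compose (tops U') k a f = d \<and> mmap U' f = e'"
      then have "a f = t" using h'(6) by (intro un) (auto simp: compose_eq h'(8))
      then show "f = t'" using a t' f by (metis bij_betw_def inj_onD)
    qed
  next
    show "src U' = src S" "tgt U' = tgt T" using h'(1,2) c(5,6) by simp_all
  next
    fix g e d assume "g \<in> carrier G" "e \<in> mids U'"
      "d \<in> fibre T (compose (mids U') r b e)"
    then show "\<sigma> (b (act (mid U') g e)) (act (bispan.top T) g d) = act (mid S) g (\<sigma> (b e) d)"
      using c(10)[OF _ h'(9)] h'(11) by (simp add: compose_eq)
  next
    fix t assume t: "t \<in> tops U'"
    note t' = h'(6)[OF t] h'(8)[OF t] bispan_points_closed(2)[OF U' t]
    show "mmap T (compose (tops U') k a t) = compose (mids U') r b (mmap U' t)"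
      "mmap S (compose (tops U') s a t) =
         \<sigma> (b (mmap U' t)) (compose (tops U') k a t)"
      "lmap U' t = lmap S (compose (tops U') s a t)"
      using c(13,14,16)[OF t'(2)] t'(1,3) t h'(5)[OF t] by (simp_all add: compose_eq)
  next
    fix e assume e: "e \<in> mids U'"
    show "\<sigma> (b e) \<in> sections S T (compose (mids U') r b e)"
      "rmap U' e = rmap T (compose (mids U') r b e)"
      using c(8,17)[OF h'(9)[OF e]] e h'(7)[OF e] by (simp_all add: compose_eq)
  qed (rule c(1,2,4) U')+
  then show ?thesis by blast
qed

end

context group
begin

text \<open>
  A point of the exponential is a section with values in the pullback \<open>P\<close>; its first components form
  \<open>\<sigma> e\<close>, and its second components are forced.
\<close>

lemma is_composite_imp_via:
  assumes "is_composite G S T U"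
  shows "\<exists>r \<sigma> s k. composite_via G S T U r \<sigma> s k"
proof -
  obtain P \<pi>B \<pi>C r W u v ev s t where
    D: "is_bispan G S" "is_bispan G T" "is_bispan G U" "tgt S = src T" "src U = src S" "tgt U = tgt T"
    and P: "is_pullback G P \<pi>B \<pi>C (mid S) (rmap S) (bispan.top T) (lmap T)"
    and E: "is_exponential G P \<pi>C (bispan.top T) (mmap T) (mid T) (mid U) r W u v ev"
    and Q: "is_pullback G (bispan.top U) s t (bispan.top S) (mmap S) W (compose (points W) \<pi>B ev)"
    and maps: "lmap U = compose (tops U) (lmap S) s"
      "mmap U = compose (tops U) v t"
      "rmap U = compose (mids U) (rmap T) r"
    using assms unfolding is_composite_def by (elim conjE exE) (rule that)
  have Pg: "is_gset G P" "\<pi>B \<in> gmaps G P (mid S)" "\<pi>C \<in> gmaps G P (bispan.top T)"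
    and Pb: "bij_betw (\<lambda>w. (\<pi>B w, \<pi>C w)) (points P)
      {(x, y) \<in> mids S \<times> tops T. rmap S x = lmap T y}"
    using P by (auto simp: is_pullback_def)
  have Wg: "is_gset G W" "u \<in> gmaps G W (bispan.top T)" "v \<in> gmaps G W (mid U)"
    and Wb: "bij_betw (\<lambda>w. (u w, v w)) (points W)
      {(x, y) \<in> tops T \<times> mids U. mmap T x = r y}"
    and rg: "r \<in> gmaps G (mid U) (mid T)" and evg: "ev \<in> gmaps G W P"
    and ev: "\<And>w. w \<in> points W \<Longrightarrow> \<pi>C (ev w) = u w"
    and ex: "\<And>d s. d \<in> mids T \<Longrightarrow>
        s \<in> (\<Pi>\<^sub>E c\<in>{c\<in>tops T. mmap T c = d}. {x\<in>points P. \<pi>C x = c}) \<Longrightarrow>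
        \<exists>!e. e \<in> mids U \<and> r e = d \<and> (\<forall>w\<in>points W. v w = e \<longrightarrow> ev w = s (u w))"
    using E unfolding is_pullback_def is_exponential_def by blast+
  have Qg: "s \<in> gmaps G (bispan.top U) (bispan.top S)" "t \<in> gmaps G (bispan.top U) W"
    and Qb: "bij_betw (\<lambda>w. (s w, t w)) (tops U)
      {(x, y) \<in> tops S \<times> points W. mmap S x = compose (points W) \<pi>B ev y}"
    using Q by (auto simp: is_pullback_def)
  have Pex: "\<exists>p\<in>points P. \<pi>B p = b \<and> \<pi>C p = c"
    if "b \<in> mids S" "c \<in> tops T" "rmap S b = lmap T c" for b c
  proof -
    have "(b, c) \<in> (\<lambda>w. (\<pi>B w, \<pi>C w)) ` points P"
      using that unfolding bij_betw_imp_surj_on[OF Pb] by auto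
    then show ?thesis by auto
  qed
  have Pun: "p = p'" if "p \<in> points P" "p' \<in> points P" "\<pi>B p = \<pi>B p'" "\<pi>C p = \<pi>C p'" for p p'
    using that Pb by (auto simp: bij_betw_def inj_on_def)
  have Pin: "rmap S (\<pi>B p) = lmap T (\<pi>C p)" if "p \<in> points P" for p
    using bij_betwE[OF Pb] that by auto
  define j where "j c e = (THE w. w \<in> points W \<and> u w = c \<and> v w = e)" for c e
  have Wun: "w = w'" if "w \<in> points W" "w' \<in> points W" "u w = u w'" "v w = v w'" for w w'
    using that Wb by (auto simp: bij_betw_def inj_on_def)
  have j: "j c e \<in> points W" "u (j c e) = c" "v (j c e) = e"
    if "e \<in> mids U" "c \<in> fibre T (r e)" for c e
  proof -
    have "(c, e) \<in> (\<lambda>w. (u w, v w)) ` points W"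
      using that unfolding bij_betw_imp_surj_on[OF Wb] by (auto simp: fibre_def)
    then obtain w where w: "w \<in> points W" "u w = c" "v w = e" by auto
    have "j c e = w"
      unfolding j_def
    proof (rule the_equality)
      fix w' assume "w' \<in> points W \<and> u w' = c \<and> v w' = e"
      then show "w' = w" using Wun[of w' w] w by simp
    qed (use w in simp)
    then show "j c e \<in> points W" "u (j c e) = c" "v (j c e) = e"
      using w by auto
  qed
  have uv: "u w \<in> fibre T (r (v w))" "v w \<in> mids U" "j (u w) (v w) = w"
    if w: "w \<in> points W" for w
  proof -
    show 1: "u w \<in> fibre T (r (v w))" "v w \<in> mids U"
      using bij_betwE[OF Wb] w by (auto simp: fibre_def)
    show "j (u w) (v w) = w" using Wun[OF j(1)[OF 1(2,1)] w] j(2,3)[OF 1(2,1)] by simp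
  qed
  define \<sigma> where "\<sigma> e = (\<lambda>c\<in>fibre T (r e). \<pi>B (ev (j c e)))" for e
  have evP: "ev w \<in> points P" if "w \<in> points W" for w using evg that by (rule gmaps_closed)
  have \<sigma>_apply: "\<sigma> e c = \<pi>B (ev (j c e))" if "c \<in> fibre T (r e)" for c e
    using that by (simp add: \<sigma>_def)
  have ut: "t x \<in> points W" "mmap U x = v (t x)" if "x \<in> tops U" for x
    using that gmaps_closed[OF Qg(2) that] maps(2) by (simp_all add: compose_eq)
  have tun: "x = x'" if "x \<in> tops U" "x' \<in> tops U" "s x = s x'" "t x = t x'"
    for x x' using that Qb by (auto simp: bij_betw_def inj_on_def)
  let ?k = "compose (tops U) u t"
  have "composite_via G S T U r \<sigma> s ?k"
    unfolding composite_via_def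
  proof (intro conjI ballI impI)
    show "?k \<in> gmaps G (bispan.top U) (bispan.top T)"
      by (rule compose_gmaps[OF bispan_closed(2)[OF D(3)] Qg(2) Wg(2)])
  next
    fix e assume e: "e \<in> mids U"
    show "\<sigma> e \<in> sections S T (r e)"
      unfolding sections_def
    proof (rule PiE_I)
      fix c assume c: "c \<in> fibre T (r e)"
      have "ev (j c e) \<in> points P" using evP j[OF e c] by blast
      then show "\<sigma> e c \<in> {b \<in> mids S. rmap S b = lmap T c}"
        using \<sigma>_apply[OF c] Pin ev[OF j(1)[OF e c]] j(2)[OF e c] Pg(2) by (simp add: gmaps_closed)
    qed (simp add: \<sigma>_def)
    show "rmap U e = rmap T (r e)" using e maps by (simp add: compose_eq)
  next
    fix d \<tau> assume d: "d \<in> mids T" and \<tau>: "\<tau> \<in> sections S T d"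
    \<comment> \<open>The section of \<open>P\<close> with first components \<open>\<tau>\<close>.\<close>
    define \<rho> where "\<rho> = (\<lambda>c\<in>fibre T d. SOME p. p \<in> points P \<and> \<pi>B p = \<tau> c \<and> \<pi>C p = c)"
    have \<rho>: "\<rho> c \<in> points P" "\<pi>B (\<rho> c) = \<tau> c" "\<pi>C (\<rho> c) = c" if c: "c \<in> fibre T d" for c
    proof -
      have "\<tau> c \<in> mids S" "rmap S (\<tau> c) = lmap T c" using \<tau> c by (auto simp: sections_def)
      then have "\<exists>p. p \<in> points P \<and> \<pi>B p = \<tau> c \<and> \<pi>C p = c"
        using Pex c by (auto simp: fibre_def)
      from someI_ex[OF this] show "\<rho> c \<in> points P" "\<pi>B (\<rho> c) = \<tau> c" "\<pi>C (\<rho> c) = c"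
        using c by (simp_all add: \<rho>_def)
    qed
    have "\<rho> \<in> (\<Pi>\<^sub>E c\<in>{c\<in>tops T. mmap T c = d}. {x\<in>points P. \<pi>C x = c})"
      using \<rho> by (auto simp: fibre_def \<rho>_def)
    note exd = ex[OF d this]
    have eqv: "(\<forall>w\<in>points W. v w = e \<longrightarrow> ev w = \<rho> (u w)) \<longleftrightarrow> \<sigma> e = \<tau>"
      if e: "e \<in> mids U" "r e = d" for e
    proof
      assume L: "\<forall>w\<in>points W. v w = e \<longrightarrow> ev w = \<rho> (u w)"
      show "\<sigma> e = \<tau>"
      proof (rule extensionalityI[where A = "fibre T d"])
        show "\<sigma> e \<in> extensional (fibre T d)" using e by (simp add: \<sigma>_def)
        show "\<tau> \<in> extensional (fibre T d)" using \<tau> by (simp add: sections_def PiE_def)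
        fix c assume c: "c \<in> fibre T d"
        then have c': "c \<in> fibre T (r e)" using e by simp
        show "\<sigma> e c = \<tau> c"
          using L j[OF e(1) c'] \<sigma>_apply[OF c'] \<rho>[OF c] by simp
      qed
    next
      assume R: "\<sigma> e = \<tau>"
      show "\<forall>w\<in>points W. v w = e \<longrightarrow> ev w = \<rho> (u w)"
      proof (intro ballI impI)
        fix w assume w: "w \<in> points W" "v w = e"
        have f: "u w \<in> fibre T (r e)" using uv(1)[OF w(1)] w(2) by simp
        have "\<pi>B (ev w) = \<tau> (u w)" using \<sigma>_apply[OF f] R uv(3)[OF w(1)] w(2) by simp
        then show "ev w = \<rho> (u w)"
          using Pun[OF evP[OF w(1)] \<rho>(1)] \<rho>(2,3) f e(2) ev[OF w(1)] by simp
      qed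
    qed
    show "\<exists>!e. e \<in> mids U \<and> r e = d \<and> \<sigma> e = \<tau>"
      using exd eqv by (simp cong: conj_cong)
  next
    fix g e c assume g: "g \<in> carrier G" and e: "e \<in> mids U" and c: "c \<in> fibre T (r e)"
    let ?e = "act (mid U) g e" and ?c = "act (bispan.top T) g c"
    have ct: "c \<in> tops T" "mmap T c = r e" using c by (auto simp: fibre_def)
    have e': "?e \<in> mids U" using D(3) g e by (simp add: bispan_equivariant)
    have c': "?c \<in> fibre T (r ?e)"
      using ct bispan_equivariant(2,4)[OF D(2) g ct(1)] gmaps_equivariant[OF rg g e]
      by (simp add: fibre_def)
    note w = j(1)[OF e c]
    have gw: "act W g (j c e) \<in> points W" by (rule gset_act_closed[OF Wg(1) g w])
    have "u (act W g (j c e)) = ?c" "v (act W g (j c e)) = ?e"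
      using gmaps_equivariant[OF Wg(2) g w] gmaps_equivariant[OF Wg(3) g w] j(2,3)[OF e c]
      by simp_all
    then have "j ?c ?e = act W g (j c e)"
      using Wun[OF j(1)[OF e' c'] gw] j(2,3)[OF e' c'] by simp
    moreover have "\<pi>B (ev (act W g (j c e))) = act (mid S) g (\<pi>B (ev (j c e)))"
      using gmaps_equivariant[OF evg g w] gmaps_equivariant[OF Pg(2) g evP[OF w]] by simp
    ultimately show "\<sigma> ?e ?c = act (mid S) g (\<sigma> e c)"
      using \<sigma>_apply[OF c] \<sigma>_apply[OF c'] by simp
  next
    fix x assume x: "x \<in> tops U"
    note w = ut[OF x]
    show "mmap T (?k x) = r (mmap U x)"
      using x uv(1)[OF w(1)] w(2) by (simp add: compose_eq fibre_def)
    have "mmap S (s x) = \<pi>B (ev (t x))"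
      using bij_betwE[OF Qb] x w by (auto simp: compose_eq)
    then show "mmap S (s x) = \<sigma> (mmap U x) (?k x)"
      using x w uv[OF w(1)] by (simp add: compose_eq \<sigma>_apply)
    show "lmap U x = lmap S (s x)" using x maps by (simp add: compose_eq)
  next
    fix x e c assume x: "x \<in> tops S" and e: "e \<in> mids U"
      and c: "c \<in> fibre T (r e)" and eq: "mmap S x = \<sigma> e c"
    note w = j[OF e c]
    have "(x, j c e) \<in> (\<lambda>w. (s w, t w)) ` tops U"
      using x w eq \<sigma>_apply[OF c] unfolding bij_betw_imp_surj_on[OF Qb] by (auto simp: compose_eq)
    then obtain y where y: "y \<in> tops U" "s y = x" "t y = j c e" by auto
    show "\<exists>!y. y \<in> tops U \<and> s y = x \<and> ?k y = c \<and> mmap U y = e"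
    proof (rule ex1I[of _ y])
      show "y \<in> tops U \<and> s y = x \<and> ?k y = c \<and> mmap U y = e"
        using y w maps by (simp add: compose_eq)
      fix z assume z: "z \<in> tops U \<and> s z = x \<and> ?k z = c \<and> mmap U z = e"
      then have "t z = t y"
        using y w ut[of z] by - (rule Wun, auto simp: compose_eq)
      then show "z = y" using z y by - (rule tun, auto)
    qed
  qed (use D rg Qg in auto)
  then show ?thesis by blast
qed

text \<open>
  Conversely the pullback and the evaluation map are built from coded pairs: \<open>W\<close> consists of the pairs
  \<open>(c, e)\<close> with \<open>c\<close> in the fibre at \<open>r e\<close>, and such a pair evaluates to \<open>(\<sigma> e c, c)\<close>.
\<close>

lemma composite_via_imp_is_composite:
  assumes "composite_via G S T U r \<sigma> s k"
  shows "is_composite G S T U"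
proof -
  note c = composite_viaD[OF assms]
  note cl = bispan_closed[OF c(1)] bispan_closed[OF c(2)] bispan_closed[OF c(3)]
  let ?QP = "{(x, y) \<in> mids S \<times> tops T. rmap S x = lmap T y}"
  let ?QW = "{(x, y) \<in> tops T \<times> mids U. mmap T x = r y}"
  let ?P = "pair_gset (mid S) (bispan.top T) ?QP" and ?W = "pair_gset (bispan.top T) (mid U) ?QW"
  let ?u = "pair_fst ?QW" and ?v = "pair_snd ?QW"
  let ?pB = "pair_fst ?QP" and ?pC = "pair_snd ?QP"
  have P: "is_pullback G ?P ?pB ?pC (mid S) (rmap S) (bispan.top T) (lmap T)"
    using pair_gset_pullback[OF cl(3,9,7)] cl(12) c(4) by simp
  have W: "is_pullback G ?W ?u ?v (bispan.top T) (mmap T) (mid U) r"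
    by (rule pair_gset_pullback[OF cl(9,17,13) c(7)])
  have QW: "c' \<in> fibre T (r e)" if "(c', e) \<in> ?QW" for c' e using that by (auto simp: fibre_def)
  have \<sigma>: "\<sigma> e z \<in> mids S" "rmap S (\<sigma> e z) = lmap T z"
    if "e \<in> mids U" "z \<in> fibre T (r e)" for e z
    using c(8)[OF that(1)] that(2) by (auto simp: sections_def)
  have QP: "(\<sigma> e z, z) \<in> ?QP" if "(z, e) \<in> ?QW" for e z
    using \<sigma>[OF _ QW[OF that]] that by auto
  have Pg: "is_gset G ?P" and Wg: "is_gset G ?W" using P W by (auto simp: is_pullback_def)
  have QWg: "(act (bispan.top T) g z, act (mid U) g e) \<in> ?QW" if "g \<in> carrier G" "(z, e) \<in> ?QW" for g z e
    using that c(2,3,7) by (auto simp: bispan_equivariant gmaps_equivariant)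
  define ev where "ev = (\<lambda>n\<in>points ?W. case prod_decode n of (z, e) \<Rightarrow> prod_encode (\<sigma> e z, z))"
  have ev: "ev (prod_encode (z, e)) = prod_encode (\<sigma> e z, z)" if "(z, e) \<in> ?QW" for z e
    using that by (auto simp: ev_def points_pair_gset)
  have Wcases: "\<exists>z e. n = prod_encode (z, e) \<and> (z, e) \<in> ?QW" if "n \<in> points ?W" for n
    using that by (auto simp: points_pair_gset)
  have evg: "ev \<in> gmaps G ?W ?P"
  proof (rule gmapsI)
    show "ev \<in> extensional (points ?W)" by (simp add: ev_def)
    fix n assume "n \<in> points ?W"
    from Wcases[OF this] obtain z e where n: "n = prod_encode (z, e)" "(z, e) \<in> ?QW"
      by (elim exE conjE)
    show "ev n \<in> points ?P"
      unfolding n(1) ev[OF n(2)] points_pair_gset by (rule imageI[OF QP[OF n(2)]])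
    fix g assume g: "g \<in> carrier G"
    have e: "e \<in> mids U" using n(2) by simp
    show "ev (act ?W g n) = act ?P g (ev n)"
      by (simp only: n(1) ev[OF n(2)] ev[OF QWg[OF g n(2)]] c(10)[OF g e QW[OF n(2)]]
        act_pair_gset[OF g n(2)] act_pair_gset[OF g QP[OF n(2)]])
  qed
  define t where "t = (\<lambda>y\<in>tops U. prod_encode (k y, mmap U y))"
  have ktQ: "(k y, mmap U y) \<in> ?QW" if "y \<in> tops U" for y
    using c(13)[OF that] gmaps_closed[OF c(12) that] bispan_points_closed(2)[OF c(3) that] by simp
  have t: "t y = prod_encode (k y, mmap U y)" "t y \<in> points ?W" if "y \<in> tops U" for y
    using that ktQ[OF that] by (auto simp: t_def points_pair_gset)
  have tg: "t \<in> gmaps G (bispan.top U) ?W"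
  proof (rule gmapsI)
    fix g y assume g: "g \<in> carrier G" and y: "y \<in> tops U"
    have gy: "act (bispan.top U) g y \<in> tops U" using c(3) g y by (simp add: bispan_equivariant)
    show "t (act (bispan.top U) g y) = act ?W g (t y)"
      using t(1)[OF y] t(1)[OF gy] act_pair_gset[OF g ktQ[OF y]]
        gmaps_equivariant[OF c(12) g y] bispan_equivariant(2)[OF c(3) g y] by simp
  qed (use t in \<open>auto simp: t_def\<close>)
  have E: "is_exponential G ?P ?pC (bispan.top T) (mmap T) (mid T) (mid U) r ?W ?u ?v ev"
    unfolding is_exponential_def
  proof (intro conjI ballI)
    fix n assume "n \<in> points ?W"
    from Wcases[OF this] obtain z e where n: "n = prod_encode (z, e)" "(z, e) \<in> ?QW"
      by (elim exE conjE)
    show "?pC (ev n) = ?u n"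
      by (simp only: n(1) ev[OF n(2)] pair_snd_apply[OF QP[OF n(2)]] pair_fst_apply[OF n(2)])
  next
    fix d \<rho> assume d: "d \<in> mids T"
      and \<rho>: "\<rho> \<in> (\<Pi>\<^sub>E c\<in>{c\<in>tops T. mmap T c = d}. {x\<in>points ?P. ?pC x = c})"
    define \<tau> where "\<tau> = (\<lambda>z\<in>fibre T d. ?pB (\<rho> z))"
    have \<rho>_eq: "\<rho> z = prod_encode (\<tau> z, z)" "(\<tau> z, z) \<in> ?QP" if z: "z \<in> fibre T d" for z
    proof -
      have "\<rho> z \<in> {x \<in> points ?P. ?pC x = z}"
        by (rule PiE_mem[OF \<rho>]) (use z in \<open>simp add: fibre_def\<close>)
      then have \<rho>z: "\<rho> z \<in> points ?P" "?pC (\<rho> z) = z" by simp_all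
      from \<rho>z(1) obtain q where q: "q \<in> ?QP" "\<rho> z = prod_encode q"
        unfolding points_pair_gset by (elim imageE)
      obtain x y where xy: "q = (x, y)" by (cases q)
      note q' = q[unfolded xy]
      have y: "y = z" using pair_snd_apply[OF q'(1)] q'(2) \<rho>z(2) by simp
      have x: "\<tau> z = x" using pair_fst_apply[OF q'(1)] q'(2) z by (simp add: \<tau>_def)
      show "\<rho> z = prod_encode (\<tau> z, z)" "(\<tau> z, z) \<in> ?QP"
        unfolding x using q' unfolding y by blast+
    qed
    have \<tau>: "\<tau> \<in> sections S T d"
      unfolding sections_def
    proof (rule PiE_I)
      fix z assume "z \<in> fibre T d"
      then show "\<tau> z \<in> {b \<in> mids S. rmap S b = lmap T z}" using \<rho>_eq(2) by auto
    qed (simp add: \<tau>_def)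
    have eqv: "(\<forall>w\<in>points ?W. ?v w = e \<longrightarrow> ev w = \<rho> (?u w)) \<longleftrightarrow> \<sigma> e = \<tau>"
      if e: "e \<in> mids U" "r e = d" for e
    proof
      assume L: "\<forall>w\<in>points ?W. ?v w = e \<longrightarrow> ev w = \<rho> (?u w)"
      show "\<sigma> e = \<tau>"
      proof (rule extensionalityI[where A = "fibre T d"])
        show "\<sigma> e \<in> extensional (fibre T d)" using c(8)[OF e(1)] e(2) by (simp add: sections_def PiE_def)
        show "\<tau> \<in> extensional (fibre T d)" by (simp add: \<tau>_def)
        fix z assume z: "z \<in> fibre T d"
        then have q: "(z, e) \<in> ?QW" using e by (simp add: fibre_def)
        then have zW: "prod_encode (z, e) \<in> points ?W" by (simp add: points_pair_gset)
        have "ev (prod_encode (z, e)) = \<rho> z"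
          using bspec[OF L zW] pair_fst_apply[OF q] pair_snd_apply[OF q] by simp
        then show "\<sigma> e z = \<tau> z" using ev[OF q] \<rho>_eq(1)[OF z] by simp
      qed
    next
      assume R: "\<sigma> e = \<tau>"
      show "\<forall>w\<in>points ?W. ?v w = e \<longrightarrow> ev w = \<rho> (?u w)"
      proof (intro ballI impI)
        fix n assume nW: "n \<in> points ?W" and ne: "?v n = e"
        from Wcases[OF nW] obtain z e' where n: "n = prod_encode (z, e')" "(z, e') \<in> ?QW"
          by (elim exE conjE)
        have "e' = e" using pair_snd_apply[OF n(2)] n(1) ne by simp
        note n' = n[unfolded this]
        have z: "z \<in> fibre T d" using QW[OF n'(2)] e by simp
        show "ev n = \<rho> (?u n)"
          unfolding n'(1) ev[OF n'(2)] pair_fst_apply[OF n'(2)] \<rho>_eq(1)[OF z] R by (rule refl)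
      qed
    qed
    show "\<exists>!e. e \<in> mids U \<and> r e = d \<and> (\<forall>w\<in>points ?W. ?v w = e \<longrightarrow> ev w = \<rho> (?u w))"
      using c(9)[OF d \<tau>] eqv by (simp cong: conj_cong)
  qed (fact cl(17) c(7) W evg)+
  have comp_ev: "compose (points ?W) ?pB ev (prod_encode (z, e)) = \<sigma> e z" if q: "(z, e) \<in> ?QW" for z e
  proof -
    have "prod_encode (z, e) \<in> points ?W" using q by (simp add: points_pair_gset)
    then show ?thesis using ev[OF q] pair_fst_apply[OF QP[OF q]] by (simp add: compose_eq)
  qed
  have Q: "is_pullback G (bispan.top U) s t (bispan.top S) (mmap S) ?W (compose (points ?W) ?pB ev)"
    unfolding is_pullback_def
  proof (intro conjI bij_betw_imageI inj_onI)
    fix y y' assume y: "y \<in> tops U" "y' \<in> tops U"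
      and eq: "(s y, t y) = (s y', t y')"
    have kf: "k y \<in> fibre T (r (mmap U y))"
      using c(13)[OF y(1)] gmaps_closed[OF c(12) y(1)] by (simp add: fibre_def)
    note ex = c(15)[OF gmaps_closed[OF c(11) y(1)] bispan_points_closed(2)[OF c(3) y(1)] kf c(14)[OF y(1)]]
    show "y = y'"
      using the1_equality[OF ex, of y] the1_equality[OF ex, of y'] y eq t(1)[OF y(1)] t(1)[OF y(2)] by simp
  next
    show "(\<lambda>w. (s w, t w)) ` tops U =
       {(x, y) \<in> tops S \<times> points ?W. mmap S x = compose (points ?W) ?pB ev y}" (is "?I = ?J")
    proof (intro equalityI subsetI)
      fix p assume "p \<in> ?I"
      then obtain y where y: "y \<in> tops U" "p = (s y, t y)" by auto
      show "p \<in> ?J"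
        using y(2) t[OF y(1)] gmaps_closed[OF c(11) y(1)] c(14)[OF y(1)] comp_ev[OF ktQ[OF y(1)]] by simp
    next
      fix p assume "p \<in> ?J"
      then obtain x n where p: "p = (x, n)" "x \<in> tops S" "n \<in> points ?W"
        "mmap S x = compose (points ?W) ?pB ev n" by auto
      from Wcases[OF p(3)] obtain z e where n: "n = prod_encode (z, e)" "(z, e) \<in> ?QW"
        by (elim exE conjE)
      have "\<exists>!y. y \<in> tops U \<and> s y = x \<and> k y = z \<and> mmap U y = e"
        using p(2,4) n(1) comp_ev[OF n(2)] QW[OF n(2)] n(2) by (intro c(15)) auto
      then obtain y where "y \<in> tops U" "s y = x" "k y = z" "mmap U y = e" by blast
      then show "p \<in> ?I" using p(1) n(1) t(1) by (intro image_eqI[of _ _ y]) auto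
    qed
  qed (fact cl(16) c(11) tg)+
  have maps: "lmap U = compose (tops U) (lmap S) s"
      "mmap U = compose (tops U) ?v t"
      "rmap U = compose (mids U) (rmap T) r"
  proof -
    show "lmap U = compose (tops U) (lmap S) s"
      using c(16) by (intro extensionalityI[OF gmaps_extensional[OF cl(19)]]) (auto simp: compose_eq)
    show "mmap U = compose (tops U) ?v t"
      using t(1) pair_snd_apply[OF ktQ]
      by (intro extensionalityI[OF gmaps_extensional[OF cl(20)]]) (auto simp: compose_eq)
    show "rmap U = compose (mids U) (rmap T) r"
      using c(17) by (intro extensionalityI[OF gmaps_extensional[OF cl(21)]]) (auto simp: compose_eq)
  qed
  show ?thesis
    unfolding is_composite_def using c(1-6) P E Q maps by blast
qed

text \<open>
  The set \<open>Comp\<close> is a single isomorphism class because composites of isomorphic bispans are isomorphic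
  and every bispan isomorphic to a composite is a composite.  Hence one explicit composite of
  representatives computes the composition of classes.
\<close>

lemma Comp_bispan_class:
  assumes "composite_via G S T U r \<sigma> s k"
  shows "Comp (bispan_cat G) (bispan_class G T) (bispan_class G S) = bispan_class G U"
proof (intro equalityI subsetI)
  fix U' assume "U' \<in> Comp (bispan_cat G) (bispan_class G T) (bispan_class G S)"
  then obtain S' T' where S': "(S, S') \<in> bispan_iso G" and T': "(T, T') \<in> bispan_iso G"
    and "is_composite G S' T' U'"
    by (auto simp: bispan_cat_def bispan_class_def)
  then obtain r' \<sigma>' s' k' where "composite_via G S' T' U' r' \<sigma>' s' k'"
    using is_composite_imp_via by blast
  then have "(U, U') \<in> bispan_iso G" using composite_unique[OF assms _ S' T'] by blast
  then show "U' \<in> bispan_class G U" by (simp add: bispan_class_def)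
next
  fix U' assume "U' \<in> bispan_class G U"
  then have "(U, U') \<in> bispan_iso G" by (simp add: bispan_class_def)
  then obtain r' \<sigma>' s' k' where "composite_via G S T U' r' \<sigma>' s' k'"
    using composite_via_iso[OF assms] by blast
  then have "is_composite G S T U'" by (rule composite_via_imp_is_composite)
  moreover have "S \<in> bispan_class G S" "T \<in> bispan_class G T"
    using composite_viaD(1,2)[OF assms] by (auto simp: bispan_class_self)
  ultimately show "U' \<in> Comp (bispan_cat G) (bispan_class G T) (bispan_class G S)"
    by (auto simp: bispan_cat_def)
qed

end

section \<open>Composing with a transfer, a norm or a restriction\<close>

context group
begin

text \<open>
  The middle map of a transfer is an identity, so a section over a point \<open>y\<close> is just a point of \<open>mid D\<close>
  above \<open>y\<close>.
\<close>

lemma Comp_transfer: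
  assumes D: "is_bispan G D" and Z: "is_gset G Z" and h: "h \<in> gmaps G (tgt D) Z"
  shows "Comp (bispan_cat G) (transfer_map G (tgt D) Z h) (bispan_class G D) =
    bispan_class G \<lparr>src = src D, top = bispan.top D, mid = mid D, tgt = Z,
      lmap = lmap D, mmap = mmap D, rmap = compose (mids D) h (rmap D)\<rparr>"
  unfolding transfer_map_def
proof (rule Comp_bispan_class)
  let ?Y = "tgt D"
  let ?T = "\<lparr>src = ?Y, top = ?Y, mid = ?Y, tgt = Z, lmap = gid ?Y, mmap = gid ?Y, rmap = h\<rparr>"
  let ?U = "\<lparr>src = src D, top = bispan.top D, mid = mid D, tgt = Z,
      lmap = lmap D, mmap = mmap D, rmap = compose (mids D) h (rmap D)\<rparr>"
  note cl = bispan_closed[OF D] and pc = bispan_points_closed[OF D] and eq = bispan_equivariant[OF D]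
  have fib: "fibre ?T y = {y}" if "y \<in> points ?Y" for y
    using that by (auto simp: fibre_def gid_apply)
  show "composite_via G D ?T ?U (rmap D) (\<lambda>e. \<lambda>c\<in>{rmap D e}. e) (gid (bispan.top D))
    (compose (tops D) (rmap D) (mmap D))"
    unfolding composite_via_def
  proof (intro conjI ballI impI; (simp only: bispan.simps)?)
    show "is_bispan G ?T" using cl Z h by (simp add: is_bispan_def gid_gmaps)
    show "is_bispan G ?U" using cl Z h by (simp add: is_bispan_def compose_gmaps)
  next
    fix e assume e: "e \<in> mids D"
    show "(\<lambda>c\<in>{rmap D e}. e) \<in> sections D ?T (rmap D e)"
      using e pc(3)[OF e] by (simp add: sections_def fib gid_apply)
  next
    fix d \<tau> assume d: "d \<in> points (tgt D)" and \<tau>: "\<tau> \<in> sections D ?T d"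
    have \<tau>E: "\<tau> \<in> (\<Pi>\<^sub>E c\<in>{d}. {b \<in> mids D. rmap D b = gid (tgt D) c})"
      using \<tau> by (simp add: sections_def fib[OF d])
    have \<tau>d: "\<tau> d \<in> mids D" "rmap D (\<tau> d) = gid (tgt D) d"
      using PiE_mem[OF \<tau>E, of d] by simp_all
    then have \<tau>d': "rmap D (\<tau> d) = d" using d by (simp add: gid_apply)
    have \<tau>_eq: "\<tau> = (\<lambda>c\<in>{d}. \<tau> d)"
      using \<tau>E by (intro extensionalityI[where A = "{d}"]) (auto simp: PiE_def)
    show "\<exists>!e. e \<in> mids D \<and> rmap D e = d \<and> (\<lambda>c\<in>{rmap D e}. e) = \<tau>"
    proof (rule ex1I[of _ "\<tau> d"])
      show "\<tau> d \<in> mids D \<and> rmap D (\<tau> d) = d \<and> (\<lambda>c\<in>{rmap D (\<tau> d)}. \<tau> d) = \<tau>"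
        using \<tau>d(1) \<tau>d' \<tau>_eq[symmetric] by simp
      fix e assume "e \<in> mids D \<and> rmap D e = d \<and> (\<lambda>c\<in>{rmap D e}. e) = \<tau>"
      then show "e = \<tau> d" by auto
    qed
  next
    fix g e c assume g: "g \<in> carrier G" and e: "e \<in> mids D" and c: "c \<in> fibre ?T (rmap D e)"
    have "c = rmap D e" using c fib[OF pc(3)[OF e]] by simp
    then show "(\<lambda>c\<in>{rmap D (act (mid D) g e)}. act (mid D) g e) (act (tgt D) g c) =
        act (mid D) g ((\<lambda>c\<in>{rmap D e}. e) c)"
      using eq(3)[OF g e] by simp
  next
    show "gid (bispan.top D) \<in> gmaps G (bispan.top D) (bispan.top D)"
      using cl by (simp add: gid_gmaps)
    show "compose (tops D) (rmap D) (mmap D) \<in> gmaps G (bispan.top D) (tgt D)"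
      using cl by (simp add: compose_gmaps)
  next
    fix t assume t: "t \<in> tops D"
    show "gid (tgt D) (compose (tops D) (rmap D) (mmap D) t) = rmap D (mmap D t)"
      "mmap D (gid (bispan.top D) t) =
        (\<lambda>c\<in>{rmap D (mmap D t)}. mmap D t) (compose (tops D) (rmap D) (mmap D) t)"
      "lmap D t = lmap D (gid (bispan.top D) t)"
      using t pc(2)[OF t] pc(3)[OF pc(2)[OF t]] by (simp_all add: gid_apply compose_eq)
  next
    fix x e c assume x: "x \<in> tops D" and e: "e \<in> mids D"
      and c: "c \<in> fibre ?T (rmap D e)" and m: "mmap D x = (\<lambda>c\<in>{rmap D e}. e) c"
    have "c = rmap D e" using c fib[OF pc(3)[OF e]] by simp
    moreover from this have "mmap D x = e" using m by simp
    ultimately show "\<exists>!t. t \<in> tops D \<and> gid (bispan.top D) t = x \<and>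
        compose (tops D) (rmap D) (mmap D) t = c \<and> mmap D t = e"
      using x by (intro ex1I[of _ x]) (simp_all add: gid_apply compose_eq, metis gid_apply)
  qed (use D cl in \<open>simp_all add: compose_eq\<close>)
qed

text \<open>
  If the last leg of \<open>D\<close> is an identity, there is exactly one section over every fibre, so the middle set
  of the composite is \<open>Z\<close>.
\<close>

lemma Comp_norm:
  assumes D: "is_bispan G D" "mid D = tgt D" "rmap D = gid (tgt D)"
    and Z: "is_gset G Z" and h: "h \<in> gmaps G (tgt D) Z"
  shows "Comp (bispan_cat G) (norm_map G (tgt D) Z h) (bispan_class G D) =
    bispan_class G \<lparr>src = src D, top = bispan.top D, mid = Z, tgt = Z, lmap = lmap D,
      mmap = compose (tops D) h (mmap D), rmap = gid Z\<rparr>"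
  unfolding norm_map_def
proof (rule Comp_bispan_class)
  let ?Y = "tgt D"
  let ?T = "\<lparr>src = ?Y, top = ?Y, mid = Z, tgt = Z, lmap = gid ?Y, mmap = h, rmap = gid Z\<rparr>"
  let ?U = "\<lparr>src = src D, top = bispan.top D, mid = Z, tgt = Z, lmap = lmap D,
      mmap = compose (tops D) h (mmap D), rmap = gid Z\<rparr>"
  note cl = bispan_closed[OF D(1)] and pc = bispan_points_closed[OF D(1)]
    and eq = bispan_equivariant[OF D(1)]
  have mY: "mmap D \<in> gmaps G (bispan.top D) ?Y" using cl(6) D(2) by simp
  show "composite_via G D ?T ?U (gid Z) (\<lambda>e. \<lambda>c\<in>fibre ?T e. c) (gid (bispan.top D)) (mmap D)"
    unfolding composite_via_def
  proof (intro conjI ballI impI; (simp only: bispan.simps)?)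
    show "is_bispan G ?T" using cl Z h by (simp add: is_bispan_def gid_gmaps)
    show "is_bispan G ?U" using cl Z h mY by (simp add: is_bispan_def compose_gmaps gid_gmaps)
  next
    fix e assume e: "e \<in> points Z"
    show "(\<lambda>c\<in>fibre ?T e. c) \<in> sections D ?T (gid Z e)"
      using e D by (auto simp: sections_def gid_apply fibre_def)
  next
    fix d \<tau> assume d: "d \<in> points Z" and \<tau>: "\<tau> \<in> sections D ?T d"
    have "\<tau> c = c" if "c \<in> fibre ?T d" for c
      using PiE_mem[OF \<tau>[unfolded sections_def] that] that D
      by (simp add: fibre_def) (metis gid_apply)
    moreover have "\<tau> \<in> extensional (fibre ?T d)" using \<tau> by (simp add: sections_def PiE_def)
    ultimately have \<tau>': "(\<lambda>c\<in>fibre ?T d. c) = \<tau>"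
      by (intro extensionalityI[where A = "fibre ?T d"]) simp_all
    show "\<exists>!e. e \<in> points Z \<and> gid Z e = d \<and> (\<lambda>c\<in>fibre ?T e. c) = \<tau>"
    proof (rule ex1I[of _ d])
      show "d \<in> points Z \<and> gid Z d = d \<and> (\<lambda>c\<in>fibre ?T d. c) = \<tau>"
        using d \<tau>' by (simp add: gid_apply)
    qed (metis gid_apply)
  next
    fix g e c assume g: "g \<in> carrier G" and e: "e \<in> points Z" and c: "c \<in> fibre ?T (gid Z e)"
    have c': "c \<in> fibre ?T e" using c e by (simp add: gid_apply)
    then have cp: "c \<in> points (tgt D)" "h c = e" by (simp_all add: fibre_def)
    have "act (tgt D) g c \<in> fibre ?T (act Z g e)"
      using cp gmaps_equivariant[OF h g cp(1)] gset_act_closed[OF cl(4) g cp(1)]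
      by (simp add: fibre_def)
    then show "(\<lambda>c\<in>fibre ?T (act Z g e). c) (act (tgt D) g c) =
        act (mid D) g ((\<lambda>c\<in>fibre ?T e. c) c)"
      using c' D(2) by simp
  next
    show "gid (bispan.top D) \<in> gmaps G (bispan.top D) (bispan.top D)"
      using cl by (simp add: gid_gmaps)
    show "gid Z \<in> gmaps G Z Z" using Z by (rule gid_gmaps)
  next
    fix t assume t: "t \<in> tops D"
    have m: "mmap D t \<in> points (tgt D)" using gmaps_closed[OF mY t] .
    have hm: "h (mmap D t) \<in> points Z" using gmaps_closed[OF h m] .
    show "h (mmap D t) = gid Z (compose (tops D) h (mmap D) t)"
      "mmap D (gid (bispan.top D) t) =
         (\<lambda>c\<in>fibre ?T (compose (tops D) h (mmap D) t). c) (mmap D t)"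
      "lmap D t = lmap D (gid (bispan.top D) t)"
      using t m hm by (simp_all add: gid_apply compose_eq fibre_def)
  next
    fix x e c assume x: "x \<in> tops D" and e: "e \<in> points Z"
      and c: "c \<in> fibre ?T (gid Z e)" and m: "mmap D x = (\<lambda>c\<in>fibre ?T e. c) c"
    have c': "c \<in> fibre ?T e" using c e by (simp add: gid_apply)
    show "\<exists>!t. t \<in> tops D \<and> gid (bispan.top D) t = x \<and>
        mmap D t = c \<and> compose (tops D) h (mmap D) t = e"
      using x m c'
      by (intro ex1I[of _ x]) (simp_all add: gid_apply compose_eq fibre_def, metis gid_apply)
  qed (use D mY in \<open>simp_all add: gid_apply\<close>)
qed

text \<open>
  The distributive law in the degenerate case in which no section exists: every fibre of \<open>h\<close> contains a
  point that is not in the image of \<open>f\<close>.  This is where \<open>0 \<cdot> x = 0\<close> and the vanishing of norms of \<open>0\<close>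
  come from.
\<close>

lemma Comp_norm_transfer_missing_fibres:
  assumes X: "is_gset G X" and Y: "is_gset G Y" and Z: "is_gset G Z"
    and f: "f \<in> gmaps G X Y" and h: "h \<in> gmaps G Y Z"
    and missing: "\<And>z. z \<in> points Z \<Longrightarrow> \<exists>y\<in>points Y. h y = z \<and> y \<notin> f ` points X"
  shows "Comp (bispan_cat G) (norm_map G Y Z h) (transfer_map G X Y f) =
    bispan_class G \<lparr>src = X, top = gset_empty G, mid = gset_empty G, tgt = Z,
      lmap = gid (gset_empty G), mmap = gid (gset_empty G), rmap = gid (gset_empty G)\<rparr>"
  unfolding norm_map_def transfer_map_def
proof (rule Comp_bispan_class)
  let ?S = "\<lparr>src = X, top = X, mid = X, tgt = Y, lmap = gid X, mmap = gid X, rmap = f\<rparr>"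
  let ?T = "\<lparr>src = Y, top = Y, mid = Z, tgt = Z, lmap = gid Y, mmap = h, rmap = gid Z\<rparr>"
  let ?i = "gid (gset_empty G)"
  let ?U = "\<lparr>src = X, top = gset_empty G, mid = gset_empty G, tgt = Z, lmap = ?i, mmap = ?i, rmap = ?i\<rparr>"
  have no: "\<tau> \<notin> sections ?S ?T d" if d: "d \<in> points Z" for \<tau> d
  proof
    assume \<tau>: "\<tau> \<in> sections ?S ?T d"
    obtain y where y: "y \<in> points Y" "h y = d" "y \<notin> f ` points X" using missing[OF d] by blast
    then have "y \<in> fibre ?T d" by (simp add: fibre_def)
    from PiE_mem[OF \<tau>[unfolded sections_def] this]
    have "\<tau> y \<in> points X" "f (\<tau> y) = y" using y by (simp_all add: gid_apply)
    then show False using y(3) by (metis imageI)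
  qed
  show "composite_via G ?S ?T ?U ?i (\<lambda>e. undefined) ?i ?i"
    unfolding composite_via_def
    using X Y Z f h no
    by (simp add: is_bispan_def gid_gmaps gset_empty gid_gset_empty_gmaps)
qed

text \<open>
  Restriction along \<open>f\<close> pulls the last two sets of a bispan back along \<open>f\<close>: the assumptions say that
  \<open>mid U\<close> is the pullback of \<open>mid D\<close> along \<open>f\<close> and that \<open>top U\<close> is the pullback of \<open>top D\<close> along \<open>\<beta>\<close>.
\<close>

lemma Comp_restriction:
  assumes D: "is_bispan G D" and U: "is_bispan G U" and f: "f \<in> gmaps G (tgt U) (tgt D)"
    and src: "src U = src D"
    and \<beta>: "\<beta> \<in> gmaps G (mid U) (mid D)" and \<alpha>: "\<alpha> \<in> gmaps G (bispan.top U) (bispan.top D)"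
    and rmap: "\<And>e. e \<in> mids U \<Longrightarrow> rmap D (\<beta> e) = f (rmap U e)"
    and mid: "\<And>b x. b \<in> mids D \<Longrightarrow> x \<in> points (tgt U) \<Longrightarrow> rmap D b = f x
        \<Longrightarrow> \<exists>!e. e \<in> mids U \<and> \<beta> e = b \<and> rmap U e = x"
    and mmap: "\<And>t. t \<in> tops U \<Longrightarrow> mmap D (\<alpha> t) = \<beta> (mmap U t)"
    and top: "\<And>y e. y \<in> tops D \<Longrightarrow> e \<in> mids U \<Longrightarrow> mmap D y = \<beta> e
        \<Longrightarrow> \<exists>!t. t \<in> tops U \<and> \<alpha> t = y \<and> mmap U t = e"
    and lmap: "\<And>t. t \<in> tops U \<Longrightarrow> lmap U t = lmap D (\<alpha> t)"
  shows "Comp (bispan_cat G) (restriction G (tgt U) (tgt D) f) (bispan_class G D) = bispan_class G U"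
  unfolding restriction_def
proof (rule Comp_bispan_class)
  let ?X = "tgt U"
  let ?T = "\<lparr>src = tgt D, top = ?X, mid = ?X, tgt = ?X, lmap = f, mmap = gid ?X, rmap = gid ?X\<rparr>"
  note clD = bispan_closed[OF D] and clU = bispan_closed[OF U]
    and pcU = bispan_points_closed[OF U] and eqU = bispan_equivariant[OF U]
  have fib: "fibre ?T x = {x}" if "x \<in> points ?X" for x
    using that by (auto simp: fibre_def gid_apply)
  show "composite_via G D ?T U (rmap U) (\<lambda>e. \<lambda>c\<in>{rmap U e}. \<beta> e) \<alpha>
    (compose (tops U) (rmap U) (mmap U))"
    unfolding composite_via_def
  proof (intro conjI ballI impI; (simp only: bispan.simps)?)
    show "is_bispan G ?T" using clD clU f by (simp add: is_bispan_def gid_gmaps)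
  next
    fix e assume e: "e \<in> mids U"
    show "(\<lambda>c\<in>{rmap U e}. \<beta> e) \<in> sections D ?T (rmap U e)"
      using gmaps_closed[OF \<beta> e] rmap[OF e] pcU(3)[OF e] by (simp add: sections_def fib)
    show "rmap U e = gid (tgt U) (rmap U e)" using pcU(3)[OF e] by (simp add: gid_apply)
  next
    fix d \<tau> assume d: "d \<in> points (tgt U)" and \<tau>: "\<tau> \<in> sections D ?T d"
    have \<tau>E: "\<tau> \<in> (\<Pi>\<^sub>E c\<in>{d}. {b \<in> mids D. rmap D b = f c})"
      using \<tau> by (simp add: sections_def fib[OF d])
    have \<tau>d: "\<tau> d \<in> mids D" "rmap D (\<tau> d) = f d"
      using PiE_mem[OF \<tau>E, of d] by simp_all
    have \<tau>_eq: "\<tau> = (\<lambda>c\<in>{d}. \<tau> d)"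
      using \<tau>E by (intro extensionalityI[where A = "{d}"]) (auto simp: PiE_def)
    have eqv: "(\<lambda>c\<in>{rmap U e}. \<beta> e) = \<tau> \<longleftrightarrow> \<beta> e = \<tau> d" if "rmap U e = d" for e
    proof
      assume "(\<lambda>c\<in>{rmap U e}. \<beta> e) = \<tau>"
      then show "\<beta> e = \<tau> d" using that by auto
    next
      assume "\<beta> e = \<tau> d"
      then show "(\<lambda>c\<in>{rmap U e}. \<beta> e) = \<tau>" using that \<tau>_eq[symmetric] by simp
    qed
    have "(e \<in> mids U \<and> rmap U e = d \<and> (\<lambda>c\<in>{rmap U e}. \<beta> e) = \<tau>) \<longleftrightarrow>
        (e \<in> mids U \<and> \<beta> e = \<tau> d \<and> rmap U e = d)" for e
      using eqv[of e] by blast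
    then show "\<exists>!e. e \<in> mids U \<and> rmap U e = d \<and> (\<lambda>c\<in>{rmap U e}. \<beta> e) = \<tau>"
      using mid[OF \<tau>d(1) d \<tau>d(2)] by simp
  next
    fix g e c assume g: "g \<in> carrier G" and e: "e \<in> mids U" and c: "c \<in> fibre ?T (rmap U e)"
    have "c = rmap U e" using c fib[OF pcU(3)[OF e]] by simp
    then show "(\<lambda>c\<in>{rmap U (act (mid U) g e)}. \<beta> (act (mid U) g e)) (act (tgt U) g c) =
        act (mid D) g ((\<lambda>c\<in>{rmap U e}. \<beta> e) c)"
      using eqU(3)[OF g e] gmaps_equivariant[OF \<beta> g e] by simp
  next
    show "compose (tops U) (rmap U) (mmap U) \<in> gmaps G (bispan.top U) (tgt U)"
      using clU by (simp add: compose_gmaps)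
  next
    fix t assume t: "t \<in> tops U"
    show "gid (tgt U) (compose (tops U) (rmap U) (mmap U) t) = rmap U (mmap U t)"
      "mmap D (\<alpha> t) =
        (\<lambda>c\<in>{rmap U (mmap U t)}. \<beta> (mmap U t)) (compose (tops U) (rmap U) (mmap U) t)"
      using t pcU(2)[OF t] pcU(3)[OF pcU(2)[OF t]] mmap[OF t]
      by (simp_all add: gid_apply compose_eq)
  next
    fix x e c assume x: "x \<in> tops D" and e: "e \<in> mids U"
      and c: "c \<in> fibre ?T (rmap U e)" and m: "mmap D x = (\<lambda>c\<in>{rmap U e}. \<beta> e) c"
    have ce: "c = rmap U e" using c fib[OF pcU(3)[OF e]] by simp
    have "(t \<in> tops U \<and> \<alpha> t = x \<and>
        compose (tops U) (rmap U) (mmap U) t = c \<and> mmap U t = e) \<longleftrightarrow>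
        (t \<in> tops U \<and> \<alpha> t = x \<and> mmap U t = e)" for t
      using ce by (auto simp: compose_eq)
    moreover have "mmap D x = \<beta> e" using m ce by simp
    ultimately show "\<exists>!t. t \<in> tops U \<and> \<alpha> t = x \<and>
        compose (tops U) (rmap U) (mmap U) t = c \<and> mmap U t = e"
      using top[OF x e] by simp
  qed (use D U clU src \<alpha> lmap in simp_all)
qed

end

section \<open>Products in the category of bispans\<close>

context group
begin

lemma is_terminal_gset_empty: "is_terminal (bispan_cat G) (gset_empty G)"
  unfolding is_terminal_def
proof (intro conjI ballI)
  show "gset_empty G \<in> Ob (bispan_cat G)" by (simp add: gset_empty)
  fix Z assume "Z \<in> Ob (bispan_cat G)"
  then have Z: "is_gset G Z" by simp
  let ?i = "gid (gset_empty G)"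
  let ?D = "\<lparr>src = Z, top = gset_empty G, mid = gset_empty G, tgt = gset_empty G,
      lmap = ?i, mmap = ?i, rmap = ?i\<rparr>"
  have D: "is_bispan G ?D" using Z by (simp add: is_bispan_def gset_empty gid_gset_empty_gmaps)
  have iso: "(E, ?D) \<in> bispan_iso G" if E: "is_bispan G E" "src E = Z" "tgt E = gset_empty G" for E
  proof -
    have "mids E = {}" using bispan_points_closed(3)[OF E(1)] E(3) by auto
    then have mid: "mid E = gset_empty G" using gset_with_no_points bispan_closed(3)[OF E(1)] by blast
    have "tops E = {}" using bispan_points_closed(2)[OF E(1)] mid by auto
    then have top: "bispan.top E = gset_empty G"
      using gset_with_no_points bispan_closed(2)[OF E(1)] by blast
    show ?thesis
      unfolding bispan_iso_iff bispan_hom_def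
      using E D by (intro conjI exI[of _ ?i]) (auto simp: mid top gid_gset_empty_gmaps bij_betw_def)
  qed
  show "\<exists>!h. h \<in> Hom (bispan_cat G) Z (gset_empty G)"
  proof (rule ex1I[of _ "bispan_class G ?D"])
    show "bispan_class G ?D \<in> Hom (bispan_cat G) Z (gset_empty G)"
      unfolding Hom_bispan_cat using D by (intro exI[of _ ?D]) simp
    fix h assume "h \<in> Hom (bispan_cat G) Z (gset_empty G)"
    then show "h = bispan_class G ?D"
      unfolding Hom_bispan_cat using iso bispan_class_eq by blast
  qed
qed

text \<open>
  The restriction of \<open>D\<close> along an injection \<open>i\<close> from \<open>X\<close> to the target of \<open>D\<close>, realised on subsets of
  \<open>top D\<close> and \<open>mid D\<close>.
\<close>

definition part_bispan :: "'a bispan \<Rightarrow> 'a gset \<Rightarrow> (nat \<Rightarrow> nat) \<Rightarrow> 'a bispan" where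
  "part_bispan D X i = (
     let B = {b \<in> mids D. rmap D b \<in> i ` points X};
         A = {t \<in> tops D. mmap D t \<in> B}
     in \<lparr>src = src D, top = sub_gset (bispan.top D) A, mid = sub_gset (mid D) B, tgt = X,
         lmap = restrict (lmap D) A, mmap = restrict (mmap D) A,
         rmap = (\<lambda>b\<in>B. inv_into (points X) i (rmap D b))\<rparr>)"

context
  fixes D X i B A
  assumes D: "is_bispan G D" and X: "is_gset G X"
    and i: "i \<in> gmaps G X (tgt D)" and inj: "inj_on i (points X)"
  defines "B \<equiv> {b \<in> mids D. rmap D b \<in> i ` points X}"
    and "A \<equiv> {t \<in> tops D. mmap D t \<in> B}"
begin

lemma part_bispan_simps:
  "src (part_bispan D X i) = src D" "tgt (part_bispan D X i) = X"
  "bispan.top (part_bispan D X i) = sub_gset (bispan.top D) A"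
  "mid (part_bispan D X i) = sub_gset (mid D) B"
  "lmap (part_bispan D X i) = restrict (lmap D) A" "mmap (part_bispan D X i) = restrict (mmap D) A"
  "rmap (part_bispan D X i) = (\<lambda>b\<in>B. inv_into (points X) i (rmap D b))"
  by (simp_all add: part_bispan_def A_def B_def Let_def)

lemma part_bispan_stable:
  assumes g: "g \<in> carrier G"
  shows "b \<in> B \<Longrightarrow> act (mid D) g b \<in> B"
    and "b \<in> B \<Longrightarrow> inv_into (points X) i (rmap D (act (mid D) g b)) =
           act X g (inv_into (points X) i (rmap D b))"
    and "t \<in> A \<Longrightarrow> act (bispan.top D) g t \<in> A"
proof -
  have *: "act (mid D) g b \<in> B \<and> inv_into (points X) i (rmap D (act (mid D) g b)) =
           act X g (inv_into (points X) i (rmap D b))" if b: "b \<in> B" for b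
  proof -
    obtain x where x: "x \<in> points X" "rmap D b = i x" "b \<in> mids D"
      using b by (auto simp: B_def)
    have gx: "act X g x \<in> points X" using gset_act_closed[OF X g x(1)] .
    have "rmap D (act (mid D) g b) = i (act X g x)"
      using bispan_equivariant(3)[OF D g x(3)] gmaps_equivariant[OF i g x(1)] x(2) by simp
    then show ?thesis
      using bispan_equivariant(5)[OF D g x(3)] gx x inj by (simp add: B_def inv_into_f_f)
  qed
  then show "b \<in> B \<Longrightarrow> act (mid D) g b \<in> B"
    and "b \<in> B \<Longrightarrow> inv_into (points X) i (rmap D (act (mid D) g b)) =
           act X g (inv_into (points X) i (rmap D b))" by simp_all
  show "act (bispan.top D) g t \<in> A" if "t \<in> A"
    using that * bispan_equivariant(2,4)[OF D g] by (simp add: A_def)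
qed

lemma part_bispan: "is_bispan G (part_bispan D X i)"
proof -
  have B: "is_gset G (sub_gset (mid D) B)"
    by (rule sub_gset[OF bispan_closed(3)[OF D]]) (use part_bispan_stable(1) in \<open>auto simp: B_def\<close>)
  have A: "is_gset G (sub_gset (bispan.top D) A)"
    by (rule sub_gset[OF bispan_closed(2)[OF D]]) (use part_bispan_stable in \<open>auto simp: A_def\<close>)
  have At: "t \<in> tops D \<and> mmap D t \<in> B" if "t \<in> A" for t using that by (simp add: A_def)
  have "restrict (lmap D) A \<in> gmaps G (sub_gset (bispan.top D) A) (src D)"
    using At part_bispan_stable(3) bispan_points_closed(1)[OF D] bispan_equivariant(1)[OF D]
    by (intro gmapsI) simp_all
  moreover have "restrict (mmap D) A \<in> gmaps G (sub_gset (bispan.top D) A) (sub_gset (mid D) B)"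
    using At part_bispan_stable(3) bispan_equivariant(2)[OF D]
    by (intro gmapsI) simp_all
  moreover have "(\<lambda>b\<in>B. inv_into (points X) i (rmap D b)) \<in> gmaps G (sub_gset (mid D) B) X"
    using part_bispan_stable
    by (intro gmapsI) (simp_all, simp add: B_def inv_into_into)
  ultimately show ?thesis
    using A B X bispan_closed[OF D] by (simp add: is_bispan_def part_bispan_simps)
qed

lemma Comp_restriction_part:
  "Comp (bispan_cat G) (restriction G X (tgt D) i) (bispan_class G D) = bispan_class G (part_bispan D X i)"
proof -
  let ?U = "part_bispan D X i"
  have "Comp (bispan_cat G) (restriction G (tgt ?U) (tgt D) i) (bispan_class G D) = bispan_class G ?U"
  proof (rule Comp_restriction[OF D part_bispan])
    show "gid (mid ?U) \<in> gmaps G (mid ?U) (mid D)"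
      unfolding part_bispan_simps
      by (rule gid_sub_gset_gmaps) (use part_bispan_stable(1) in \<open>auto simp: B_def\<close>)
    show "gid (bispan.top ?U) \<in> gmaps G (bispan.top ?U) (bispan.top D)"
      unfolding part_bispan_simps
      by (rule gid_sub_gset_gmaps) (use part_bispan_stable(3) in \<open>auto simp: A_def\<close>)
    show "\<exists>!e. e \<in> mids ?U \<and> gid (mid ?U) e = b \<and> rmap ?U e = x"
      if "b \<in> mids D" "x \<in> points (tgt ?U)" "rmap D b = i x" for b x
    proof (rule ex1I[of _ b])
      show "b \<in> mids ?U \<and> gid (mid ?U) b = b \<and> rmap ?U b = x"
        using that inj by (simp add: part_bispan_simps gid_apply B_def)
    qed (metis gid_apply)
    show "\<exists>!t. t \<in> tops ?U \<and> gid (bispan.top ?U) t = y \<and> mmap ?U t = e"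
      if "y \<in> tops D" "e \<in> mids ?U" "mmap D y = gid (mid ?U) e" for y e
    proof (rule ex1I[of _ y])
      show "y \<in> tops ?U \<and> gid (bispan.top ?U) y = y \<and> mmap ?U y = e"
        using that by (simp add: part_bispan_simps gid_apply A_def)
    qed (metis gid_apply)
  qed (simp_all add: part_bispan_simps gid_apply i A_def, simp_all add: B_def f_inv_into_f)
  then show ?thesis by (simp add: part_bispan_simps)
qed

end

text \<open>
  An isomorphism between two such parts in terms of the original bispans: the part knows \<open>rmap D y\<close> only
  through its preimage under \<open>i\<close>, and applying \<open>i\<close> recovers it.
\<close>

lemma part_bispan_iso:
  assumes D: "is_bispan G D" "is_bispan G D'" and X: "is_gset G X"
    and tgt: "tgt D = P" "tgt D' = P"
    and i: "i \<in> gmaps G X P" "inj_on i (points X)"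
    and iso: "(part_bispan D X i, part_bispan D' X i) \<in> bispan_iso G"
  obtains b a where
    "\<And>y. y \<in> mids D \<Longrightarrow> rmap D y \<in> i ` points X \<Longrightarrow>
       b y \<in> mids D' \<and> rmap D' (b y) = rmap D y \<and>
       (\<forall>g\<in>carrier G. b (act (mid D) g y) = act (mid D') g (b y))"
    "\<And>t. t \<in> tops D \<Longrightarrow> rmap D (mmap D t) \<in> i ` points X \<Longrightarrow>
       a t \<in> tops D' \<and> lmap D' (a t) = lmap D t \<and> mmap D' (a t) = b (mmap D t) \<and>
       (\<forall>g\<in>carrier G. a (act (bispan.top D) g t) = act (bispan.top D') g (a t))"
    "inj_on b {y \<in> mids D. rmap D y \<in> i ` points X}"
    "inj_on a {t \<in> tops D. rmap D (mmap D t) \<in> i ` points X}"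
proof -
  have i': "i \<in> gmaps G X (tgt D)" "i \<in> gmaps G X (tgt D')" using i tgt by simp_all
  note s = part_bispan_simps[OF D(1) X i'(1) i(2)] part_bispan_simps[OF D(2) X i'(2) i(2)]
  obtain a b where h: "bispan_hom G (part_bispan D X i) (part_bispan D' X i) a b"
    and a: "bij_betw a (tops (part_bispan D X i)) (tops (part_bispan D' X i))"
    and b: "bij_betw b (mids (part_bispan D X i)) (mids (part_bispan D' X i))"
    using iso unfolding bispan_iso_iff by blast
  let ?B = "{y \<in> mids D. rmap D y \<in> i ` points X}"
  let ?A = "{t \<in> tops D. rmap D (mmap D t) \<in> i ` points X}"
  let ?B' = "{y \<in> mids D'. rmap D' y \<in> i ` points X}"
  let ?A' = "{t \<in> tops D'. rmap D' (mmap D' t) \<in> i ` points X}"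
  have A_eq: "{t \<in> tops D. mmap D t \<in> ?B} = ?A"
    "{t \<in> tops D'. mmap D' t \<in> ?B'} = ?A'"
    using bispan_points_closed(2)[OF D(1)] bispan_points_closed(2)[OF D(2)] by auto
  note s' = s[unfolded A_eq]
  note hD = bispan_homD[OF h, unfolded s' points_sub_gset]
  show thesis
  proof (rule that[of b a])
    show "inj_on b ?B" "inj_on a ?A"
      using a b unfolding s' points_sub_gset bij_betw_def by blast+
  next
    fix y assume "y \<in> mids D" "rmap D y \<in> i ` points X"
    then have y: "y \<in> ?B" by simp
    have by': "b y \<in> ?B'" using hD(9)[OF y] .
    have "rmap D' (b y) = rmap D y"
    proof -
      have "i (inv_into (points X) i (rmap D' (b y))) = i (inv_into (points X) i (rmap D y))"
        using hD(7)[OF y] y by' by simp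
      then show ?thesis using y by' by (simp add: f_inv_into_f)
    qed
    moreover have "b (act (mid D) g y) = act (mid D') g (b y)" if g: "g \<in> carrier G" for g
      using hD(11)[OF g y] act_sub_gset[OF g y, of "mid D"] act_sub_gset[OF g by', of "mid D'"] by simp
    ultimately show "b y \<in> mids D' \<and> rmap D' (b y) = rmap D y \<and>
       (\<forall>g\<in>carrier G. b (act (mid D) g y) = act (mid D') g (b y))" using by' by simp
  next
    fix t assume "t \<in> tops D" "rmap D (mmap D t) \<in> i ` points X"
    then have t: "t \<in> ?A" by simp
    have at': "a t \<in> ?A'" using hD(8)[OF t] .
    have "a (act (bispan.top D) g t) = act (bispan.top D') g (a t)" if g: "g \<in> carrier G" for g
      using hD(10)[OF g t] act_sub_gset[OF g t, of "bispan.top D"]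
        act_sub_gset[OF g at', of "bispan.top D'"] by simp
    then show "a t \<in> tops D' \<and> lmap D' (a t) = lmap D t \<and> mmap D' (a t) = b (mmap D t) \<and>
       (\<forall>g\<in>carrier G. a (act (bispan.top D) g t) = act (bispan.top D') g (a t))"
      using hD(5)[OF t] hD(6)[OF t] t at' by simp
  qed
qed

text \<open>
  The two parts partition \<open>top D\<close> and \<open>mid D\<close> according to the image in the target, and so
  isomorphisms of the parts glue.
\<close>

lemma part_bispan_glue:
  assumes D: "is_bispan G D" "is_bispan G D'" and XY: "is_gset G X" "is_gset G Y"
    and src: "src D = src D'" and tgt: "tgt D = P" "tgt D' = P"
    and i: "i \<in> gmaps G X P" "inj_on i (points X)" and j: "j \<in> gmaps G Y P" "inj_on j (points Y)"
    and disj: "i ` points X \<inter> j ` points Y = {}" and cover: "i ` points X \<union> j ` points Y = points P"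
    and iso: "(part_bispan D X i, part_bispan D' X i) \<in> bispan_iso G"
      "(part_bispan D Y j, part_bispan D' Y j) \<in> bispan_iso G"
  shows "\<exists>a b. bispan_hom G D D' a b \<and> inj_on a (tops D) \<and> inj_on b (mids D)"
proof -
  obtain b1 a1 where
    b1: "\<And>y. y \<in> mids D \<Longrightarrow> rmap D y \<in> i ` points X \<Longrightarrow>
       b1 y \<in> mids D' \<and> rmap D' (b1 y) = rmap D y \<and>
       (\<forall>g\<in>carrier G. b1 (act (mid D) g y) = act (mid D') g (b1 y))"
    and a1: "\<And>t. t \<in> tops D \<Longrightarrow> rmap D (mmap D t) \<in> i ` points X \<Longrightarrow>
       a1 t \<in> tops D' \<and> lmap D' (a1 t) = lmap D t \<and> mmap D' (a1 t) = b1 (mmap D t) \<and>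
       (\<forall>g\<in>carrier G. a1 (act (bispan.top D) g t) = act (bispan.top D') g (a1 t))"
    and inj1: "inj_on b1 {y \<in> mids D. rmap D y \<in> i ` points X}"
      "inj_on a1 {t \<in> tops D. rmap D (mmap D t) \<in> i ` points X}"
  proof (rule part_bispan_iso[OF D XY(1) tgt i iso(1)], goal_cases)
    case (1 b a)
    from 1(2-5) show ?case by (rule 1(1))
  qed
  obtain b2 a2 where
    b2: "\<And>y. y \<in> mids D \<Longrightarrow> rmap D y \<in> j ` points Y \<Longrightarrow>
       b2 y \<in> mids D' \<and> rmap D' (b2 y) = rmap D y \<and>
       (\<forall>g\<in>carrier G. b2 (act (mid D) g y) = act (mid D') g (b2 y))"
    and a2: "\<And>t. t \<in> tops D \<Longrightarrow> rmap D (mmap D t) \<in> j ` points Y \<Longrightarrow>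
       a2 t \<in> tops D' \<and> lmap D' (a2 t) = lmap D t \<and> mmap D' (a2 t) = b2 (mmap D t) \<and>
       (\<forall>g\<in>carrier G. a2 (act (bispan.top D) g t) = act (bispan.top D') g (a2 t))"
    and inj2: "inj_on b2 {y \<in> mids D. rmap D y \<in> j ` points Y}"
      "inj_on a2 {t \<in> tops D. rmap D (mmap D t) \<in> j ` points Y}"
  proof (rule part_bispan_iso[OF D XY(2) tgt j iso(2)], goal_cases)
    case (1 b a)
    from 1(2-5) show ?case by (rule 1(1))
  qed
  have split: "(y \<in> i ` points X \<and> y \<notin> j ` points Y) \<or> (y \<notin> i ` points X \<and> y \<in> j ` points Y)"
    if "y \<in> points P" for y using that disj cover by blast
  have stable: "act P g y \<in> i ` points X" if g: "g \<in> carrier G" and y: "y \<in> i ` points X" for g y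
  proof -
    obtain x where x: "x \<in> points X" "y = i x" using y by blast
    show ?thesis
      using gmaps_equivariant[OF i(1) g x(1)] gset_act_closed[OF XY(1) g x(1)] x(2)
      by (metis imageI)
  qed
  have stable': "act P g y \<in> j ` points Y" if g: "g \<in> carrier G" and y: "y \<in> j ` points Y" for g y
  proof -
    obtain x where x: "x \<in> points Y" "y = j x" using y by blast
    show ?thesis
      using gmaps_equivariant[OF j(1) g x(1)] gset_act_closed[OF XY(2) g x(1)] x(2)
      by (metis imageI)
  qed
  define b where "b = (\<lambda>y\<in>mids D. if rmap D y \<in> i ` points X then b1 y else b2 y)"
  define a where "a = (\<lambda>t\<in>tops D. if rmap D (mmap D t) \<in> i ` points X then a1 t else a2 t)"
  have b: "b y \<in> mids D'" "rmap D' (b y) = rmap D y" if y: "y \<in> mids D" for y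
    using b1[OF y] b2[OF y] split[of "rmap D y"] bispan_points_closed(3)[OF D(1) y] tgt y
    by (auto simp: b_def)
  have a: "a t \<in> tops D'" "lmap D' (a t) = lmap D t" "mmap D' (a t) = b (mmap D t)"
    if t: "t \<in> tops D" for t
    using a1[OF t] a2[OF t] split[of "rmap D (mmap D t)"] bispan_points_closed(2)[OF D(1) t]
      bispan_points_closed(3)[OF D(1) bispan_points_closed(2)[OF D(1) t]] tgt t
    by (auto simp: a_def b_def)
  have b_act: "b (act (mid D) g y) = act (mid D') g (b y)" if g: "g \<in> carrier G" and y: "y \<in> mids D" for g y
  proof -
    have gy: "act (mid D) g y \<in> mids D" "rmap D (act (mid D) g y) = act P g (rmap D y)"
      using bispan_equivariant(3,5)[OF D(1) g y] tgt by simp_all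
    have "rmap D y \<in> points P" using bispan_points_closed(3)[OF D(1) y] tgt by simp
    from split[OF this] show ?thesis
    proof
      assume "rmap D y \<in> i ` points X \<and> rmap D y \<notin> j ` points Y"
      then show ?thesis using b1[OF y] g gy stable[OF g] y by (simp add: b_def)
    next
      assume r: "rmap D y \<notin> i ` points X \<and> rmap D y \<in> j ` points Y"
      then have "act P g (rmap D y) \<notin> i ` points X" using stable'[OF g] disj by blast
      then show ?thesis using b2[OF y] g gy r y by (simp add: b_def)
    qed
  qed
  have a_act: "a (act (bispan.top D) g t) = act (bispan.top D') g (a t)"
    if g: "g \<in> carrier G" and t: "t \<in> tops D" for g t
  proof -
    have y: "mmap D t \<in> mids D" using bispan_points_closed(2)[OF D(1) t] .
    have gt: "act (bispan.top D) g t \<in> tops D"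
      "rmap D (mmap D (act (bispan.top D) g t)) = act P g (rmap D (mmap D t))"
      using bispan_equivariant(2,4)[OF D(1) g t] bispan_equivariant(3)[OF D(1) g y] tgt by simp_all
    have "rmap D (mmap D t) \<in> points P" using bispan_points_closed(3)[OF D(1) y] tgt by simp
    from split[OF this] show ?thesis
    proof
      assume "rmap D (mmap D t) \<in> i ` points X \<and> rmap D (mmap D t) \<notin> j ` points Y"
      then show ?thesis using a1[OF t] g gt stable[OF g] t by (simp add: a_def)
    next
      assume r: "rmap D (mmap D t) \<notin> i ` points X \<and> rmap D (mmap D t) \<in> j ` points Y"
      then have "act P g (rmap D (mmap D t)) \<notin> i ` points X" using stable'[OF g] disj by blast
      then show ?thesis using a2[OF t] g gt r t by (simp add: a_def)
    qed
  qed
  have b_inj: "inj_on b (mids D)"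
  proof (rule inj_onI)
    fix y z assume yz: "y \<in> mids D" "z \<in> mids D" and eq: "b y = b z"
    have r: "rmap D y = rmap D z" using b(2)[OF yz(1)] b(2)[OF yz(2)] eq by simp
    show "y = z"
    proof (cases "rmap D y \<in> i ` points X")
      case True
      then have "b1 y = b1 z" using eq r yz by (simp add: b_def)
      then show ?thesis using inj_onD[OF inj1(1)] True r yz by simp
    next
      case False
      then have "b2 y = b2 z" using eq r yz by (simp add: b_def)
      moreover have "rmap D y \<in> j ` points Y"
        using False split bispan_points_closed(3)[OF D(1) yz(1)] tgt by blast
      ultimately show ?thesis using inj_onD[OF inj2(1)] r yz by simp
    qed
  qed
  have a_inj: "inj_on a (tops D)"
  proof (rule inj_onI)
    fix t u assume tu: "t \<in> tops D" "u \<in> tops D" and eq: "a t = a u"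
    have mtu: "mmap D t \<in> mids D" "mmap D u \<in> mids D"
      using bispan_points_closed(2)[OF D(1)] tu by simp_all
    have "b (mmap D t) = b (mmap D u)" using a(3)[OF tu(1)] a(3)[OF tu(2)] eq by simp
    then have r: "mmap D t = mmap D u" using inj_onD[OF b_inj] mtu by simp
    show "t = u"
    proof (cases "rmap D (mmap D t) \<in> i ` points X")
      case True
      then have "a1 t = a1 u" using eq r tu by (simp add: a_def)
      then show ?thesis using inj_onD[OF inj1(2)] True r tu by simp
    next
      case False
      then have "a2 t = a2 u" using eq r tu by (simp add: a_def)
      moreover have "rmap D (mmap D t) \<in> j ` points Y"
        using False split bispan_points_closed(3)[OF D(1) mtu(1)] tgt by blast
      ultimately show ?thesis using inj_onD[OF inj2(2)] r tu by simp
    qed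
  qed
  have "a \<in> gmaps G (bispan.top D) (bispan.top D')"
    by (rule gmapsI[OF _ a(1) a_act]) (simp add: a_def extensional_def)
  moreover have "b \<in> gmaps G (mid D) (mid D')"
    by (rule gmapsI[OF _ b(1) b_act]) (simp add: b_def extensional_def)
  ultimately have "bispan_hom G D D' a b"
    unfolding bispan_hom_def using src tgt a(2,3) b(2) by simp
  then show ?thesis using a_inj b_inj by blast
qed

lemma restriction_in_Hom:
  assumes "is_gset G X" "is_gset G Y" "f \<in> gmaps G X Y"
  shows "restriction G X Y f \<in> Hom (bispan_cat G) Y X"
  unfolding Hom_bispan_cat restriction_def
  using assms
  by (intro exI[of _ "\<lparr>src = Y, top = X, mid = X, tgt = X, lmap = f, mmap = gid X, rmap = gid X\<rparr>"])
     (simp add: is_bispan_def gid_gmaps)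

text \<open>
  Bispans into a disjoint union \<open>P\<close> of \<open>X\<close> and \<open>Y\<close> are pairs of bispans into \<open>X\<close> and into \<open>Y\<close>: the pair
  is recovered by disjoint unions of the last two sets.  The statement allows any two jointly surjective
  injections with disjoint images, so that it applies both to the standard sum and to the decomposition of
  a \<open>G\<close>-set into an orbit and its complement.
\<close>

lemma is_product_disjoint_cover:
  assumes X: "is_gset G X" and Y: "is_gset G Y" and P: "is_gset G P"
    and i: "i \<in> gmaps G X P" "inj_on i (points X)" and j: "j \<in> gmaps G Y P" "inj_on j (points Y)"
    and disj: "i ` points X \<inter> j ` points Y = {}" and cover: "i ` points X \<union> j ` points Y = points P"
  shows "is_product (bispan_cat G) X Y P (restriction G X P i) (restriction G Y P j)"
  unfolding is_product_def
proof (intro conjI ballI)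
  fix Z f k assume "Z \<in> Ob (bispan_cat G)"
    and f: "f \<in> Hom (bispan_cat G) Z X" and k: "k \<in> Hom (bispan_cat G) Z Y"
  then have Z: "is_gset G Z" by simp
  obtain F where F: "is_bispan G F" "src F = Z" "tgt F = X" "f = bispan_class G F"
    using f unfolding Hom_bispan_cat by blast
  obtain K where K: "is_bispan G K" "src K = Z" "tgt K = Y" "k = bispan_class G K"
    using k unfolding Hom_bispan_cat by blast
  note clF = bispan_closed[OF F(1)] and clK = bispan_closed[OF K(1)]
  note pF = bispan_points_closed[OF F(1)] and pK = bispan_points_closed[OF K(1)]
  let ?A = "gset_sum G (bispan.top F) (bispan.top K)" and ?B = "gset_sum G (mid F) (mid K)"
  let ?m = "sum_case_map (bispan.top F) (bispan.top K)
    (compose (tops F) (gset_inl (mid F)) (mmap F))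
    (compose (tops K) (gset_inr (mid K)) (mmap K))"
  let ?r = "sum_case_map (mid F) (mid K) (compose (mids F) i (rmap F)) (compose (mids K) j (rmap K))"
  let ?D = "\<lparr>src = Z, top = ?A, mid = ?B, tgt = P,
    lmap = sum_case_map (bispan.top F) (bispan.top K) (lmap F) (lmap K), mmap = ?m, rmap = ?r\<rparr>"
  have D: "is_bispan G ?D"
    unfolding is_bispan_def bispan.simps
  proof (intro conjI)
    show "sum_case_map (bispan.top F) (bispan.top K) (lmap F) (lmap K) \<in> gmaps G ?A Z"
      using clF clK F(2) K(2) by (intro sum_case_map_gmaps) simp_all
    show "?m \<in> gmaps G ?A ?B"
      by (rule sum_case_map_gmaps[OF clF(2) clK(2)
            compose_gmaps[OF clF(2,6) gset_inl_gmaps[OF clF(3)]]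
            compose_gmaps[OF clK(2,6) gset_inr_gmaps[OF clK(3)]]])
    show "?r \<in> gmaps G ?B P"
      using clF clK F(3) K(3) i(1) j(1) by (intro sum_case_map_gmaps compose_gmaps) simp_all
  qed (use clF clK Z P in \<open>simp_all add: gset_sum\<close>)
  have disj': False if "x \<in> points X" "y \<in> points Y" "i x = j y" for x y
    using that disj by blast
  have compF: "Comp (bispan_cat G) (restriction G X P i) (bispan_class G ?D) = f"
  proof -
    have "Comp (bispan_cat G) (restriction G (tgt F) (tgt ?D) i) (bispan_class G ?D) = bispan_class G F"
    proof (rule Comp_restriction[OF D F(1)])
      show "gset_inl (mid F) \<in> gmaps G (mid F) (mid ?D)" using clF by (simp add: gset_inl_gmaps)
      show "gset_inl (bispan.top F) \<in> gmaps G (bispan.top F) (bispan.top ?D)"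
        using clF by (simp add: gset_inl_gmaps)
      fix b x assume b: "b \<in> mids ?D" and x: "x \<in> points (tgt F)" and eq: "rmap ?D b = i x"
      from b[unfolded bispan.simps] have "\<exists>e\<in>mids F. b = sum_encode (Inl e) \<and> rmap F e = x"
      proof (cases rule: gset_sum_cases)
        case (inl e)
        then have "i (rmap F e) = i x" using eq by (simp add: compose_eq)
        then show ?thesis using inl x pF(3)[OF inl(1)] F(3) i(2) by (metis inj_onD)
      next
        case (inr e)
        then have "j (rmap K e) = i x" using eq by (simp add: compose_eq)
        then show ?thesis using x pK(3)[OF inr(1)] F(3) K(3) disj' by metis
      qed
      then obtain e where e: "e \<in> mids F" "b = sum_encode (Inl e)" "rmap F e = x" by blast
      show "\<exists>!e. e \<in> mids F \<and> gset_inl (mid F) e = b \<and> rmap F e = x"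
        by (rule ex1I[of _ e]) (use e in \<open>auto simp: sum_encode_eq\<close>)
    next
      fix y e assume y: "y \<in> tops ?D" and e: "e \<in> mids F"
        and eq: "mmap ?D y = gset_inl (mid F) e"
      from y[unfolded bispan.simps] have "\<exists>t\<in>tops F. y = sum_encode (Inl t) \<and> mmap F t = e"
        by (cases rule: gset_sum_cases) (use eq e pF(2) pK(2) in \<open>auto simp: compose_eq sum_encode_eq\<close>)
      then obtain t where t: "t \<in> tops F" "y = sum_encode (Inl t)" "mmap F t = e" by blast
      show "\<exists>!t. t \<in> tops F \<and> gset_inl (bispan.top F) t = y \<and> mmap F t = e"
        by (rule ex1I[of _ t]) (use t in \<open>auto simp: sum_encode_eq\<close>)
    qed (use F(2,3) i pF in \<open>simp_all add: compose_eq\<close>)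
    then show ?thesis by (simp add: F(3,4))
  qed
  have compK: "Comp (bispan_cat G) (restriction G Y P j) (bispan_class G ?D) = k"
  proof -
    have "Comp (bispan_cat G) (restriction G (tgt K) (tgt ?D) j) (bispan_class G ?D) = bispan_class G K"
    proof (rule Comp_restriction[OF D K(1)])
      show "gset_inr (mid K) \<in> gmaps G (mid K) (mid ?D)" using clK by (simp add: gset_inr_gmaps)
      show "gset_inr (bispan.top K) \<in> gmaps G (bispan.top K) (bispan.top ?D)"
        using clK by (simp add: gset_inr_gmaps)
      fix b x assume b: "b \<in> mids ?D" and x: "x \<in> points (tgt K)" and eq: "rmap ?D b = j x"
      from b[unfolded bispan.simps] have "\<exists>e\<in>mids K. b = sum_encode (Inr e) \<and> rmap K e = x"
      proof (cases rule: gset_sum_cases)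
        case (inr e)
        then have "j (rmap K e) = j x" using eq by (simp add: compose_eq)
        then show ?thesis using inr x pK(3)[OF inr(1)] K(3) j(2) by (metis inj_onD)
      next
        case (inl e)
        then have "i (rmap F e) = j x" using eq by (simp add: compose_eq)
        then show ?thesis using x pF(3)[OF inl(1)] F(3) K(3) disj' by metis
      qed
      then obtain e where e: "e \<in> mids K" "b = sum_encode (Inr e)" "rmap K e = x" by blast
      show "\<exists>!e. e \<in> mids K \<and> gset_inr (mid K) e = b \<and> rmap K e = x"
        by (rule ex1I[of _ e]) (use e in \<open>auto simp: sum_encode_eq\<close>)
    next
      fix y e assume y: "y \<in> tops ?D" and e: "e \<in> mids K"
        and eq: "mmap ?D y = gset_inr (mid K) e"
      from y[unfolded bispan.simps] have "\<exists>t\<in>tops K. y = sum_encode (Inr t) \<and> mmap K t = e"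
        by (cases rule: gset_sum_cases) (use eq e pF(2) pK(2) in \<open>auto simp: compose_eq sum_encode_eq\<close>)
      then obtain t where t: "t \<in> tops K" "y = sum_encode (Inr t)" "mmap K t = e" by blast
      show "\<exists>!t. t \<in> tops K \<and> gset_inr (bispan.top K) t = y \<and> mmap K t = e"
        by (rule ex1I[of _ t]) (use t in \<open>auto simp: sum_encode_eq\<close>)
    qed (use K(2,3) j pK in \<open>simp_all add: compose_eq\<close>)
    then show ?thesis by (simp add: K(3,4))
  qed
  show "\<exists>!h. h \<in> Hom (bispan_cat G) Z P \<and> Comp (bispan_cat G) (restriction G X P i) h = f \<and>
      Comp (bispan_cat G) (restriction G Y P j) h = k"
  proof (rule ex1I[of _ "bispan_class G ?D"])
    have "bispan_class G ?D \<in> Hom (bispan_cat G) Z P"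
      unfolding Hom_bispan_cat by (rule exI[of _ ?D]) (simp add: D)
    then show "bispan_class G ?D \<in> Hom (bispan_cat G) Z P \<and>
      Comp (bispan_cat G) (restriction G X P i) (bispan_class G ?D) = f \<and>
      Comp (bispan_cat G) (restriction G Y P j) (bispan_class G ?D) = k"
      using compF compK by blast
  next
    fix h assume h: "h \<in> Hom (bispan_cat G) Z P \<and> Comp (bispan_cat G) (restriction G X P i) h = f \<and>
      Comp (bispan_cat G) (restriction G Y P j) h = k"
    then obtain E where E: "is_bispan G E" "src E = Z" "tgt E = P" "h = bispan_class G E"
      unfolding Hom_bispan_cat by blast
    have parts: "(part_bispan E V l, part_bispan ?D V l) \<in> bispan_iso G"
      if V: "is_gset G V" "l \<in> gmaps G V P" "inj_on l (points V)"
        and eq: "Comp (bispan_cat G) (restriction G V P l) h =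
          Comp (bispan_cat G) (restriction G V P l) (bispan_class G ?D)" for V l
    proof -
      have "bispan_class G (part_bispan E V l) = bispan_class G (part_bispan ?D V l)"
        using eq Comp_restriction_part[OF E(1) V(1) _ V(3)] Comp_restriction_part[OF D V(1) _ V(3)]
          V(2) E(3,4) by simp
      then show ?thesis
        using bispan_class_eq_iff part_bispan[OF D V(1) _ V(3)] V(2) by simp
    qed
    have pX: "(part_bispan E X i, part_bispan ?D X i) \<in> bispan_iso G"
      using parts[OF X i] h compF by simp
    have pY: "(part_bispan E Y j, part_bispan ?D Y j) \<in> bispan_iso G"
      using parts[OF Y j] h compK by simp
    have P': "tgt ?D = P" "src ?D = Z" by simp_all
    obtain a b where "bispan_hom G E ?D a b" "inj_on a (tops E)" "inj_on b (mids E)"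
      using part_bispan_glue[OF E(1) D X Y _ E(3) P'(1) i j disj cover pX pY] E(2) P'(2) by auto
    moreover obtain a' b' where "bispan_hom G ?D E a' b'" "inj_on a' (tops ?D)"
      "inj_on b' (mids ?D)"
      using part_bispan_glue[OF D E(1) X Y _ P'(1) E(3) i j disj cover
          bispan_iso_sym[OF pX] bispan_iso_sym[OF pY]] E(2) P'(2) by auto
    ultimately have "(E, ?D) \<in> bispan_iso G" using bispan_iso_antisym[OF E(1) D] by blast
    then show "h = bispan_class G ?D" using bispan_class_eq E(4) by simp
  qed
qed (use X Y P i(1) j(1) in \<open>simp_all add: restriction_in_Hom\<close>)

end

section \<open>Relations between restrictions, norms and transfers\<close>

context group
begin

abbreviation restriction_bispan where
  "restriction_bispan X Y f \<equiv>
     \<lparr>src = Y, top = X, mid = X, tgt = X, lmap = f, mmap = gid X, rmap = gid X\<rparr>"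

abbreviation norm_bispan where
  "norm_bispan X Y f \<equiv>
     \<lparr>src = X, top = X, mid = Y, tgt = Y, lmap = gid X, mmap = f, rmap = gid Y\<rparr>"

abbreviation transfer_bispan where
  "transfer_bispan X Y f \<equiv>
     \<lparr>src = X, top = X, mid = X, tgt = Y, lmap = gid X, mmap = gid X, rmap = f\<rparr>"

abbreviation empty_map where "empty_map \<equiv> gid (gset_empty G)"

lemma compose_empty [simp]: "compose {} f k = empty_map"
  by (simp add: compose_def gid_def restrict_def)

lemma norm_gid: "norm_map G X X (gid X) = Ident (bispan_cat G) X"
  and transfer_gid: "transfer_map G X X (gid X) = Ident (bispan_cat G) X"
  by (simp_all add: norm_map_def transfer_map_def bispan_cat_def)

context
  fixes X Y f
  assumes X: "is_gset G X" and Y: "is_gset G Y" and f: "f \<in> gmaps G X Y"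
begin

lemma is_bispan_restriction:
  "is_bispan G (restriction_bispan X Y f)"
  using X Y f by (simp add: is_bispan_def gid_gmaps)

lemma is_bispan_norm:
  "is_bispan G (norm_bispan X Y f)"
  using X Y f by (simp add: is_bispan_def gid_gmaps)

lemma is_bispan_transfer:
  "is_bispan G (transfer_bispan X Y f)"
  using X Y f by (simp add: is_bispan_def gid_gmaps)

lemma norm_in_Hom: "norm_map G X Y f \<in> Hom (bispan_cat G) X Y"
  unfolding Hom_bispan_cat norm_map_def
  by (rule exI, rule conjI[OF is_bispan_norm]) simp

lemma transfer_in_Hom: "transfer_map G X Y f \<in> Hom (bispan_cat G) X Y"
  unfolding Hom_bispan_cat transfer_map_def
  by (rule exI, rule conjI[OF is_bispan_transfer]) simp

end

lemma Comp_restriction_restriction: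
  assumes X: "is_gset G X" and Y: "is_gset G Y" and Z: "is_gset G Z"
    and f: "f \<in> gmaps G X Y" and g: "g \<in> gmaps G Y Z"
  shows "Comp (bispan_cat G) (restriction G X Y f) (restriction G Y Z g) =
    restriction G X Z (compose (points X) g f)"
proof -
  let ?D = "restriction_bispan Y Z g"
  let ?U = "restriction_bispan X Z (compose (points X) g f)"
  have "Comp (bispan_cat G) (restriction G (tgt ?U) (tgt ?D) f) (bispan_class G ?D) = bispan_class G ?U"
  proof (rule Comp_restriction[OF is_bispan_restriction[OF Y Z g]
        is_bispan_restriction[OF X Z compose_gmaps[OF X f g]], where \<alpha> = f and \<beta> = f];
      simp only: bispan.simps)
    fix b x assume "b \<in> points Y" "x \<in> points X" "gid Y b = f x"
    then show "\<exists>!e. e \<in> points X \<and> f e = b \<and> gid X e = x"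
      by (intro ex1I[of _ x]) (simp_all add: gid_apply, metis gid_apply)
  next
    fix y e assume "y \<in> points Y" "e \<in> points X" "gid Y y = f e"
    then show "\<exists>!t. t \<in> points X \<and> f t = y \<and> gid X t = e"
      by (intro ex1I[of _ e]) (simp_all add: gid_apply, metis gid_apply)
  qed (use f in \<open>simp_all add: gid_apply gmaps_closed compose_eq\<close>)
  then show ?thesis by (simp add: restriction_def)
qed

lemma Comp_norm_norm:
  assumes X: "is_gset G X" and Y: "is_gset G Y" and Z: "is_gset G Z"
    and f: "f \<in> gmaps G X Y" and g: "g \<in> gmaps G Y Z"
  shows "Comp (bispan_cat G) (norm_map G Y Z g) (norm_map G X Y f) =
    norm_map G X Z (compose (points X) g f)"
  using Comp_norm[OF is_bispan_norm[OF X Y f], simplified bispan.simps, OF refl refl Z g]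
  by (simp add: norm_map_def)

lemma Comp_transfer_transfer:
  assumes X: "is_gset G X" and Y: "is_gset G Y" and Z: "is_gset G Z"
    and f: "f \<in> gmaps G X Y" and g: "g \<in> gmaps G Y Z"
  shows "Comp (bispan_cat G) (transfer_map G Y Z g) (transfer_map G X Y f) =
    transfer_map G X Z (compose (points X) g f)"
  using Comp_transfer[OF is_bispan_transfer[OF X Y f], simplified bispan.simps, OF Z g]
  by (simp add: transfer_map_def)

text \<open>
  The bispans \<open>X \<leftarrow> \<emptyset> \<rightarrow> Y = Y\<close> and \<open>X \<leftarrow> \<emptyset> \<rightarrow> \<emptyset> \<rightarrow> Y\<close> factor through \<open>\<emptyset>\<close>, where a Tambara functor has
  only one element, so they act as the constants \<open>1\<close> and \<open>0\<close>.
\<close>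

lemma Comp_norm_empty_restriction_empty:
  assumes X: "is_gset G X" and Y: "is_gset G Y"
  shows "Comp (bispan_cat G) (norm_map G (gset_empty G) Y empty_map)
      (restriction G (gset_empty G) X empty_map) =
    bispan_class G \<lparr>src = X, top = gset_empty G, mid = Y, tgt = Y,
      lmap = empty_map, mmap = empty_map, rmap = gid Y\<rparr>"
  using Comp_norm[OF is_bispan_restriction[OF gset_empty X gid_gset_empty_gmaps],
      simplified bispan.simps, OF refl refl Y gid_gset_empty_gmaps]
  by (simp add: restriction_def)

lemma Comp_transfer_empty_restriction_empty:
  assumes X: "is_gset G X" and Y: "is_gset G Y"
  shows "Comp (bispan_cat G) (transfer_map G (gset_empty G) Y empty_map)
      (restriction G (gset_empty G) X empty_map) =
    bispan_class G \<lparr>src = X, top = gset_empty G, mid = gset_empty G, tgt = Y,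
      lmap = empty_map, mmap = empty_map, rmap = empty_map\<rparr>"
  using Comp_transfer[OF is_bispan_restriction[OF gset_empty X gid_gset_empty_gmaps],
      simplified bispan.simps, OF Y gid_gset_empty_gmaps]
  by (simp add: restriction_def)

text \<open>
  Base change for an injection \<open>i\<close>: over \<open>X\<close> its fibres are points, and over a set \<open>Y\<close> disjoint from
  \<open>X\<close> they are empty.  So a norm along \<open>i\<close> becomes \<open>1\<close> on \<open>Y\<close> and a transfer becomes \<open>0\<close>.
\<close>

context
  fixes X Y P i j
  assumes X: "is_gset G X" and Y: "is_gset G Y" and P: "is_gset G P"
    and i: "i \<in> gmaps G X P" and inj: "inj_on i (points X)" and j: "j \<in> gmaps G Y P"
    and disj: "i ` points X \<inter> j ` points Y = {}"
begin

lemma Comp_restriction_norm_same: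
  "Comp (bispan_cat G) (restriction G X P i) (norm_map G X P i) = Ident (bispan_cat G) X"
proof -
  let ?D = "norm_bispan X P i"
  let ?U = "restriction_bispan X X (gid X)"
  have "Comp (bispan_cat G) (restriction G (tgt ?U) (tgt ?D) i) (bispan_class G ?D) = bispan_class G ?U"
  proof (rule Comp_restriction[OF is_bispan_norm[OF X P i] is_bispan_restriction[OF X X gid_gmaps[OF X]],
        where \<alpha> = "gid X" and \<beta> = i]; simp only: bispan.simps)
    fix b x assume "b \<in> points P" "x \<in> points X" "gid P b = i x"
    then show "\<exists>!e. e \<in> points X \<and> i e = b \<and> gid X e = x"
      by (intro ex1I[of _ x]) (simp_all add: gid_apply, metis gid_apply)
  next
    fix y e assume "y \<in> points X" "e \<in> points X" "i y = i e"
    then have "y = e" "y \<in> points X" using inj by (auto dest: inj_onD)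
    then show "\<exists>!t. t \<in> points X \<and> gid X t = y \<and> gid X t = e"
      by (intro ex1I[of _ e]) (simp_all add: gid_apply, metis gid_apply)
  qed (use X i in \<open>simp_all add: gid_gmaps gid_apply gmaps_closed\<close>)
  then show ?thesis by (simp add: norm_map_def bispan_cat_def)
qed

lemma Comp_restriction_transfer_same:
  "Comp (bispan_cat G) (restriction G X P i) (transfer_map G X P i) = Ident (bispan_cat G) X"
proof -
  let ?D = "transfer_bispan X P i"
  let ?U = "restriction_bispan X X (gid X)"
  have "Comp (bispan_cat G) (restriction G (tgt ?U) (tgt ?D) i) (bispan_class G ?D) = bispan_class G ?U"
  proof (rule Comp_restriction[OF is_bispan_transfer[OF X P i] is_bispan_restriction[OF X X gid_gmaps[OF X]],
        where \<alpha> = "gid X" and \<beta> = "gid X"]; simp only: bispan.simps)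
    fix b x assume "b \<in> points X" "x \<in> points X" "i b = i x"
    then have "b = x" "x \<in> points X" using inj by (auto dest: inj_onD)
    then show "\<exists>!e. e \<in> points X \<and> gid X e = b \<and> gid X e = x"
      by (intro ex1I[of _ x]) (simp_all add: gid_apply, metis gid_apply)
  next
    fix y e assume "y \<in> points X" "e \<in> points X" "gid X y = gid X e"
    then have "y = e" "e \<in> points X" by (simp_all add: gid_apply)
    then show "\<exists>!t. t \<in> points X \<and> gid X t = y \<and> gid X t = e"
      by (intro ex1I[of _ e]) (simp_all add: gid_apply, metis gid_apply)
  qed (use X i in \<open>simp_all add: gid_gmaps gid_apply gmaps_closed\<close>)
  then show ?thesis by (simp add: transfer_map_def bispan_cat_def)
qed

lemma Comp_restriction_norm_disjoint:
  "Comp (bispan_cat G) (restriction G Y P j) (norm_map G X P i) =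
   Comp (bispan_cat G) (norm_map G (gset_empty G) Y empty_map) (restriction G (gset_empty G) X empty_map)"
proof -
  let ?D = "norm_bispan X P i"
  let ?U = "\<lparr>src = X, top = gset_empty G, mid = Y, tgt = Y, lmap = empty_map, mmap = empty_map, rmap = gid Y\<rparr>"
  have U: "is_bispan G ?U"
    using X Y by (simp add: is_bispan_def gset_empty gid_gset_empty_gmaps gid_gmaps)
  have "Comp (bispan_cat G) (restriction G (tgt ?U) (tgt ?D) j) (bispan_class G ?D) = bispan_class G ?U"
  proof (rule Comp_restriction[OF is_bispan_norm[OF X P i] U, where \<alpha> = empty_map and \<beta> = j];
      simp only: bispan.simps)
    fix b x assume "b \<in> points P" "x \<in> points Y" "gid P b = j x"
    then show "\<exists>!e. e \<in> points Y \<and> j e = b \<and> gid Y e = x"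
      by (intro ex1I[of _ x]) (simp_all add: gid_apply, metis gid_apply)
  next
    fix y e assume "y \<in> points X" "e \<in> points Y" "i y = j e"
    then have False using disj by blast
    then show "\<exists>!t. t \<in> points (gset_empty G) \<and> empty_map t = y \<and> empty_map t = e" ..
  qed (use j in \<open>simp_all add: gid_gset_empty_gmaps gid_apply gmaps_closed\<close>)
  then show ?thesis using Comp_norm_empty_restriction_empty[OF X Y] by (simp add: norm_map_def)
qed

lemma Comp_restriction_transfer_disjoint:
  "Comp (bispan_cat G) (restriction G Y P j) (transfer_map G X P i) =
   Comp (bispan_cat G) (transfer_map G (gset_empty G) Y empty_map) (restriction G (gset_empty G) X empty_map)"
proof -
  let ?D = "transfer_bispan X P i"
  let ?U = "\<lparr>src = X, top = gset_empty G, mid = gset_empty G, tgt = Y,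
    lmap = empty_map, mmap = empty_map, rmap = empty_map\<rparr>"
  have U: "is_bispan G ?U"
    using X Y by (simp add: is_bispan_def gset_empty gid_gset_empty_gmaps gid_gmaps)
  have "Comp (bispan_cat G) (restriction G (tgt ?U) (tgt ?D) j) (bispan_class G ?D) = bispan_class G ?U"
  proof (rule Comp_restriction[OF is_bispan_transfer[OF X P i] U, where \<alpha> = empty_map and \<beta> = empty_map];
      simp only: bispan.simps)
    fix b x assume "b \<in> points X" "x \<in> points Y" "i b = j x"
    then have False using disj by blast
    then show "\<exists>!e. e \<in> points (gset_empty G) \<and> empty_map e = b \<and> empty_map e = x" ..
  qed (use j in \<open>simp_all add: gid_gset_empty_gmaps\<close>)
  then show ?thesis using Comp_transfer_empty_restriction_empty[OF X Y] by (simp add: transfer_map_def)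
qed

end

lemma Comp_restriction_unit:
  assumes X: "is_gset G X" and Y: "is_gset G Y" and f: "f \<in> gmaps G X Y"
  shows "Comp (bispan_cat G) (restriction G X Y f) (norm_map G (gset_empty G) Y empty_map) =
    norm_map G (gset_empty G) X empty_map"
proof -
  let ?D = "\<lparr>src = gset_empty G, top = gset_empty G, mid = Y, tgt = Y, lmap = empty_map, mmap = empty_map, rmap = gid Y\<rparr>"
  let ?U = "\<lparr>src = gset_empty G, top = gset_empty G, mid = X, tgt = X, lmap = empty_map, mmap = empty_map, rmap = gid X\<rparr>"
  have "Comp (bispan_cat G) (restriction G (tgt ?U) (tgt ?D) f) (bispan_class G ?D) = bispan_class G ?U"
  proof (rule Comp_restriction[OF is_bispan_norm[OF gset_empty Y gid_gset_empty_gmaps]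
        is_bispan_norm[OF gset_empty X gid_gset_empty_gmaps], where \<alpha> = empty_map and \<beta> = f];
      simp only: bispan.simps)
    fix b x assume "b \<in> points Y" "x \<in> points X" "gid Y b = f x"
    then show "\<exists>!e. e \<in> points X \<and> f e = b \<and> gid X e = x"
      by (intro ex1I[of _ x]) (simp_all add: gid_apply, metis gid_apply)
  qed (use f in \<open>simp_all add: gid_gset_empty_gmaps gid_apply gmaps_closed\<close>)
  then show ?thesis by (simp add: norm_map_def)
qed

lemma Comp_restriction_zero:
  assumes X: "is_gset G X" and Y: "is_gset G Y" and f: "f \<in> gmaps G X Y"
  shows "Comp (bispan_cat G) (restriction G X Y f) (transfer_map G (gset_empty G) Y empty_map) =
    transfer_map G (gset_empty G) X empty_map"
proof -
  let ?e = "gset_empty G"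
  let ?D = "\<lparr>src = ?e, top = ?e, mid = ?e, tgt = Y, lmap = empty_map, mmap = empty_map, rmap = empty_map\<rparr>"
  let ?U = "\<lparr>src = ?e, top = ?e, mid = ?e, tgt = X, lmap = empty_map, mmap = empty_map, rmap = empty_map\<rparr>"
  have "Comp (bispan_cat G) (restriction G (tgt ?U) (tgt ?D) f) (bispan_class G ?D) = bispan_class G ?U"
    by (rule Comp_restriction[OF is_bispan_transfer[OF gset_empty Y gid_gset_empty_gmaps]
        is_bispan_transfer[OF gset_empty X gid_gset_empty_gmaps], where \<alpha> = empty_map and \<beta> = empty_map])
       (use f in \<open>simp_all add: gid_gset_empty_gmaps\<close>)
  then show ?thesis by (simp add: transfer_map_def)
qed

definition sum_map :: "'a gset \<Rightarrow> (nat \<Rightarrow> nat) \<Rightarrow> nat \<Rightarrow> nat" where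
  "sum_map X f = sum_case_map X X (\<lambda>x. sum_encode (Inl (f x))) (\<lambda>x. sum_encode (Inr (f x)))"

lemma sum_map_apply [simp]:
  "x \<in> points X \<Longrightarrow> sum_map X f (sum_encode (Inl x)) = sum_encode (Inl (f x))"
  "x \<in> points X \<Longrightarrow> sum_map X f (sum_encode (Inr x)) = sum_encode (Inr (f x))"
  by (simp_all add: sum_map_def)

lemma sum_map_gmaps:
  assumes X: "is_gset G X" and f: "f \<in> gmaps G X Y"
  shows "sum_map X f \<in> gmaps G (gset_sum G X X) (gset_sum G Y Y)"
proof (rule gmapsI)
  show "sum_map X f \<in> extensional (points (gset_sum G X X))"
    by (simp add: sum_map_def sum_case_map_def)
  show "sum_map X f n \<in> points (gset_sum G Y Y)" if "n \<in> points (gset_sum G X X)" for n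
    using that by (cases rule: gset_sum_cases) (auto simp: points_gset_sum gmaps_closed[OF f])
  show "sum_map X f (act (gset_sum G X X) g n) = act (gset_sum G Y Y) g (sum_map X f n)"
    if "g \<in> carrier G" "n \<in> points (gset_sum G X X)" for g n
    using that(2,1)
    by (cases rule: gset_sum_cases)
       (simp_all add: act_gset_sum gset_act_closed[OF X] gmaps_closed[OF f] gmaps_equivariant[OF f])
qed

text \<open>
  The pullback of the fold map of \<open>Y\<close> along \<open>f\<close> is the fold map of \<open>X\<close>; this makes restrictions
  multiplicative.
\<close>

lemma Comp_restriction_norm_fold:
  assumes X: "is_gset G X" and Y: "is_gset G Y" and f: "f \<in> gmaps G X Y"
  shows "Comp (bispan_cat G) (restriction G X Y f) (norm_map G (gset_sum G Y Y) Y (gset_fold Y)) =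
    Comp (bispan_cat G) (norm_map G (gset_sum G X X) X (gset_fold X))
      (restriction G (gset_sum G X X) (gset_sum G Y Y) (sum_map X f))"
proof -
  let ?SX = "gset_sum G X X" and ?SY = "gset_sum G Y Y"
  let ?D = "norm_bispan ?SY Y (gset_fold Y)"
  let ?U = "\<lparr>src = ?SY, top = ?SX, mid = X, tgt = X, lmap = sum_map X f, mmap = gset_fold X, rmap = gid X\<rparr>"
  note SX = gset_sum[OF X X] and SY = gset_sum[OF Y Y] and s = sum_map_gmaps[OF X f]
  have U: "is_bispan G ?U"
    using SX SY X s by (simp add: is_bispan_def gid_gmaps gset_fold_gmaps)
  have "Comp (bispan_cat G) (restriction G (tgt ?U) (tgt ?D) f) (bispan_class G ?D) = bispan_class G ?U"
  proof (rule Comp_restriction[OF is_bispan_norm[OF SY Y gset_fold_gmaps[OF Y]] U,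
        where \<alpha> = "sum_map X f" and \<beta> = f]; simp only: bispan.simps)
    fix b x assume "b \<in> points Y" "x \<in> points X" "gid Y b = f x"
    then show "\<exists>!e. e \<in> points X \<and> f e = b \<and> gid X e = x"
      by (intro ex1I[of _ x]) (simp_all add: gid_apply, metis gid_apply)
  next
    fix t assume t: "t \<in> points ?SX"
    then show "gset_fold Y (sum_map X f t) = f (gset_fold X t)"
      by (cases rule: gset_sum_cases) (simp_all add: gmaps_closed[OF f])
  next
    fix y e assume y: "y \<in> points ?SY" and e: "e \<in> points X" and eq: "gset_fold Y y = f e"
    from y show "\<exists>!t. t \<in> points ?SX \<and> sum_map X f t = y \<and> gset_fold X t = e"
    proof (cases rule: gset_sum_cases)
      case (inl z)
      show ?thesis
      proof (rule ex1I[of _ "sum_encode (Inl e)"])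
        fix t assume "t \<in> points ?SX \<and> sum_map X f t = y \<and> gset_fold X t = e"
        then show "t = sum_encode (Inl e)"
          using inl by (elim conjE gset_sum_cases) (simp_all add: sum_encode_eq)
      qed (use e eq inl in \<open>auto simp: points_gset_sum\<close>)
    next
      case (inr z)
      show ?thesis
      proof (rule ex1I[of _ "sum_encode (Inr e)"])
        fix t assume "t \<in> points ?SX \<and> sum_map X f t = y \<and> gset_fold X t = e"
        then show "t = sum_encode (Inr e)"
          using inr by (elim conjE gset_sum_cases) (simp_all add: sum_encode_eq)
      qed (use e eq inr in \<open>auto simp: points_gset_sum\<close>)
    qed
  qed (use f s SX SY in \<open>simp_all add: gid_apply gmaps_closed\<close>)
  moreover have "Comp (bispan_cat G) (norm_map G ?SX X (gset_fold X)) (restriction G ?SX ?SY (sum_map X f)) =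
      bispan_class G ?U"
  proof -
    have "compose (points ?SX) (gset_fold X) (gid ?SX) = gset_fold X"
      by (rule gmaps_eqI[OF compose_gmaps[OF SX gid_gmaps[OF SX] gset_fold_gmaps[OF X]] gset_fold_gmaps[OF X]])
         (simp add: compose_eq gid_apply)
    then show ?thesis
      using Comp_norm[OF is_bispan_restriction[OF SX SY s], simplified bispan.simps, OF refl refl X gset_fold_gmaps[OF X]]
      by (simp add: restriction_def)
  qed
  ultimately show ?thesis by (simp add: norm_map_def)
qed

end

section \<open>Arithmetic in a Tambara functor\<close>

locale tambara_functor = group G for G :: "('g, 'b) monoid_scheme" (structure) +
  fixes R :: "('g, 'r) tambara"
  assumes tambara: "is_tambara G R"
begin

abbreviation res where "res X Y f \<equiv> mor R (restriction G X Y f)"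
abbreviation nrm where "nrm X Y f \<equiv> mor R (norm_map G X Y f)"
abbreviation tr where "tr X Y f \<equiv> mor R (transfer_map G X Y f)"
abbreviation unit where "unit X \<equiv> \<one>\<^bsub>tambara_ring G R X\<^esub>"
abbreviation null where "null X \<equiv> \<zero>\<^bsub>tambara_ring G R X\<^esub>"

lemma is_functor: "is_set_functor (bispan_cat G) R"
  and products: "preserves_products (bispan_cat G) R"
  using tambara by (simp_all add: is_tambara_def)

lemma mor_closed:
  assumes "c \<in> Hom (bispan_cat G) X Y" "is_gset G X" "is_gset G Y" "x \<in> obj R X"
  shows "mor R c x \<in> obj R Y"
proof -
  have "X \<in> Ob (bispan_cat G)" "Y \<in> Ob (bispan_cat G)" using assms by simp_all
  then have "mor R c \<in> obj R X \<rightarrow> obj R Y"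
    using is_functor assms(1) unfolding is_set_functor_def by blast
  then show ?thesis using assms(4) by (rule funcset_mem)
qed

lemma mor_Ident:
  assumes "is_gset G X" "x \<in> obj R X"
  shows "mor R (Ident (bispan_cat G) X) x = x"
proof -
  have "X \<in> Ob (bispan_cat G)" using assms by simp
  then show ?thesis using is_functor assms(2) unfolding is_set_functor_def by blast
qed

lemma mor_Comp:
  assumes "c \<in> Hom (bispan_cat G) X Y" "d \<in> Hom (bispan_cat G) Y Z"
    "is_gset G X" "is_gset G Y" "is_gset G Z" "x \<in> obj R X"
  shows "mor R d (mor R c x) = mor R (Comp (bispan_cat G) d c) x"
proof -
  have "X \<in> Ob (bispan_cat G)" "Y \<in> Ob (bispan_cat G)" "Z \<in> Ob (bispan_cat G)"
    using assms by simp_all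
  then have "mor R (Comp (bispan_cat G) d c) x = mor R d (mor R c x)"
    using is_functor assms(1,2,6) unfolding is_set_functor_def by blast
  then show ?thesis by simp
qed

lemma res_closed: "is_gset G X \<Longrightarrow> is_gset G Y \<Longrightarrow> f \<in> gmaps G X Y \<Longrightarrow> y \<in> obj R Y
    \<Longrightarrow> res X Y f y \<in> obj R X"
  and nrm_closed: "is_gset G X \<Longrightarrow> is_gset G Y \<Longrightarrow> f \<in> gmaps G X Y \<Longrightarrow> x \<in> obj R X
    \<Longrightarrow> nrm X Y f x \<in> obj R Y"
  and tr_closed: "is_gset G X \<Longrightarrow> is_gset G Y \<Longrightarrow> f \<in> gmaps G X Y \<Longrightarrow> x \<in> obj R X
    \<Longrightarrow> tr X Y f x \<in> obj R Y"
  using mor_closed restriction_in_Hom norm_in_Hom transfer_in_Hom by blast+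

lemma res_res:
  assumes "is_gset G X" "is_gset G Y" "is_gset G Z" "f \<in> gmaps G X Y" "g \<in> gmaps G Y Z" "z \<in> obj R Z"
  shows "res X Y f (res Y Z g z) = res X Z (compose (points X) g f) z"
  using mor_Comp[OF restriction_in_Hom[OF assms(2,3,5)] restriction_in_Hom[OF assms(1,2,4)]]
    Comp_restriction_restriction[OF assms(1-5)] assms by simp

lemma obj_empty: "obj R (gset_empty G) = {tambara_pt G R}"
proof -
  obtain t where t: "obj R (gset_empty G) = {t}"
    using products is_terminal_gset_empty unfolding preserves_products_def by blast
  then have "tambara_pt G R = t" unfolding tambara_pt_def by simp
  then show ?thesis using t by simp
qed

lemma pt_closed: "tambara_pt G R \<in> obj R (gset_empty G)"
  by (simp add: obj_empty)

lemma unit_def: "unit X = nrm (gset_empty G) X empty_map (tambara_pt G R)"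
  and null_def: "null X = tr (gset_empty G) X empty_map (tambara_pt G R)"
  by (simp_all add: tambara_ring_def)

lemma unit_closed: "is_gset G X \<Longrightarrow> unit X \<in> obj R X"
  and null_closed: "is_gset G X \<Longrightarrow> null X \<in> obj R X"
  by (simp_all add: unit_def null_def nrm_closed tr_closed pt_closed gset_empty gid_gset_empty_gmaps)

lemma res_unit:
  assumes "is_gset G X" "is_gset G Y" "f \<in> gmaps G X Y"
  shows "res X Y f (unit Y) = unit X"
  unfolding unit_def
  using mor_Comp[OF norm_in_Hom[OF gset_empty assms(2) gid_gset_empty_gmaps] restriction_in_Hom[OF assms]
      gset_empty assms(2,1) pt_closed]
  by (simp add: Comp_restriction_unit[OF assms])

lemma res_null:
  assumes "is_gset G X" "is_gset G Y" "f \<in> gmaps G X Y"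
  shows "res X Y f (null Y) = null X"
  unfolding null_def
  using mor_Comp[OF transfer_in_Hom[OF gset_empty assms(2) gid_gset_empty_gmaps] restriction_in_Hom[OF assms]
      gset_empty assms(2,1) pt_closed]
  by (simp add: Comp_restriction_zero[OF assms])

lemma nrm_unit:
  assumes "is_gset G X" "is_gset G Y" "f \<in> gmaps G X Y"
  shows "nrm X Y f (unit X) = unit Y"
  unfolding unit_def
  using mor_Comp[OF norm_in_Hom[OF gset_empty assms(1) gid_gset_empty_gmaps] norm_in_Hom[OF assms]
      gset_empty assms(1,2) pt_closed]
  by (simp add: Comp_norm_norm[OF gset_empty assms(1,2) gid_gset_empty_gmaps assms(3)])

text \<open>
  Over a point of \<open>Y\<close>, surjectivity of \<open>f\<close> provides a point of \<open>X\<close>, at which there is no section of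
  \<open>\<emptyset> \<rightarrow> X\<close>.
\<close>

lemma nrm_null:
  assumes "is_gset G X" "is_gset G Y" "f \<in> gmaps G X Y" "f ` points X = points Y"
  shows "nrm X Y f (null X) = null Y"
proof -
  have "\<exists>x\<in>points X. f x = y \<and> x \<notin> empty_map ` points (gset_empty G)" if "y \<in> points Y" for y
    using that unfolding assms(4)[symmetric] by auto
  then have "Comp (bispan_cat G) (norm_map G X Y f) (transfer_map G (gset_empty G) X empty_map) =
      transfer_map G (gset_empty G) Y empty_map"
    using Comp_norm_transfer_missing_fibres[OF gset_empty assms(1,2) gid_gset_empty_gmaps assms(3)]
    by (simp add: transfer_map_def)
  then show ?thesis
    unfolding null_def
    using mor_Comp[OF transfer_in_Hom[OF gset_empty assms(1) gid_gset_empty_gmaps] norm_in_Hom[OF assms(1-3)]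
        gset_empty assms(1,2) pt_closed] by simp
qed

lemma res_to_empty: "is_gset G X \<Longrightarrow> x \<in> obj R X \<Longrightarrow> res (gset_empty G) X empty_map x = tambara_pt G R"
  using res_closed[OF gset_empty _ gid_gset_empty_gmaps] obj_empty by blast

lemma empty_factorisations:
  assumes X: "is_gset G X" and Y: "is_gset G Y" and x: "x \<in> obj R X"
  shows "mor R (Comp (bispan_cat G) (norm_map G (gset_empty G) Y empty_map)
      (restriction G (gset_empty G) X empty_map)) x = unit Y"
    and "mor R (Comp (bispan_cat G) (transfer_map G (gset_empty G) Y empty_map)
      (restriction G (gset_empty G) X empty_map)) x = null Y"
proof -
  note r = restriction_in_Hom[OF gset_empty X gid_gset_empty_gmaps]
  show "mor R (Comp (bispan_cat G) (norm_map G (gset_empty G) Y empty_map)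
      (restriction G (gset_empty G) X empty_map)) x = unit Y"
    using mor_Comp[OF r norm_in_Hom[OF gset_empty Y gid_gset_empty_gmaps] X gset_empty Y x]
    by (simp add: unit_def res_to_empty X x)
  show "mor R (Comp (bispan_cat G) (transfer_map G (gset_empty G) Y empty_map)
      (restriction G (gset_empty G) X empty_map)) x = null Y"
    using mor_Comp[OF r transfer_in_Hom[OF gset_empty Y gid_gset_empty_gmaps] X gset_empty Y x]
    by (simp add: null_def res_to_empty X x)
qed

context
  fixes X Y P i j
  assumes X: "is_gset G X" and Y: "is_gset G Y" and P: "is_gset G P"
    and i: "i \<in> gmaps G X P" "inj_on i (points X)" and j: "j \<in> gmaps G Y P"
    and disj: "i ` points X \<inter> j ` points Y = {}"
begin

lemma res_nrm_disjoint:
  assumes x: "x \<in> obj R X"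
  shows "res X P i (nrm X P i x) = x" "res Y P j (nrm X P i x) = unit Y"
proof -
  note n = norm_in_Hom[OF X P i(1)]
  show "res X P i (nrm X P i x) = x"
    using mor_Comp[OF n restriction_in_Hom[OF X P i(1)] X P X x]
      Comp_restriction_norm_same[OF X Y P i j disj] mor_Ident[OF X x] by simp
  show "res Y P j (nrm X P i x) = unit Y"
    using mor_Comp[OF n restriction_in_Hom[OF Y P j] X P Y x]
      Comp_restriction_norm_disjoint[OF X Y P i j disj] empty_factorisations(1)[OF X Y x] by simp
qed

lemma res_tr_disjoint:
  assumes x: "x \<in> obj R X"
  shows "res X P i (tr X P i x) = x" "res Y P j (tr X P i x) = null Y"
proof -
  note n = transfer_in_Hom[OF X P i(1)]
  show "res X P i (tr X P i x) = x"
    using mor_Comp[OF n restriction_in_Hom[OF X P i(1)] X P X x]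
      Comp_restriction_transfer_same[OF X Y P i j disj] mor_Ident[OF X x] by simp
  show "res Y P j (tr X P i x) = null Y"
    using mor_Comp[OF n restriction_in_Hom[OF Y P j] X P Y x]
      Comp_restriction_transfer_disjoint[OF X Y P i j disj] empty_factorisations(2)[OF X Y x] by simp
qed

context
  assumes inj_j: "inj_on j (points Y)" and cover: "i ` points X \<union> j ` points Y = points P"
begin

lemma decomposition_bij:
  "bij_betw (\<lambda>z. (res X P i z, res Y P j z)) (obj R P) (obj R X \<times> obj R Y)"
  using products is_product_disjoint_cover[OF X Y P i j inj_j disj cover]
  unfolding preserves_products_def by blast

lemma decomposition_eqI:
  assumes "z \<in> obj R P" "z' \<in> obj R P" "res X P i z = res X P i z'" "res Y P j z = res Y P j z'"
  shows "z = z'"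
  using bij_betw_imp_inj_on[OF decomposition_bij] assms by (auto simp: inj_on_def)

lemma decomposition_ex:
  assumes "x \<in> obj R X" "y \<in> obj R Y"
  shows "\<exists>z\<in>obj R P. res X P i z = x \<and> res Y P j z = y"
proof -
  have "(x, y) \<in> (\<lambda>z. (res X P i z, res Y P j z)) ` obj R P"
    using bij_betw_imp_surj_on[OF decomposition_bij] assms by simp
  then show ?thesis by auto
qed

end

end

lemma sum_decomposition:
  assumes "is_gset G X"
  shows "inj_on (gset_inl X) (points X)" "inj_on (gset_inr X) (points X)"
    "gset_inl X ` points X \<inter> gset_inr X ` points X = {}"
    "gset_inr X ` points X \<inter> gset_inl X ` points X = {}"
    "gset_inl X ` points X \<union> gset_inr X ` points X = points (gset_sum G X X)"
  by (auto simp: inj_on_def sum_encode_eq points_gset_sum image_iff elim!: PlusE)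

context
  fixes X
  assumes X: "is_gset G X"
begin

private abbreviation S where "S \<equiv> gset_sum G X X"
private abbreviation l where "l \<equiv> gset_inl X"
private abbreviation r where "r \<equiv> gset_inr X"
private lemmas S = gset_sum[OF X X]
private lemmas lr = gset_inl_gmaps[OF X, where Y = X] gset_inr_gmaps[OF X, where X = X]
private lemmas d = sum_decomposition[OF X]

lemma pair_ex1:
  assumes "x \<in> obj R X" "y \<in> obj R X"
  shows "\<exists>!z. z \<in> obj R S \<and> res X S l z = x \<and> res X S r z = y"
proof -
  obtain z where z: "z \<in> obj R S" "res X S l z = x" "res X S r z = y"
    using decomposition_ex[OF X X S lr(1) d(1) lr(2) d(3) d(2) d(5) assms] by blast
  show ?thesis
  proof (rule ex1I[of _ z])
    fix z' assume "z' \<in> obj R S \<and> res X S l z' = x \<and> res X S r z' = y"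
    then show "z' = z"
      using decomposition_eqI[OF X X S lr(1) d(1) lr(2) d(3) d(2) d(5), of z' z] z by simp
  qed (use z in simp)
qed

lemma pair_eqI:
  assumes "z \<in> obj R S" "res X S l z = x" "res X S r z = y"
  shows "tambara_pair G R X x y = z"
  unfolding tambara_pair_def
  by (rule the1_equality[OF pair_ex1]) (use assms X S lr in \<open>auto intro: res_closed\<close>)

lemma pair:
  assumes "x \<in> obj R X" "y \<in> obj R X"
  shows "tambara_pair G R X x y \<in> obj R S" "res X S l (tambara_pair G R X x y) = x"
    "res X S r (tambara_pair G R X x y) = y"
  using theI'[OF pair_ex1[OF assms]] unfolding tambara_pair_def by simp_all

lemma mult_def: "x \<otimes>\<^bsub>tambara_ring G R X\<^esub> y = nrm S X (gset_fold X) (tambara_pair G R X x y)"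
  and add_def: "x \<oplus>\<^bsub>tambara_ring G R X\<^esub> y = tr S X (gset_fold X) (tambara_pair G R X x y)"
  by (simp_all add: tambara_ring_def)

lemma mult_closed: "x \<in> obj R X \<Longrightarrow> y \<in> obj R X \<Longrightarrow> x \<otimes>\<^bsub>tambara_ring G R X\<^esub> y \<in> obj R X"
  and add_closed: "x \<in> obj R X \<Longrightarrow> y \<in> obj R X \<Longrightarrow> x \<oplus>\<^bsub>tambara_ring G R X\<^esub> y \<in> obj R X"
  unfolding mult_def add_def
  using X S by (auto intro: nrm_closed tr_closed gset_fold_gmaps pair)

private lemma fold_summand: "compose (points X) (gset_fold X) l = gid X" "compose (points X) (gset_fold X) r = gid X"
  by (auto simp: compose_def gid_def)

text \<open>
  The pair \<open>(x, 1)\<close> is the norm of \<open>x\<close> along the inclusion of the left summand, because norms along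
  \<open>\<emptyset> \<rightarrow> X\<close> are \<open>1\<close>; multiplying its entries is the norm along \<open>X \<rightarrow> X \<squnion> X \<rightarrow> X\<close>, the identity.
\<close>

lemma mult_unit:
  assumes x: "x \<in> obj R X"
  shows "x \<otimes>\<^bsub>tambara_ring G R X\<^esub> unit X = x" "unit X \<otimes>\<^bsub>tambara_ring G R X\<^esub> x = x"
proof -
  have "tambara_pair G R X x (unit X) = nrm X S l x"
    using res_nrm_disjoint[OF X X S lr(1) d(1) lr(2) d(3) x] nrm_closed[OF X S lr(1) x] by (intro pair_eqI)
  then show "x \<otimes>\<^bsub>tambara_ring G R X\<^esub> unit X = x"
    using mor_Comp[OF norm_in_Hom[OF X S lr(1)] norm_in_Hom[OF S X gset_fold_gmaps[OF X]] X S X x]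
      Comp_norm_norm[OF X S X lr(1) gset_fold_gmaps[OF X]]
    by (simp add: mult_def fold_summand norm_gid mor_Ident X x)
  have "tambara_pair G R X (unit X) x = nrm X S r x"
    using res_nrm_disjoint[OF X X S lr(2) d(2) lr(1) d(4) x] nrm_closed[OF X S lr(2) x] by (intro pair_eqI)
  then show "unit X \<otimes>\<^bsub>tambara_ring G R X\<^esub> x = x"
    using mor_Comp[OF norm_in_Hom[OF X S lr(2)] norm_in_Hom[OF S X gset_fold_gmaps[OF X]] X S X x]
      Comp_norm_norm[OF X S X lr(2) gset_fold_gmaps[OF X]]
    by (simp add: mult_def fold_summand norm_gid mor_Ident X x)
qed

lemma add_null:
  assumes x: "x \<in> obj R X"
  shows "x \<oplus>\<^bsub>tambara_ring G R X\<^esub> null X = x" "null X \<oplus>\<^bsub>tambara_ring G R X\<^esub> x = x"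
proof -
  have "tambara_pair G R X x (null X) = tr X S l x"
    using res_tr_disjoint[OF X X S lr(1) d(1) lr(2) d(3) x] tr_closed[OF X S lr(1) x] by (intro pair_eqI)
  then show "x \<oplus>\<^bsub>tambara_ring G R X\<^esub> null X = x"
    using mor_Comp[OF transfer_in_Hom[OF X S lr(1)] transfer_in_Hom[OF S X gset_fold_gmaps[OF X]] X S X x]
      Comp_transfer_transfer[OF X S X lr(1) gset_fold_gmaps[OF X]]
    by (simp add: add_def fold_summand transfer_gid mor_Ident X x)
  have "tambara_pair G R X (null X) x = tr X S r x"
    using res_tr_disjoint[OF X X S lr(2) d(2) lr(1) d(4) x] tr_closed[OF X S lr(2) x] by (intro pair_eqI)
  then show "null X \<oplus>\<^bsub>tambara_ring G R X\<^esub> x = x"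
    using mor_Comp[OF transfer_in_Hom[OF X S lr(2)] transfer_in_Hom[OF S X gset_fold_gmaps[OF X]] X S X x]
      Comp_transfer_transfer[OF X S X lr(2) gset_fold_gmaps[OF X]]
    by (simp add: add_def fold_summand transfer_gid mor_Ident X x)
qed

text \<open>
  The pair \<open>(x, 0)\<close> is the transfer of \<open>x\<close> along the inclusion of the left summand, and every fibre of the
  fold map contains a point outside that summand.
\<close>

lemma mult_null:
  assumes x: "x \<in> obj R X"
  shows "x \<otimes>\<^bsub>tambara_ring G R X\<^esub> null X = null X" "null X \<otimes>\<^bsub>tambara_ring G R X\<^esub> x = null X"
proof -
  have miss: "\<exists>y\<in>points S. gset_fold X y = z \<and> y \<notin> l ` points X"
    "\<exists>y\<in>points S. gset_fold X y = z \<and> y \<notin> r ` points X" if z: "z \<in> points X" for z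
  proof -
    have "sum_encode (Inr z) \<notin> l ` points X" "sum_encode (Inl z) \<notin> r ` points X"
      by (auto simp: sum_encode_eq)
    moreover have "sum_encode (Inr z) \<in> points S" "sum_encode (Inl z) \<in> points S"
      using z by (auto simp: points_gset_sum)
    ultimately show "\<exists>y\<in>points S. gset_fold X y = z \<and> y \<notin> l ` points X"
      "\<exists>y\<in>points S. gset_fold X y = z \<and> y \<notin> r ` points X"
      using gset_fold_apply[OF z] by blast+
  qed
  have "tambara_pair G R X x (null X) = tr X S l x"
    using res_tr_disjoint[OF X X S lr(1) d(1) lr(2) d(3) x] tr_closed[OF X S lr(1) x] by (intro pair_eqI)
  then show "x \<otimes>\<^bsub>tambara_ring G R X\<^esub> null X = null X"
    using mor_Comp[OF transfer_in_Hom[OF X S lr(1)] norm_in_Hom[OF S X gset_fold_gmaps[OF X]] X S X x]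
      Comp_norm_transfer_missing_fibres[OF X S X lr(1) gset_fold_gmaps[OF X] miss(1)]
      Comp_transfer_empty_restriction_empty[OF X X] empty_factorisations(2)[OF X X x]
    by (simp add: mult_def)
  have "tambara_pair G R X (null X) x = tr X S r x"
    using res_tr_disjoint[OF X X S lr(2) d(2) lr(1) d(4) x] tr_closed[OF X S lr(2) x] by (intro pair_eqI)
  then show "null X \<otimes>\<^bsub>tambara_ring G R X\<^esub> x = null X"
    using mor_Comp[OF transfer_in_Hom[OF X S lr(2)] norm_in_Hom[OF S X gset_fold_gmaps[OF X]] X S X x]
      Comp_norm_transfer_missing_fibres[OF X S X lr(2) gset_fold_gmaps[OF X] miss(2)]
      Comp_transfer_empty_restriction_empty[OF X X] empty_factorisations(2)[OF X X x]
    by (simp add: mult_def)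
qed

lemma res_mult:
  assumes V: "is_gset G V" and f: "f \<in> gmaps G V X" and x: "x \<in> obj R X" and y: "y \<in> obj R X"
  shows "res V X f (x \<otimes>\<^bsub>tambara_ring G R X\<^esub> y) = res V X f x \<otimes>\<^bsub>tambara_ring G R V\<^esub> res V X f y"
proof -
  let ?SV = "gset_sum G V V"
  note SV = gset_sum[OF V V] and s = sum_map_gmaps[OF V f]
  note lV = gset_inl_gmaps[OF V, where Y = V] and rV = gset_inr_gmaps[OF V, where X = V]
  let ?z = "tambara_pair G R X x y"
  note z = pair[OF x y]
  have eq: "compose (points V) (sum_map V f) (gset_inl V) = compose (points V) l f"
    "compose (points V) (sum_map V f) (gset_inr V) = compose (points V) r f"
    using gmaps_closed[OF f] by (auto simp: compose_def)
  have "res V ?SV (gset_inl V) (res ?SV S (sum_map V f) ?z) = res V X f x"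
    using res_res[OF V SV S lV s z(1)] res_res[OF V X S f lr(1) z(1)] z(2) eq by simp
  moreover have "res V ?SV (gset_inr V) (res ?SV S (sum_map V f) ?z) = res V X f y"
    using res_res[OF V SV S rV s z(1)] res_res[OF V X S f lr(2) z(1)] z(3) eq by simp
  ultimately have p: "tambara_pair G R V (res V X f x) (res V X f y) = res ?SV S (sum_map V f) ?z"
    using V SV S s z(1) by (intro tambara_functor.pair_eqI[OF tambara_functor_axioms V] res_closed)
  have "res V X f (nrm S X (gset_fold X) ?z) = nrm ?SV V (gset_fold V) (res ?SV S (sum_map V f) ?z)"
    using mor_Comp[OF norm_in_Hom[OF S X gset_fold_gmaps[OF X]] restriction_in_Hom[OF V X f] S X V z(1)]
      mor_Comp[OF restriction_in_Hom[OF SV S s] norm_in_Hom[OF SV V gset_fold_gmaps[OF V]] S SV V z(1)]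
      Comp_restriction_norm_fold[OF V X f] by simp
  then show ?thesis using p by (simp add: tambara_ring_def)
qed

end

end

section \<open>Free orbits\<close>

context group
begin

abbreviation enc :: "'a \<Rightarrow> nat" where "enc \<equiv> to_nat_on (carrier G)"

text \<open>
  The map from \<open>G/e\<close> that sends \<open>g\<close> to \<open>g x\<close>.  Right multiplications are the maps of this form
  from \<open>G/e\<close> to itself.
\<close>

definition orbit_map :: "'a gset \<Rightarrow> nat \<Rightarrow> nat \<Rightarrow> nat" where
  "orbit_map X x = (\<lambda>n\<in>points (free_orbit G). act X (from_nat_into (carrier G) n) x)"

definition free_gset :: "'a gset \<Rightarrow> bool" where
  "free_gset X \<longleftrightarrow> (\<forall>x\<in>points X. \<forall>g\<in>carrier G. act X g x = x \<longrightarrow> g = \<one>)"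

context
  assumes fin: "finite (carrier G)"
begin

lemma dec_enc [simp]: "g \<in> carrier G \<Longrightarrow> from_nat_into (carrier G) (enc g) = g"
  using fin by (simp add: countable_finite)

lemma enc_inj: "g \<in> carrier G \<Longrightarrow> h \<in> carrier G \<Longrightarrow> enc g = enc h \<longleftrightarrow> g = h"
  by (metis dec_enc)

lemma points_free_orbit: "points (free_orbit G) = enc ` carrier G"
  by (simp add: free_orbit_def)

lemma act_free_orbit: "g \<in> carrier G \<Longrightarrow> h \<in> carrier G \<Longrightarrow> act (free_orbit G) g (enc h) = enc (g \<otimes> h)"
  by (simp add: free_orbit_def)

lemma free_orbit: "is_gset G (free_orbit G)"
proof (rule is_gsetI)
  show "finite (points (free_orbit G))" using fin by (simp add: points_free_orbit)
qed (auto simp: points_free_orbit act_free_orbit m_assoc, auto simp: free_orbit_def)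

lemma free_orbit_free: "free_gset (free_orbit G)"
  by (auto simp: free_gset_def points_free_orbit act_free_orbit enc_inj)

lemma orbit_map_enc [simp]: "g \<in> carrier G \<Longrightarrow> orbit_map X x (enc g) = act X g x"
  by (simp add: orbit_map_def points_free_orbit)

lemma orbit_map_gmaps:
  assumes X: "is_gset G X" and x: "x \<in> points X"
  shows "orbit_map X x \<in> gmaps G (free_orbit G) X"
  by (rule gmapsI)
     (use x in \<open>auto simp: points_free_orbit act_free_orbit gset_act_closed[OF X] gset_act_mult[OF X]\<close>,
      simp add: orbit_map_def points_free_orbit)

lemma compose_orbit_map:
  assumes X: "is_gset G X" and x: "x \<in> points X" and f: "f \<in> gmaps G X Y" and Y: "is_gset G Y"
  shows "compose (points (free_orbit G)) f (orbit_map X x) = orbit_map Y (f x)"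
  by (rule gmaps_eqI[OF compose_gmaps[OF free_orbit orbit_map_gmaps[OF X x] f]
        orbit_map_gmaps[OF Y gmaps_closed[OF f x]]])
     (auto simp: compose_eq points_free_orbit gmaps_equivariant[OF f _ x])

lemma orbit_map_inj:
  assumes X: "is_gset G X" "free_gset X" and x: "x \<in> points X"
  shows "inj_on (orbit_map X x) (points (free_orbit G))"
proof (rule inj_onI)
  fix m n assume mn: "m \<in> points (free_orbit G)" "n \<in> points (free_orbit G)"
    and eq: "orbit_map X x m = orbit_map X x n"
  obtain g h where g: "g \<in> carrier G" "m = enc g" and h: "h \<in> carrier G" "n = enc h"
    using mn unfolding points_free_orbit by blast
  have "act X g x = act X h x" using eq g h by simp
  then have "act X (inv h \<otimes> g) x = x"
    using g h x gset_act_mult[OF X(1), of "inv h" g x] gset_act_inv(1)[OF X(1), of h x] by simp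
  then have "inv h \<otimes> g = \<one>" using X(2) x g h unfolding free_gset_def by simp
  then have "g = h" using g h by (metis inv_closed inv_equality inv_inv)
  then show "m = n" using g h by simp
qed

lemma orbit_map_image: "orbit_map X x ` points (free_orbit G) = (\<lambda>g. act X g x) ` carrier G"
  by (auto simp: points_free_orbit image_iff)

text \<open>
  The orbit of \<open>x\<close> and the remaining points decompose \<open>X\<close>.  In particular, a free \<open>G\<close>-set is the
  disjoint union of a copy of \<open>G/e\<close>, embedded by an orbit map, and a smaller free
  \<open>G\<close>-set, which makes induction on the number of points possible.
\<close>

lemma orbit_complement:
  assumes X: "is_gset G X" and x: "x \<in> points X"
  defines "Y \<equiv> points X - (\<lambda>g. act X g x) ` carrier G"
  shows "is_gset G (sub_gset X Y)" "gid (sub_gset X Y) \<in> gmaps G (sub_gset X Y) X"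
    "inj_on (gid (sub_gset X Y)) (points (sub_gset X Y))"
    "orbit_map X x ` points (free_orbit G) \<inter> gid (sub_gset X Y) ` points (sub_gset X Y) = {}"
    "orbit_map X x ` points (free_orbit G) \<union> gid (sub_gset X Y) ` points (sub_gset X Y) = points X"
proof -
  have st: "act X g y \<in> Y" if g: "g \<in> carrier G" and y: "y \<in> Y" for g y
  proof -
    have yX: "y \<in> points X" using y by (simp add: Y_def)
    have "act X g y \<noteq> act X h x" if h: "h \<in> carrier G" for h
    proof
      assume eq: "act X g y = act X h x"
      have "y = act X (inv g) (act X g y)" using gset_act_inv(1)[OF X g yX] by simp
      also have "\<dots> = act X (inv g \<otimes> h) x" using eq gset_act_mult[OF X inv_closed[OF g] h x] by simp
      finally show False using y g h unfolding Y_def by blast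
    qed
    then show ?thesis using gset_act_closed[OF X g yX] by (auto simp: Y_def)
  qed
  have img: "gid (sub_gset X Y) ` points (sub_gset X Y) = Y" by (auto simp: gid_apply)
  show "is_gset G (sub_gset X Y)" by (rule sub_gset[OF X _ st]) (simp add: Y_def)
  show "gid (sub_gset X Y) \<in> gmaps G (sub_gset X Y) X"
    by (rule gid_sub_gset_gmaps[OF _ st]) (simp add: Y_def)
  show "inj_on (gid (sub_gset X Y)) (points (sub_gset X Y))" by (auto simp: inj_on_def gid_apply)
  show "orbit_map X x ` points (free_orbit G) \<inter> gid (sub_gset X Y) ` points (sub_gset X Y) = {}"
    "orbit_map X x ` points (free_orbit G) \<union> gid (sub_gset X Y) ` points (sub_gset X Y) = points X"
    unfolding img orbit_map_image using gset_act_closed[OF X _ x] by (auto simp: Y_def)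
qed

lemma free_orbit_rmult_eq:
  assumes "g \<in> carrier G"
  shows "free_orbit_rmult G g = orbit_map (free_orbit G) (enc g)"
proof (rule extensionalityI[where A = "points (free_orbit G)"])
  fix n assume "n \<in> points (free_orbit G)"
  then obtain h where "h \<in> carrier G" "n = enc h" unfolding points_free_orbit by blast
  then show "free_orbit_rmult G g n = orbit_map (free_orbit G) (enc g) n"
    using assms by (simp add: free_orbit_rmult_def act_free_orbit)
qed (simp_all add: free_orbit_rmult_def orbit_map_def points_free_orbit)

end

end

locale finite_tambara_functor = tambara_functor +
  assumes fin: "finite (carrier G)"
begin

abbreviation F where "F \<equiv> free_orbit G"
abbreviation at_point where "at_point X x \<equiv> res F X (orbit_map X x)"

lemmas F = free_orbit[OF fin]

lemma at_point_closed: "is_gset G X \<Longrightarrow> x \<in> points X \<Longrightarrow> z \<in> obj R X \<Longrightarrow> at_point X x z \<in> obj R F"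
  using res_closed[OF F _ orbit_map_gmaps[OF fin]] by blast

lemma at_point_res:
  assumes X: "is_gset G X" and Y: "is_gset G Y" and f: "f \<in> gmaps G X Y"
    and x: "x \<in> points X" and z: "z \<in> obj R Y"
  shows "at_point X x (res X Y f z) = at_point Y (f x) z"
  using res_res[OF F X Y orbit_map_gmaps[OF fin X x] f z] compose_orbit_map[OF fin X x f Y] by simp

text \<open>
  For free \<open>X\<close>, the ring \<open>R(X)\<close> is a product of copies of \<open>R(G/e)\<close>, one for every orbit; the
  induction splits off one orbit at a time.
\<close>

lemma at_point_eqI:
  assumes "is_gset G X" "free_gset X" "z \<in> obj R X" "z' \<in> obj R X"
    and "\<And>x. x \<in> points X \<Longrightarrow> at_point X x z = at_point X x z'"
  shows "z = z'"
  using assms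
proof (induction "card (points X)" arbitrary: X z z' rule: less_induct)
  case less
  note X = less.prems(1) and free = less.prems(2) and z = less.prems(3,4) and eq = less.prems(5)
  show ?case
  proof (cases "points X = {}")
    case True
    then have "X = gset_empty G" using gset_with_no_points X by blast
    then show ?thesis using z obj_empty by auto
  next
    case False
    then obtain x where x: "x \<in> points X" by blast
    define Y where "Y = points X - (\<lambda>g. act X g x) ` carrier G"
    let ?Y = "sub_gset X Y" and ?j = "gid (sub_gset X Y)"
    note c = orbit_complement[OF fin X x, folded Y_def]
    have Yx: "act X \<one> x \<notin> Y" using Y_def by blast
    have "Y \<subset> points X" using Yx x gset_act_one[OF X x] by (auto simp: Y_def)
    then have "card (points ?Y) < card (points X)"
      using psubset_card_mono[OF gset_finite[OF X]] by simp
    moreover have "free_gset ?Y"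
      using free \<open>Y \<subset> points X\<close> unfolding free_gset_def by (auto simp: subset_iff)
    moreover have "res ?Y X ?j z \<in> obj R ?Y" "res ?Y X ?j z' \<in> obj R ?Y"
      using res_closed[OF c(1) X c(2)] z by simp_all
    moreover have "at_point ?Y y (res ?Y X ?j z) = at_point ?Y y (res ?Y X ?j z')"
      if y: "y \<in> points ?Y" for y
    proof -
      have "?j y \<in> points X" using gmaps_closed[OF c(2) y] .
      then show ?thesis
        using at_point_res[OF c(1) X c(2) y] z eq by simp
    qed
    ultimately have "res ?Y X ?j z = res ?Y X ?j z'"
      using less.hyps[of ?Y "res ?Y X ?j z" "res ?Y X ?j z'"] c(1) by blast
    then show ?thesis
      using decomposition_eqI[OF F c(1) X orbit_map_gmaps[OF fin X x] orbit_map_inj[OF fin X free x]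
          c(2,4,3,5) z] eq[OF x] by blast
  qed
qed

text \<open>
  The element that is \<open>1\<close> on the orbit of \<open>x\<close> and \<open>0\<close> on its complement.
\<close>

lemma orbit_indicator_ex:
  assumes X: "is_gset G X" and free: "free_gset X" and x: "x \<in> points X"
  shows "\<exists>z\<in>obj R X. \<forall>y\<in>points X. at_point X y z =
    (if y \<in> (\<lambda>g. act X g x) ` carrier G then unit F else null F)"
proof -
  define Y where "Y = points X - (\<lambda>g. act X g x) ` carrier G"
  let ?Y = "sub_gset X Y" and ?j = "gid (sub_gset X Y)"
  note c = orbit_complement[OF fin X x, folded Y_def]
  obtain z where z: "z \<in> obj R X" "at_point X x z = unit F" "res ?Y X ?j z = null ?Y"
    using decomposition_ex[OF F c(1) X orbit_map_gmaps[OF fin X x] orbit_map_inj[OF fin X free x]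
        c(2,4,3,5) unit_closed[OF F] null_closed[OF c(1)]] by blast
  show ?thesis
  proof (intro bexI[OF _ z(1)] ballI)
    fix y assume y: "y \<in> points X"
    show "at_point X y z = (if y \<in> (\<lambda>g. act X g x) ` carrier G then unit F else null F)"
    proof (cases "y \<in> (\<lambda>g. act X g x) ` carrier G")
      case True
      then obtain g where g: "g \<in> carrier G" "y = act X g x" by blast
      have eg: "enc g \<in> points F" using g by (simp add: points_free_orbit[OF fin])
      have "at_point F (enc g) (at_point X x z) = at_point X y z"
        using at_point_res[OF F X orbit_map_gmaps[OF fin X x] eg z(1)] g by (simp add: fin)
      moreover have "at_point F (enc g) (unit F) = unit F"
        using res_unit[OF F F orbit_map_gmaps[OF fin F eg]] .
      ultimately show ?thesis using True z(2) by simp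
    next
      case False
      then have yY: "y \<in> points ?Y" using y by (simp add: Y_def)
      have "at_point X y z = at_point ?Y y (null ?Y)"
        using at_point_res[OF c(1) X c(2) yY z(1)] z(3) yY by (simp add: gid_apply)
      also have "\<dots> = null F"
        using res_null[OF F c(1) orbit_map_gmaps[OF fin c(1) yY]] .
      finally show ?thesis using False by simp
    qed
  qed
qed

lemma bottom_act_at_point:
  assumes X: "is_gset G X" and x: "x \<in> points X" and z: "z \<in> obj R X" and g: "g \<in> carrier G"
  shows "bottom_act G R g (at_point X x z) = at_point X (act X g x) z"
proof -
  have eg: "enc g \<in> points F" using g by (simp add: points_free_orbit[OF fin])
  show ?thesis
    using at_point_res[OF F X orbit_map_gmaps[OF fin X x] eg z] g
    by (simp add: bottom_act_def free_orbit_rmult_eq fin)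
qed

text \<open>
  If \<open>d \<noteq> 0\<close>, an element \<open>g\<close> outside \<open>K\<close> cannot fix \<open>d\<close>, since then \<open>d = d \<cdot> d = d \<cdot> gd = 0\<close>.  So the
  isotropy group is \<open>K\<close> and \<open>d\<close> is of type \<open>K\<close>.
\<close>

lemma clarified_imp_null:
  assumes "clarified G R" and K: "subgroup K G" "K \<noteq> carrier G" and d: "d \<in> obj R F"
    and idem: "d \<otimes>\<^bsub>tambara_ring G R F\<^esub> d = d"
    and fixed: "\<And>g. g \<in> K \<Longrightarrow> bottom_act G R g d = d"
    and orth: "\<And>g. g \<in> carrier G \<Longrightarrow> g \<notin> K \<Longrightarrow> d \<otimes>\<^bsub>tambara_ring G R F\<^esub> bottom_act G R g d = null F"
  shows "d = null F"
proof (rule ccontr)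
  assume nz: "d \<noteq> null F"
  have "bottom_act G R g d \<noteq> d" if "g \<in> carrier G" "g \<notin> K" for g
    using orth[OF that] idem nz by auto
  then have "stabilizer G (bottom_act G R) d = K"
    using fixed subgroup.subset[OF K(1)] by (auto simp: stabilizer_def)
  then have "idempotent_of_type G (tambara_ring G R F) (bottom_act G R) K d"
    using d idem orth by (simp add: idempotent_of_type_def tambara_ring_def)
  then show False using assms(1) K unfolding clarified_def clarified_gring_def by blast
qed

end

section \<open>Products of coinduced Tambara functors\<close>

lemma points_res_gset [simp]: "points (res_gset H X) = points X"
  and act_res_gset [simp]: "h \<in> H \<Longrightarrow> act (res_gset H X) h = act X h"
  by (simp_all add: res_gset_def)

lemma gid_res_gset [simp]: "gid (res_gset H X) = gid X"
  and gset_inl_res_gset [simp]: "gset_inl (res_gset H X) = gset_inl X"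
  and gset_inr_res_gset [simp]: "gset_inr (res_gset H X) = gset_inr X"
  and gset_fold_res_gset [simp]: "gset_fold (res_gset H X) = gset_fold X"
  by (simp_all add: gid_def gset_inl_def gset_inr_def gset_fold_def)

context group
begin

context
  fixes H
  assumes H: "subgroup H G"
begin

interpretation sub: group "G\<lparr>carrier := H\<rparr>"
  using H by (rule subgroup.subgroup_is_group) (rule is_group)

lemma res_gset:
  assumes X: "is_gset G X"
  shows "is_gset (G\<lparr>carrier := H\<rparr>) (res_gset H X)"
proof -
  have HG: "h \<in> carrier G" if "h \<in> H" for h using H that by (rule subgroup.mem_carrier)
  have "act X h \<in> extensional (points X)" if "h \<in> H" for h
    using X HG[OF that] unfolding is_gset_iff PiE_def by blast
  then show ?thesis
    using gset_finite[OF X] gset_act_closed[OF X] gset_act_mult[OF X] gset_act_one[OF X] HG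
      subgroup.m_closed[OF H] subgroup.one_closed[OF H]
    by (intro sub.is_gsetI) (simp_all, simp add: res_gset_def)
qed

lemma gmaps_res: "f \<in> gmaps G X Y \<Longrightarrow> f \<in> gmaps (G\<lparr>carrier := H\<rparr>) (res_gset H X) (res_gset H Y)"
  using subgroup.mem_carrier[OF H] by (auto simp: gmaps_def)

lemma res_bispan: "is_bispan G D \<Longrightarrow> is_bispan (G\<lparr>carrier := H\<rparr>) (res_bispan H D)"
  by (simp add: is_bispan_def res_bispan_def res_gset gmaps_res)

lemma res_bispan_iso:
  assumes "(D, D') \<in> bispan_iso G"
  shows "(res_bispan H D, res_bispan H D') \<in> bispan_iso (G\<lparr>carrier := H\<rparr>)"
proof -
  obtain a b where D: "is_bispan G D" "is_bispan G D'" and h: "bispan_hom G D D' a b"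
    and bij: "bij_betw a (tops D) (tops D')"
      "bij_betw b (mids D) (mids D')"
    using assms unfolding bispan_iso_iff by blast
  have "bispan_hom (G\<lparr>carrier := H\<rparr>) (res_bispan H D) (res_bispan H D') a b"
    using h unfolding bispan_hom_def by (simp add: res_bispan_def gmaps_res)
  then show ?thesis
    unfolding bispan_iso_iff using res_bispan D bij by (auto simp: res_bispan_def)
qed

text \<open>
  With this, restrictions, norms, transfers and hence all ring operations of a coinduced functor are those
  of the original functor at the restricted sets.
\<close>

lemma res_class_bispan_class:
  assumes D: "is_bispan G D"
  shows "res_class G H (bispan_class G D) = bispan_class (G\<lparr>carrier := H\<rparr>) (res_bispan H D)"
proof (intro equalityI subsetI)
  fix E assume "E \<in> res_class G H (bispan_class G D)"
  then obtain D' where "(D, D') \<in> bispan_iso G" "(res_bispan H D', E) \<in> bispan_iso (G\<lparr>carrier := H\<rparr>)"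
    by (auto simp: res_class_def bispan_class_def)
  then show "E \<in> bispan_class (G\<lparr>carrier := H\<rparr>) (res_bispan H D)"
    using res_bispan_iso sub.bispan_iso_trans unfolding bispan_class_def by blast
next
  fix E assume "E \<in> bispan_class (G\<lparr>carrier := H\<rparr>) (res_bispan H D)"
  then show "E \<in> res_class G H (bispan_class G D)"
    using bispan_class_self[OF D] unfolding res_class_def bispan_class_def by blast
qed

lemma res_gset_empty [simp]: "res_gset H (gset_empty G) = gset_empty (G\<lparr>carrier := H\<rparr>)"
  using sub.gset_with_no_points[OF res_gset[OF gset_empty]] by simp

lemma res_gset_sum:
  "res_gset H (gset_sum G X Y) = gset_sum (G\<lparr>carrier := H\<rparr>) (res_gset H X) (res_gset H Y)"
  using subgroup.mem_carrier[OF H]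
  by (auto simp: res_gset_def gset_sum_def fun_eq_iff map_sum_def split: sum.split)

lemma res_class_restriction:
  assumes "is_gset G X" "is_gset G Y" "f \<in> gmaps G X Y"
  shows "res_class G H (restriction G X Y f) =
    restriction (G\<lparr>carrier := H\<rparr>) (res_gset H X) (res_gset H Y) f"
  using res_class_bispan_class[OF is_bispan_restriction[OF assms]]
  by (simp add: restriction_def res_bispan_def)

lemma res_class_norm:
  assumes "is_gset G X" "is_gset G Y" "f \<in> gmaps G X Y"
  shows "res_class G H (norm_map G X Y f) =
    norm_map (G\<lparr>carrier := H\<rparr>) (res_gset H X) (res_gset H Y) f"
  using res_class_bispan_class[OF is_bispan_norm[OF assms]]
  by (simp add: norm_map_def res_bispan_def)

lemma res_class_transfer:
  assumes "is_gset G X" "is_gset G Y" "f \<in> gmaps G X Y"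
  shows "res_class G H (transfer_map G X Y f) =
    transfer_map (G\<lparr>carrier := H\<rparr>) (res_gset H X) (res_gset H Y) f"
  using res_class_bispan_class[OF is_bispan_transfer[OF assms]]
  by (simp add: transfer_map_def res_bispan_def)

lemma res_class_in_Hom:
  assumes "c \<in> Hom (bispan_cat G) X Y"
  shows "res_class G H c \<in> Hom (bispan_cat (G\<lparr>carrier := H\<rparr>)) (res_gset H X) (res_gset H Y)"
proof -
  obtain D where D: "is_bispan G D" "src D = X" "tgt D = Y" "c = bispan_class G D"
    using assms unfolding Hom_bispan_cat by blast
  then show ?thesis
    unfolding sub.Hom_bispan_cat
    by (intro exI[of _ "res_bispan H D"]) (simp add: res_class_bispan_class res_bispan, simp add: res_bispan_def)
qed

end

end

locale coinduced_product = group G for G :: "('g, 'b) monoid_scheme" (structure) +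
  fixes \<S> :: "'g set set" and T :: "'g set \<Rightarrow> ('g, 'r) tambara"
  assumes fin: "finite (carrier G)"
    and subgrp: "H \<in> \<S> \<Longrightarrow> subgroup H G"
    and tam: "H \<in> \<S> \<Longrightarrow> is_tambara (G\<lparr>carrier := H\<rparr>) (T H)"
begin

abbreviation R where "R \<equiv> tambara_prod \<S> (\<lambda>H. coind G H (T H))"
abbreviation grp where "grp H \<equiv> G\<lparr>carrier := H\<rparr>"
abbreviation F where "F \<equiv> free_orbit G"
abbreviation ring where "ring H X \<equiv> tambara_ring (grp H) (T H) (res_gset H X)"

lemmas F = free_orbit[OF fin]

lemma factor: "H \<in> \<S> \<Longrightarrow> finite_tambara_functor (grp H) (T H)"
proof -
  assume H: "H \<in> \<S>"
  have "group (grp H)" using subgroup.subgroup_is_group[OF subgrp[OF H]] is_group .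
  moreover have "finite H" using subgroup.subset[OF subgrp[OF H]] fin finite_subset by blast
  ultimately show ?thesis using tam[OF H]
    by (simp add: finite_tambara_functor_def finite_tambara_functor_axioms_def
        tambara_functor_def tambara_functor_axioms_def)
qed

lemma factor': "H \<in> \<S> \<Longrightarrow> tambara_functor (grp H) (T H)"
  using factor finite_tambara_functor.axioms(1) by blast

lemma obj_R: "obj R X = (\<Pi>\<^sub>E H\<in>\<S>. obj (T H) (res_gset H X))"
  by (simp add: tambara_prod_def coind_def)

lemma obj_R_component: "r \<in> obj R X \<Longrightarrow> H \<in> \<S> \<Longrightarrow> r H \<in> obj (T H) (res_gset H X)"
  by (auto simp: obj_R)

lemma obj_R_eqI:
  "r \<in> obj R X \<Longrightarrow> r' \<in> obj R X \<Longrightarrow> (\<And>H. H \<in> \<S> \<Longrightarrow> r H = r' H) \<Longrightarrow> r = r'"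
  unfolding obj_R by (rule PiE_ext)

lemma mor_R: "H \<in> \<S> \<Longrightarrow> mor R c r H = mor (T H) (res_class G H c) (r H)"
  by (simp add: tambara_prod_def coind_def)

lemma mor_R_closed:
  assumes "c \<in> Hom (bispan_cat G) X Y" "is_gset G X" "is_gset G Y" "r \<in> obj R X"
  shows "mor R c r \<in> obj R Y"
proof -
  have "mor (T H) (res_class G H c) (r H) \<in> obj (T H) (res_gset H Y)" if H: "H \<in> \<S>" for H
    using tambara_functor.mor_closed[OF factor'[OF H] res_class_in_Hom[OF subgrp[OF H] assms(1)]]
      res_gset[OF subgrp[OF H]] assms obj_R_component[OF _ H] by blast
  then show ?thesis by (auto simp: obj_R tambara_prod_def coind_def)
qed

lemmas res_R_closed = mor_R_closed[OF restriction_in_Hom]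
lemmas nrm_R_closed = mor_R_closed[OF norm_in_Hom]
lemmas tr_R_closed = mor_R_closed[OF transfer_in_Hom]

lemma
  assumes "is_gset G X" "is_gset G Y" "f \<in> gmaps G X Y" and H: "H \<in> \<S>"
  shows res_R: "mor R (restriction G X Y f) r H =
      mor (T H) (restriction (grp H) (res_gset H X) (res_gset H Y) f) (r H)"
    and nrm_R: "mor R (norm_map G X Y f) r H =
      mor (T H) (norm_map (grp H) (res_gset H X) (res_gset H Y) f) (r H)"
    and tr_R: "mor R (transfer_map G X Y f) r H =
      mor (T H) (transfer_map (grp H) (res_gset H X) (res_gset H Y) f) (r H)"
  using res_class_restriction[OF subgrp[OF H] assms(1-3)] res_class_norm[OF subgrp[OF H] assms(1-3)]
    res_class_transfer[OF subgrp[OF H] assms(1-3)]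
  by (simp_all add: mor_R H)

text \<open>
  The ring structure of \<open>R(X)\<close> is defined factor by factor; \<open>mult_eq\<close>, \<open>add_eq\<close>, \<open>unit_eq\<close> and \<open>null_eq\<close>
  identify it with the one obtained from norms and transfers, on which naturality bears.
\<close>

definition mult where "mult X x y = (\<lambda>H\<in>\<S>. x H \<otimes>\<^bsub>ring H X\<^esub> y H)"
definition add where "add X x y = (\<lambda>H\<in>\<S>. x H \<oplus>\<^bsub>ring H X\<^esub> y H)"
definition unit where "unit X = (\<lambda>H\<in>\<S>. \<one>\<^bsub>ring H X\<^esub>)"
definition null where "null X = (\<lambda>H\<in>\<S>. \<zero>\<^bsub>ring H X\<^esub>)"

definition pt where "pt = (\<lambda>H\<in>\<S>. tambara_pt (grp H) (T H))"

lemma obj_R_empty: "obj R (gset_empty G) = {pt}"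
proof -
  have "obj R (gset_empty G) = (\<Pi>\<^sub>E H\<in>\<S>. {tambara_pt (grp H) (T H)})"
    unfolding obj_R
    by (rule PiE_cong) (simp add: res_gset_empty[OF subgrp] tambara_functor.obj_empty[OF factor'])
  also have "\<dots> = {pt}"
    by (auto simp: pt_def PiE_iff fun_eq_iff extensional_def)
  finally show ?thesis .
qed

context
  fixes X
  assumes X: "is_gset G X"
begin

lemma X_res: "H \<in> \<S> \<Longrightarrow> is_gset (grp H) (res_gset H X)"
  using res_gset[OF subgrp X] .

lemma mult_in: "x \<in> obj R X \<Longrightarrow> y \<in> obj R X \<Longrightarrow> mult X x y \<in> obj R X"
  using tambara_functor.mult_closed[OF factor' X_res] obj_R_component
  by (auto simp: mult_def obj_R intro!: restrict_PiE_iff[THEN iffD2])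

lemma add_in: "x \<in> obj R X \<Longrightarrow> y \<in> obj R X \<Longrightarrow> add X x y \<in> obj R X"
  using tambara_functor.add_closed[OF factor' X_res] obj_R_component
  by (auto simp: add_def obj_R intro!: restrict_PiE_iff[THEN iffD2])

lemma unit_in: "unit X \<in> obj R X" and null_in: "null X \<in> obj R X"
  using tambara_functor.unit_closed[OF factor' X_res] tambara_functor.null_closed[OF factor' X_res]
  by (auto simp: unit_def null_def obj_R)

definition pair where "pair x y = (\<lambda>H\<in>\<S>. tambara_pair (grp H) (T H) (res_gset H X) (x H) (y H))"

lemma pair_in:
  assumes "x \<in> obj R X" "y \<in> obj R X"
  shows "pair x y \<in> obj R (gset_sum G X X)"
proof -
  have "tambara_pair (grp H) (T H) (res_gset H X) (x H) (y H) \<in> obj (T H) (res_gset H (gset_sum G X X))"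
    if H: "H \<in> \<S>" for H
    using tambara_functor.pair(1)[OF factor'[OF H] X_res[OF H]] assms obj_R_component[OF _ H]
    by (simp add: res_gset_sum[OF subgrp[OF H]])
  then show ?thesis by (auto simp: pair_def obj_R)
qed

lemma pair_restrict:
  assumes xy: "x \<in> obj R X" "y \<in> obj R X"
  shows "mor R (restriction G X (gset_sum G X X) (gset_inl X)) (pair x y) = x"
    "mor R (restriction G X (gset_sum G X X) (gset_inr X)) (pair x y) = y"
proof -
  note S = gset_sum[OF X X] and lr = gset_inl_gmaps[OF X, where Y = X] gset_inr_gmaps[OF X, where X = X]
  note p = pair_in[OF xy]
  show "mor R (restriction G X (gset_sum G X X) (gset_inl X)) (pair x y) = x"
  proof (rule obj_R_eqI[OF res_R_closed[OF X S lr(1) S X p] xy(1)])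
    fix H assume H: "H \<in> \<S>"
    show "mor R (restriction G X (gset_sum G X X) (gset_inl X)) (pair x y) H = x H"
      using tambara_functor.pair(2)[OF factor'[OF H] X_res[OF H] obj_R_component[OF xy(1) H] obj_R_component[OF xy(2) H]] H
      by (simp add: res_R[OF X S lr(1) H] res_gset_sum[OF subgrp[OF H]] pair_def)
  qed
  show "mor R (restriction G X (gset_sum G X X) (gset_inr X)) (pair x y) = y"
  proof (rule obj_R_eqI[OF res_R_closed[OF X S lr(2) S X p] xy(2)])
    fix H assume H: "H \<in> \<S>"
    show "mor R (restriction G X (gset_sum G X X) (gset_inr X)) (pair x y) H = y H"
      using tambara_functor.pair(3)[OF factor'[OF H] X_res[OF H] obj_R_component[OF xy(1) H] obj_R_component[OF xy(2) H]] H
      by (simp add: res_R[OF X S lr(2) H] res_gset_sum[OF subgrp[OF H]] pair_def)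
  qed
qed

lemma pair_unique:
  assumes z: "z \<in> obj R (gset_sum G X X)"
    and l: "mor R (restriction G X (gset_sum G X X) (gset_inl X)) z = x"
    and r: "mor R (restriction G X (gset_sum G X X) (gset_inr X)) z = y"
  shows "pair x y = z"
proof -
  note S = gset_sum[OF X X] and lr = gset_inl_gmaps[OF X, where Y = X] gset_inr_gmaps[OF X, where X = X]
  have xy: "x \<in> obj R X" "y \<in> obj R X"
    using res_R_closed[OF X S lr(1) S X z] res_R_closed[OF X S lr(2) S X z] l r by simp_all
  show ?thesis
  proof (rule obj_R_eqI[OF pair_in[OF xy] z])
    fix H assume H: "H \<in> \<S>"
    show "pair x y H = z H"
      using tambara_functor.pair_eqI[OF factor'[OF H] X_res[OF H], of "z H" "x H" "y H"]
        obj_R_component[OF z H] H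
        res_R[OF X S lr(1) H, of z] res_R[OF X S lr(2) H, of z]
      by (simp add: l r res_gset_sum[OF subgrp[OF H]] pair_def)
  qed
qed

lemma mult_eq: "x \<in> obj R X \<Longrightarrow> y \<in> obj R X \<Longrightarrow>
    mult X x y = mor R (norm_map G (gset_sum G X X) X (gset_fold X)) (pair x y)"
proof (rule obj_R_eqI[OF mult_in nrm_R_closed])
  show "mult X x y H = mor R (norm_map G (gset_sum G X X) X (gset_fold X)) (pair x y) H" if H: "H \<in> \<S>" for H
    using H by (simp add: nrm_R[OF gset_sum[OF X X] X gset_fold_gmaps[OF X] H] mult_def pair_def
        res_gset_sum[OF subgrp[OF H]] tambara_ring_def)
qed (use X pair_in gset_sum[OF X X] gset_fold_gmaps[OF X] in auto)

lemma add_eq: "x \<in> obj R X \<Longrightarrow> y \<in> obj R X \<Longrightarrow>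
    add X x y = mor R (transfer_map G (gset_sum G X X) X (gset_fold X)) (pair x y)"
proof (rule obj_R_eqI[OF add_in tr_R_closed])
  show "add X x y H = mor R (transfer_map G (gset_sum G X X) X (gset_fold X)) (pair x y) H" if H: "H \<in> \<S>" for H
    using H by (simp add: tr_R[OF gset_sum[OF X X] X gset_fold_gmaps[OF X] H] add_def pair_def
        res_gset_sum[OF subgrp[OF H]] tambara_ring_def)
qed (use X pair_in gset_sum[OF X X] gset_fold_gmaps[OF X] in auto)

lemma unit_eq: "unit X = mor R (norm_map G (gset_empty G) X empty_map) pt"
proof (rule obj_R_eqI[OF unit_in nrm_R_closed])
  show "unit X H = mor R (norm_map G (gset_empty G) X empty_map) pt H" if H: "H \<in> \<S>" for H
    using H by (simp add: nrm_R[OF gset_empty X gid_gset_empty_gmaps H] unit_def pt_def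
        tambara_ring_def flip: res_gset_empty[OF subgrp[OF H]])
qed (use X gset_empty gid_gset_empty_gmaps obj_R_empty in auto)

lemma null_eq: "null X = mor R (transfer_map G (gset_empty G) X empty_map) pt"
proof (rule obj_R_eqI[OF null_in tr_R_closed])
  show "null X H = mor R (transfer_map G (gset_empty G) X empty_map) pt H" if H: "H \<in> \<S>" for H
    using H by (simp add: tr_R[OF gset_empty X gid_gset_empty_gmaps H] null_def pt_def
        tambara_ring_def flip: res_gset_empty[OF subgrp[OF H]])
qed (use X gset_empty gid_gset_empty_gmaps obj_R_empty in auto)

end

end

section \<open>Values on points of the free orbit\<close>

context coinduced_product
begin

abbreviation bot where "bot H \<equiv> tambara_ring (grp H) (T H) (free_orbit (grp H))"

text \<open>
  The value of \<open>r\<close> at the coset \<open>La\<close>: the restriction of its component at \<open>L\<close> along \<open>l \<mapsto> la\<close>.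
\<close>

definition val where
  "val L a r = mor (T L) (restriction (grp L) (free_orbit (grp L)) (res_gset L F)
     (group.orbit_map (grp L) (res_gset L F) (enc a))) (r L)"

text \<open>
  The action of \<open>g\<close> on \<open>R(G/e)\<close>, which comes from right multiplication by \<open>g\<close>.
\<close>

abbreviation rmul where "rmul g \<equiv> mor R (restriction G F F (orbit_map F (enc g)))"

lemma enc_in: "a \<in> carrier G \<Longrightarrow> enc a \<in> points F"
  by (simp add: points_free_orbit[OF fin])

lemma rmul_gmaps: "g \<in> carrier G \<Longrightarrow> orbit_map F (enc g) \<in> gmaps G F F"
  by (rule orbit_map_gmaps[OF fin F enc_in])

lemma rmul_closed: "g \<in> carrier G \<Longrightarrow> r \<in> obj R F \<Longrightarrow> rmul g r \<in> obj R F"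
  using res_R_closed[OF F F rmul_gmaps F F] .

context
  fixes L
  assumes L: "L \<in> \<S>"
begin

interpretation L: finite_tambara_functor "grp L" "T L"
  by (rule factor[OF L])

lemma res_F: "is_gset (grp L) (res_gset L F)"
  by (rule res_gset[OF subgrp[OF L] F])

lemma in_G: "l \<in> L \<Longrightarrow> l \<in> carrier G"
  using subgroup.mem_carrier[OF subgrp[OF L]] .

lemma val_closed: "a \<in> carrier G \<Longrightarrow> r \<in> obj R F \<Longrightarrow> val L a r \<in> obj (T L) (free_orbit (grp L))"
  unfolding val_def using L.at_point_closed[OF res_F] enc_in obj_R_component[OF _ L] by simp

lemma val_eqI:
  assumes r: "r \<in> obj R F" "r' \<in> obj R F"
    and eq: "\<And>a. a \<in> carrier G \<Longrightarrow> val L a r = val L a r'"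
  shows "r L = r' L"
proof (rule L.at_point_eqI[OF res_F _ obj_R_component[OF r(1) L] obj_R_component[OF r(2) L]])
  show "L.free_gset (res_gset L F)"
    using free_orbit_free[OF fin] in_G unfolding L.free_gset_def free_gset_def by simp
  fix x assume "x \<in> points (res_gset L F)"
  then obtain a where "a \<in> carrier G" "x = enc a" by (auto simp: points_free_orbit[OF fin])
  then show "mor (T L) (restriction (grp L) L.F (res_gset L F) (L.orbit_map (res_gset L F) x)) (r L) =
      mor (T L) (restriction (grp L) L.F (res_gset L F) (L.orbit_map (res_gset L F) x)) (r' L)"
    using eq by (simp add: val_def)
qed

lemma val_mult:
  assumes "a \<in> carrier G" "r \<in> obj R F" "s \<in> obj R F"
  shows "val L a (mult F r s) = val L a r \<otimes>\<^bsub>bot L\<^esub> val L a s"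
  unfolding val_def mult_def
  using L.res_mult[OF res_F L.F L.orbit_map_gmaps[OF L.fin res_F]
      obj_R_component[OF assms(2) L] obj_R_component[OF assms(3) L]] enc_in[OF assms(1)] L
  by simp

lemma val_null: "a \<in> carrier G \<Longrightarrow> val L a (null F) = \<zero>\<^bsub>bot L\<^esub>"
  unfolding val_def null_def
  using L.res_null[OF L.F res_F L.orbit_map_gmaps[OF L.fin res_F]] enc_in L by simp_all

lemma val_rmul:
  assumes a: "a \<in> carrier G" and g: "g \<in> carrier G" and r: "r \<in> obj R F"
  shows "val L a (rmul g r) = val L (a \<otimes> g) r"
  unfolding val_def res_R[OF F F rmul_gmaps[OF g] L]
  using L.at_point_res[OF res_F res_F gmaps_res[OF subgrp[OF L] rmul_gmaps[OF g]] _ obj_R_component[OF r L]]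
    enc_in[OF a] a g by (simp add: fin act_free_orbit)

text \<open>
  Translating a value by \<open>l \<in> L\<close> only changes the chosen representative of the coset.
\<close>

lemma val_act:
  assumes l: "l \<in> L" and a: "a \<in> carrier G" and r: "r \<in> obj R F"
  shows "bottom_act (grp L) (T L) l (val L a r) = val L (l \<otimes> a) r"
  unfolding val_def
  using L.bottom_act_at_point[OF res_F _ obj_R_component[OF r L]] enc_in[OF a] l a in_G[OF l]
  by (simp add: fin act_free_orbit)

lemma indicator_ex:
  "\<exists>d\<in>obj R F. \<forall>K\<in>\<S>. \<forall>a\<in>carrier G. val K a d = (if K = L \<and> a \<in> L then \<one>\<^bsub>bot K\<^esub> else \<zero>\<^bsub>bot K\<^esub>)"
proof -
  have free: "L.free_gset (res_gset L F)"
    using free_orbit_free[OF fin] in_G unfolding L.free_gset_def free_gset_def by simp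
  obtain z where z: "z \<in> obj (T L) (res_gset L F)"
    and zv: "\<And>y. y \<in> points F \<Longrightarrow>
       mor (T L) (restriction (grp L) L.F (res_gset L F) (L.orbit_map (res_gset L F) y)) z =
       (if y \<in> (\<lambda>g. act (res_gset L F) g (enc \<one>)) ` L then \<one>\<^bsub>bot L\<^esub> else \<zero>\<^bsub>bot L\<^esub>)"
    using L.orbit_indicator_ex[OF res_F free, of "enc \<one>"] enc_in[OF one_closed] by auto
  have orb: "enc a \<in> (\<lambda>g. act (res_gset L F) g (enc \<one>)) ` L \<longleftrightarrow> a \<in> L" if a: "a \<in> carrier G" for a
  proof -
    have "(\<lambda>g. act (res_gset L F) g (enc \<one>)) ` L = enc ` L"
      using in_G by (intro image_cong) (simp_all add: act_free_orbit fin)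
    then show ?thesis using a in_G by (auto simp: image_iff enc_inj[OF fin])
  qed
  define d where "d = (null F)(L := z)"
  have d: "d \<in> obj R F"
    using null_in[OF F] z L by (auto simp: d_def obj_R PiE_iff extensional_def)
  moreover have "val K a d = (if K = L \<and> a \<in> L then \<one>\<^bsub>bot K\<^esub> else \<zero>\<^bsub>bot K\<^esub>)"
    if K: "K \<in> \<S>" and a: "a \<in> carrier G" for K a
  proof (cases "K = L")
    case True
    then show ?thesis using zv[OF enc_in[OF a]] orb[OF a] by (simp add: val_def d_def)
  next
    case False
    have "val K a d = mor (T K) (restriction (grp K) (free_orbit (grp K)) (res_gset K F)
        (group.orbit_map (grp K) (res_gset K F) (enc a))) (null F K)"
      using False by (simp add: val_def d_def)
    also have "\<dots> = \<zero>\<^bsub>bot K\<^esub>"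
    proof -
      interpret K: finite_tambara_functor "grp K" "T K" by (rule factor[OF K])
      note F' = res_gset[OF subgrp[OF K] F]
      show ?thesis
        using K.res_null[OF K.F F' K.orbit_map_gmaps[OF K.fin F']] enc_in[OF a] K
        by (simp add: null_def)
    qed
    finally show ?thesis using False by simp
  qed
  ultimately show ?thesis by blast
qed

end

lemma obj_F_eqI:
  assumes "r \<in> obj R F" "r' \<in> obj R F"
    and "\<And>L a. L \<in> \<S> \<Longrightarrow> a \<in> carrier G \<Longrightarrow> val L a r = val L a r'"
  shows "r = r'"
  using assms val_eqI by (intro obj_R_eqI[OF assms(1,2)]) blast

definition indicator where
  "indicator H = (SOME d. d \<in> obj R F \<and>
     (\<forall>K\<in>\<S>. \<forall>a\<in>carrier G. val K a d = (if K = H \<and> a \<in> H then \<one>\<^bsub>bot K\<^esub> else \<zero>\<^bsub>bot K\<^esub>)))"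

lemma indicator:
  assumes "H \<in> \<S>"
  shows "indicator H \<in> obj R F"
    "K \<in> \<S> \<Longrightarrow> a \<in> carrier G \<Longrightarrow>
      val K a (indicator H) = (if K = H \<and> a \<in> H then \<one>\<^bsub>bot K\<^esub> else \<zero>\<^bsub>bot K\<^esub>)"
proof -
  have "\<exists>d. d \<in> obj R F \<and>
     (\<forall>K\<in>\<S>. \<forall>a\<in>carrier G. val K a d = (if K = H \<and> a \<in> H then \<one>\<^bsub>bot K\<^esub> else \<zero>\<^bsub>bot K\<^esub>))"
    using indicator_ex[OF assms] by blast
  note i = someI_ex[OF this, folded indicator_def]
  show "indicator H \<in> obj R F" using i by blast
  show "K \<in> \<S> \<Longrightarrow> a \<in> carrier G \<Longrightarrow>
      val K a (indicator H) = (if K = H \<and> a \<in> H then \<one>\<^bsub>bot K\<^esub> else \<zero>\<^bsub>bot K\<^esub>)" using i by blast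
qed

lemma bot_mult:
  assumes "L \<in> \<S>" "x \<in> obj (T L) (free_orbit (grp L))"
  shows "x \<otimes>\<^bsub>bot L\<^esub> \<one>\<^bsub>bot L\<^esub> = x" "\<one>\<^bsub>bot L\<^esub> \<otimes>\<^bsub>bot L\<^esub> x = x"
    "x \<otimes>\<^bsub>bot L\<^esub> \<zero>\<^bsub>bot L\<^esub> = \<zero>\<^bsub>bot L\<^esub>" "\<zero>\<^bsub>bot L\<^esub> \<otimes>\<^bsub>bot L\<^esub> x = \<zero>\<^bsub>bot L\<^esub>"
proof -
  interpret L: finite_tambara_functor "grp L" "T L" by (rule factor[OF assms(1)])
  show "x \<otimes>\<^bsub>bot L\<^esub> \<one>\<^bsub>bot L\<^esub> = x" "\<one>\<^bsub>bot L\<^esub> \<otimes>\<^bsub>bot L\<^esub> x = x"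
    "x \<otimes>\<^bsub>bot L\<^esub> \<zero>\<^bsub>bot L\<^esub> = \<zero>\<^bsub>bot L\<^esub>" "\<zero>\<^bsub>bot L\<^esub> \<otimes>\<^bsub>bot L\<^esub> x = \<zero>\<^bsub>bot L\<^esub>"
    using L.mult_unit[OF L.F assms(2)] L.mult_null[OF L.F assms(2)] by simp_all
qed

lemma bot_units:
  assumes "L \<in> \<S>"
  shows "\<one>\<^bsub>bot L\<^esub> \<in> obj (T L) (free_orbit (grp L))" "\<zero>\<^bsub>bot L\<^esub> \<in> obj (T L) (free_orbit (grp L))"
proof -
  interpret L: finite_tambara_functor "grp L" "T L" by (rule factor[OF assms(1)])
  show "\<one>\<^bsub>bot L\<^esub> \<in> obj (T L) (free_orbit (grp L))" "\<zero>\<^bsub>bot L\<^esub> \<in> obj (T L) (free_orbit (grp L))"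
    using L.unit_closed[OF L.F] L.null_closed[OF L.F] by simp_all
qed

lemma indicator_idem:
  assumes H: "H \<in> \<S>"
  shows "mult F (indicator H) (indicator H) = indicator H"
proof (rule obj_F_eqI)
  fix L a assume L: "L \<in> \<S>" and a: "a \<in> carrier G"
  have "val L a (indicator H) = \<one>\<^bsub>bot L\<^esub> \<or> val L a (indicator H) = \<zero>\<^bsub>bot L\<^esub>"
    using indicator(2)[OF H L a] by auto
  then show "val L a (mult F (indicator H) (indicator H)) = val L a (indicator H)"
    unfolding val_mult[OF L a indicator(1)[OF H] indicator(1)[OF H]]
    by (elim disjE) (simp_all add: bot_mult[OF L] bot_units[OF L])
qed (simp_all add: mult_in[OF F] indicator(1)[OF H])

lemma rmul_indicator:
  assumes H: "H \<in> \<S>" and g: "g \<in> H"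
  shows "rmul g (indicator H) = indicator H"
proof (rule obj_F_eqI)
  note gG = in_G[OF H g]
  show "rmul g (indicator H) \<in> obj R F" using rmul_closed[OF gG indicator(1)[OF H]] .
  fix L a assume L: "L \<in> \<S>" and a: "a \<in> carrier G"
  have "a \<otimes> g \<in> H \<longleftrightarrow> a \<in> H"
    using subgroup.m_closed[OF subgrp[OF H]] subgroup.m_inv_closed[OF subgrp[OF H] g] g a gG
    by (metis inv_closed m_assoc r_inv r_one)
  then show "val L a (rmul g (indicator H)) = val L a (indicator H)"
    using a gG by (simp add: val_rmul[OF L a gG indicator(1)[OF H]] indicator(2)[OF H L])
qed (simp_all add: indicator(1)[OF H])

lemma indicator_orthogonal:
  assumes H: "H \<in> \<S>" and g: "g \<in> carrier G" "g \<notin> H"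
  shows "mult F (indicator H) (rmul g (indicator H)) = null F"
proof (rule obj_F_eqI)
  note r = rmul_closed[OF g(1) indicator(1)[OF H]]
  fix L a assume L: "L \<in> \<S>" and a: "a \<in> carrier G"
  have "a \<otimes> g \<notin> H" if "a \<in> H"
    using subgroup.m_closed[OF subgrp[OF H]] subgroup.m_inv_closed[OF subgrp[OF H] that] g a that
    by (metis inv_closed m_assoc l_inv l_one)
  moreover have "val L a (rmul g (indicator H)) = val L (a \<otimes> g) (indicator H)"
    by (rule val_rmul[OF L a g(1) indicator(1)[OF H]])
  ultimately have "val L a (indicator H) = \<zero>\<^bsub>bot L\<^esub> \<or> val L a (rmul g (indicator H)) = \<zero>\<^bsub>bot L\<^esub>"
    using indicator(2)[OF H L a] indicator(2)[OF H L, of "a \<otimes> g"] a g(1) by auto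
  then show "val L a (mult F (indicator H) (rmul g (indicator H))) = val L a (null F)"
    unfolding val_mult[OF L a indicator(1)[OF H] r] val_null[OF L a]
    using bot_mult(3)[OF L val_closed[OF L a indicator(1)[OF H]]]
      bot_mult(4)[OF L val_closed[OF L a r]] by (elim disjE) simp_all
qed (simp_all add: mult_in[OF F] null_in[OF F] indicator(1)[OF H] rmul_closed g)

end

section \<open>Endomorphisms of the product\<close>

text \<open>
  Conjugation is injective, so the two inclusions force the finite groups \<open>L\<close> and \<open>H\<close> to have the same
  order, and the first inclusion is an equality.
\<close>

lemma (in group) conjugate_in_each_other:
  assumes fin: "finite (carrier G)" and H: "subgroup H G" and L: "subgroup L G"
    and a: "a \<in> carrier G" "\<And>l. l \<in> L \<Longrightarrow> inv a \<otimes> l \<otimes> a \<in> H"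
    and b: "b \<in> carrier G" "\<And>h. h \<in> H \<Longrightarrow> inv b \<otimes> h \<otimes> b \<in> L"
  shows "inv a <# L #> inv (inv a) = H"
proof -
  let ?c = "\<lambda>a x. inv a \<otimes> x \<otimes> a"
  have inj: "inj_on (?c a) K" if "subgroup K G" "a \<in> carrier G" for a K
    using subgroup.mem_carrier[OF that(1)] that(2) by (intro inj_onI) (simp add: m_assoc)
  have finHL: "finite H" "finite L"
    using fin subgroup.subset[OF H] subgroup.subset[OF L] finite_subset by blast+
  have "card H \<le> card L"
    using card_inj_on_le[OF inj[OF H b(1)] _ finHL(2)] b(2) by blast
  moreover have "card (?c a ` L) = card L" using card_image[OF inj[OF L a(1)]] .
  moreover have "?c a ` L \<subseteq> H" using a(2) by blast
  ultimately have "?c a ` L = H" using card_subset_eq[OF finHL(1)] card_mono[OF finHL(1)] by (metis order_antisym)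
  moreover have "inv a <# L #> inv (inv a) = ?c a ` L"
    using a(1) by (auto simp: l_coset_def r_coset_def)
  ultimately show ?thesis by simp
qed

context coinduced_product
begin

abbreviation "nat_end \<phi> \<equiv> is_nat_trans (bispan_cat G) R R \<phi>"

context
  fixes \<phi>
  assumes \<phi>: "nat_end \<phi>"
begin

lemma end_closed:
  assumes "is_gset G X" "r \<in> obj R X"
  shows "\<phi> X r \<in> obj R X"
proof -
  have "\<phi> X \<in> obj R X \<rightarrow> obj R X"
    using \<phi> assms(1) Ob_bispan_cat unfolding is_nat_trans_def by blast
  then show ?thesis using assms(2) by (rule funcset_mem)
qed

lemma end_natural:
  assumes "is_gset G X" "is_gset G Y" "c \<in> Hom (bispan_cat G) X Y" "r \<in> obj R X"
  shows "\<phi> Y (mor R c r) = mor R c (\<phi> X r)"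
proof -
  have "X \<in> Ob (bispan_cat G)" "Y \<in> Ob (bispan_cat G)" using assms by simp_all
  then show ?thesis using \<phi> assms(3,4) unfolding is_nat_trans_def by blast
qed

lemma end_pair:
  assumes X: "is_gset G X" and x: "x \<in> obj R X" and y: "y \<in> obj R X"
  shows "pair X (\<phi> X x) (\<phi> X y) = \<phi> (gset_sum G X X) (pair X x y)"
proof -
  note S = gset_sum[OF X X] and p = pair_in[OF X x y]
  note h = restriction_in_Hom[OF X S gset_inl_gmaps[OF X]] restriction_in_Hom[OF X S gset_inr_gmaps[OF X]]
  show ?thesis
    using end_natural[OF S X h(1) p] end_natural[OF S X h(2) p] pair_restrict[OF X x y]
    by (intro pair_unique[OF X end_closed[OF S p]]) simp_all
qed

lemma end_mult:
  assumes X: "is_gset G X" and x: "x \<in> obj R X" and y: "y \<in> obj R X"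
  shows "\<phi> X (mult X x y) = mult X (\<phi> X x) (\<phi> X y)"
  using end_natural[OF gset_sum[OF X X] X norm_in_Hom[OF gset_sum[OF X X] X gset_fold_gmaps[OF X]] pair_in[OF X x y]]
  by (simp add: mult_eq[OF X] end_closed[OF X] x y end_pair[OF X])

lemma end_add:
  assumes X: "is_gset G X" and x: "x \<in> obj R X" and y: "y \<in> obj R X"
  shows "\<phi> X (add X x y) = add X (\<phi> X x) (\<phi> X y)"
  using end_natural[OF gset_sum[OF X X] X transfer_in_Hom[OF gset_sum[OF X X] X gset_fold_gmaps[OF X]] pair_in[OF X x y]]
  by (simp add: add_eq[OF X] end_closed[OF X] x y end_pair[OF X])

lemma end_pt: "\<phi> (gset_empty G) pt = pt"
  using end_closed[OF gset_empty, of pt] by (simp add: obj_R_empty)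

lemma end_unit: "is_gset G X \<Longrightarrow> \<phi> X (unit X) = unit X"
  and end_null: "is_gset G X \<Longrightarrow> \<phi> X (null X) = null X"
  using end_natural[OF gset_empty _ norm_in_Hom[OF gset_empty _ gid_gset_empty_gmaps], of X pt]
    end_natural[OF gset_empty _ transfer_in_Hom[OF gset_empty _ gid_gset_empty_gmaps], of X pt]
  by (simp_all add: unit_eq null_eq end_pt obj_R_empty)

lemma end_rmul: "g \<in> carrier G \<Longrightarrow> r \<in> obj R F \<Longrightarrow> \<phi> F (rmul g r) = rmul g (\<phi> F r)"
  using end_natural[OF F F restriction_in_Hom[OF F F rmul_gmaps]] .

text \<open>
  For \<open>l \<in> L\<close> one has \<open>l a = a (a\<^sup>-\<^sup>1la)\<close>, so \<open>l\<close> acts on the value at \<open>a\<close> as \<open>a\<^sup>-\<^sup>1la\<close> acts on \<open>\<phi> d\<close>, where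
  \<open>d\<close> is the indicator.  By naturality the relations between \<open>d\<close> and its translates become relations in the
  clarified ring \<open>R\<^sub>L(L/e)\<close>.
\<close>

lemma end_indicator_null:
  assumes H: "H \<in> \<S>" and L: "L \<in> \<S>" and cl: "clarified (grp L) (T L)"
    and no: "\<And>a. a \<in> carrier G \<Longrightarrow> \<exists>l\<in>L. inv a \<otimes> l \<otimes> a \<notin> H"
  shows "\<phi> F (indicator H) L = null F L"
proof (rule val_eqI[OF L _ null_in[OF F]])
  interpret L: finite_tambara_functor "grp L" "T L" by (rule factor[OF L])
  note i = indicator(1)[OF H] and inG = in_G[OF L]
  let ?f = "\<phi> F (indicator H)"
  show f: "?f \<in> obj R F" by (rule end_closed[OF F i])
  fix a assume a: "a \<in> carrier G"
  let ?d = "val L a ?f"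
  define K where "K = {l \<in> L. inv a \<otimes> l \<otimes> a \<in> H}"
  have KG: "inv a \<otimes> l \<otimes> a \<in> carrier G" "a \<otimes> (inv a \<otimes> l \<otimes> a) = l \<otimes> a" if "l \<in> L" for l
    using inG[OF that] a by (simp_all add: m_assoc[symmetric])
  have act: "bottom_act (grp L) (T L) l ?d = val L a (\<phi> F (rmul (inv a \<otimes> l \<otimes> a) (indicator H)))"
    if l: "l \<in> L" for l
    using val_act[OF L l a f] val_rmul[OF L a KG(1)[OF l] f] KG(2)[OF l] end_rmul[OF KG(1)[OF l] i] by simp
  have "?d = \<zero>\<^bsub>bot L\<^esub>"
  proof (rule L.clarified_imp_null[OF cl, of K])
    show "subgroup K (grp L)"
    proof (rule L.subgroupI)
      have "\<one> \<in> K"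
        using a subgroup.one_closed[OF subgrp[OF L]] subgroup.one_closed[OF subgrp[OF H]]
        by (simp add: K_def)
      then show "K \<noteq> {}" by blast
    next
      fix l assume "l \<in> K"
      then have l: "l \<in> L" "inv a \<otimes> l \<otimes> a \<in> H" by (simp_all add: K_def)
      have "inv (inv a \<otimes> l \<otimes> a) = inv a \<otimes> inv l \<otimes> a"
        using inG[OF l(1)] a by (simp add: inv_mult_group m_assoc)
      then have "inv l \<in> K"
        using subgroup.m_inv_closed[OF subgrp[OF H] l(2)] subgroup.m_inv_closed[OF subgrp[OF L] l(1)]
        by (simp add: K_def)
      then show "inv\<^bsub>grp L\<^esub> l \<in> K" using m_inv_consistent[OF subgrp[OF L] l(1)] by simp
    next
      fix l m assume "l \<in> K" "m \<in> K"
      then have lm: "l \<in> L" "m \<in> L" "inv a \<otimes> l \<otimes> a \<in> H" "inv a \<otimes> m \<otimes> a \<in> H" by (simp_all add: K_def)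
      have "a \<otimes> (inv a \<otimes> x) = x" if "x \<in> carrier G" for x
        using that a by (simp add: m_assoc[symmetric])
      then have "(inv a \<otimes> l \<otimes> a) \<otimes> (inv a \<otimes> m \<otimes> a) = inv a \<otimes> (l \<otimes> m) \<otimes> a"
        using inG[OF lm(1)] inG[OF lm(2)] a by (simp add: m_assoc)
      then show "l \<otimes>\<^bsub>grp L\<^esub> m \<in> K"
        using subgroup.m_closed[OF subgrp[OF H] lm(3,4)] subgroup.m_closed[OF subgrp[OF L] lm(1,2)]
        by (simp add: K_def)
    qed (auto simp: K_def)
    show "K \<noteq> carrier (grp L)" using no[OF a] by (auto simp: K_def)
    show "?d \<in> obj (T L) L.F" by (rule val_closed[OF L a f])
    show "?d \<otimes>\<^bsub>bot L\<^esub> ?d = ?d"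
      using val_mult[OF L a f f] end_mult[OF F i i] indicator_idem[OF H] by simp
    show "bottom_act (grp L) (T L) l ?d = ?d" if "l \<in> K" for l
      using act[of l] that rmul_indicator[OF H] by (simp add: K_def)
    show "?d \<otimes>\<^bsub>bot L\<^esub> bottom_act (grp L) (T L) l ?d = \<zero>\<^bsub>bot L\<^esub>"
      if "l \<in> carrier (grp L)" "l \<notin> K" for l
    proof -
      have l: "l \<in> L" "inv a \<otimes> l \<otimes> a \<notin> H" using that by (simp_all add: K_def)
      note r = rmul_closed[OF KG(1)[OF l(1)] i]
      have "?d \<otimes>\<^bsub>bot L\<^esub> bottom_act (grp L) (T L) l ?d =
          val L a (\<phi> F (mult F (indicator H) (rmul (inv a \<otimes> l \<otimes> a) (indicator H))))"
        unfolding act[OF l(1)] end_mult[OF F i r] val_mult[OF L a f end_closed[OF F r]] by (rule refl)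
      also have "\<dots> = \<zero>\<^bsub>bot L\<^esub>"
        unfolding indicator_orthogonal[OF H KG(1)[OF l(1)] l(2)] end_null[OF F] val_null[OF L a] by (rule refl)
      finally show ?thesis .
    qed
  qed
  then show "?d = val L a (null F)" by (simp add: val_null[OF L a])
qed

text \<open>
  Applying \<open>\<phi>\<close> to the hypothesis shows that the indicator of \<open>L\<close> annihilates every translate of \<open>\<phi> c\<close>;
  at the trivial coset the indicator is \<open>1\<close> and the translates of \<open>\<phi> c\<close> take all its values.
\<close>

lemma end_null_of_orthogonal:
  assumes L: "L \<in> \<S>" and d: "d \<in> obj R F" "\<phi> F d = indicator L" and c: "c \<in> obj R F"
    and orth: "\<And>g. g \<in> carrier G \<Longrightarrow> mult F d (rmul g c) = null F"
  shows "\<phi> F c L = null F L"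
proof (rule val_eqI[OF L end_closed[OF F c] null_in[OF F]])
  fix g assume g: "g \<in> carrier G"
  note r = rmul_closed[OF g c] rmul_closed[OF g end_closed[OF F c]]
  have "mult F (indicator L) (rmul g (\<phi> F c)) = null F"
    using end_mult[OF F d(1) r(1)] end_null[OF F] end_rmul[OF g c] orth[OF g] d(2) by simp
  then have "val L \<one> (indicator L) \<otimes>\<^bsub>bot L\<^esub> val L g (\<phi> F c) = val L \<one> (null F)"
    using val_mult[OF L one_closed indicator(1)[OF L] r(2)]
      val_rmul[OF L one_closed g end_closed[OF F c]] g by simp
  moreover have "val L \<one> (indicator L) = \<one>\<^bsub>bot L\<^esub>"
    using indicator(2)[OF L L one_closed] subgroup.one_closed[OF subgrp[OF L]] by simp
  ultimately show "val L g (\<phi> F c) = val L g (null F)"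
    using bot_mult(2)[OF L val_closed[OF L g end_closed[OF F c]]]
      val_null[OF L one_closed] val_null[OF L g] by simp
qed

end

lemma ring_laws:
  assumes H: "H \<in> \<S>" and X: "is_gset G X" and x: "x \<in> obj (T H) (res_gset H X)"
  shows "x \<otimes>\<^bsub>ring H X\<^esub> unit X H = x" "x \<otimes>\<^bsub>ring H X\<^esub> null X H = null X H"
    "null X H \<otimes>\<^bsub>ring H X\<^esub> x = null X H"
    "x \<oplus>\<^bsub>ring H X\<^esub> null X H = x" "null X H \<oplus>\<^bsub>ring H X\<^esub> x = x"
proof -
  interpret H: tambara_functor "grp H" "T H" by (rule factor'[OF H])
  note X' = res_gset[OF subgrp[OF H] X]
  show "x \<otimes>\<^bsub>ring H X\<^esub> unit X H = x" "x \<otimes>\<^bsub>ring H X\<^esub> null X H = null X H"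
    "null X H \<otimes>\<^bsub>ring H X\<^esub> x = null X H"
    "x \<oplus>\<^bsub>ring H X\<^esub> null X H = x" "null X H \<oplus>\<^bsub>ring H X\<^esub> x = x"
    using H.mult_unit[OF X' x] H.mult_null[OF X' x] H.add_null[OF X' x] H
    by (simp_all add: unit_def null_def)
qed

lemma res_R_null:
  assumes X: "is_gset G X" and Y: "is_gset G Y" and f: "f \<in> gmaps G X Y" and H: "H \<in> \<S>"
    and r: "r H = null Y H"
  shows "mor R (restriction G X Y f) r H = null X H"
  using tambara_functor.res_null[OF factor'[OF H] res_gset[OF subgrp[OF H] X]
      res_gset[OF subgrp[OF H] Y] gmaps_res[OF subgrp[OF H] f]] H
  by (simp add: res_R[OF X Y f H] r, simp add: null_def)

lemma res_R_unit:
  assumes X: "is_gset G X" and Y: "is_gset G Y" and f: "f \<in> gmaps G X Y" and H: "H \<in> \<S>"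
    and r: "r H = unit Y H"
  shows "mor R (restriction G X Y f) r H = unit X H"
  using tambara_functor.res_unit[OF factor'[OF H] res_gset[OF subgrp[OF H] X]
      res_gset[OF subgrp[OF H] Y] gmaps_res[OF subgrp[OF H] f]] H
  by (simp add: res_R[OF X Y f H] r, simp add: unit_def)

lemma nrm_R_unit:
  assumes X: "is_gset G X" and Y: "is_gset G Y" and f: "f \<in> gmaps G X Y" and H: "H \<in> \<S>"
    and r: "r H = unit X H"
  shows "mor R (norm_map G X Y f) r H = unit Y H"
  using tambara_functor.nrm_unit[OF factor'[OF H] res_gset[OF subgrp[OF H] X]
      res_gset[OF subgrp[OF H] Y] gmaps_res[OF subgrp[OF H] f]] H
  by (simp add: nrm_R[OF X Y f H] r, simp add: unit_def)

lemma nrm_R_null: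
  assumes X: "is_gset G X" and Y: "is_gset G Y" and f: "f \<in> gmaps G X Y" and H: "H \<in> \<S>"
    and r: "r H = null X H" and surj: "f ` points X = points Y"
  shows "mor R (norm_map G X Y f) r H = null Y H"
  using tambara_functor.nrm_null[OF factor'[OF H] res_gset[OF subgrp[OF H] X]
      res_gset[OF subgrp[OF H] Y] gmaps_res[OF subgrp[OF H] f]] H surj
  by (simp add: nrm_R[OF X Y f H] r, simp add: null_def)

definition extend where "extend H X x = (null X)(H := x)"

lemma extend:
  assumes "H \<in> \<S>" "is_gset G X" "x \<in> obj (T H) (res_gset H X)"
  shows "extend H X x \<in> obj R X"
  using null_in[OF assms(2)] assms(1,3) by (auto simp: extend_def obj_R PiE_iff extensional_def)

lemma extend_apply [simp]: "extend H X x H = x"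
  and extend_other [simp]: "L \<noteq> H \<Longrightarrow> extend H X x L = null X L"
  by (simp_all add: extend_def)

context
  assumes clar: "\<And>H. H \<in> \<S> \<Longrightarrow> clarified (grp H) (T H)"
    and conj: "\<And>H g. H \<in> \<S> \<Longrightarrow> g \<in> carrier G \<Longrightarrow> g <# H #> (inv g) \<in> \<S> \<Longrightarrow> g <# H #> (inv g) = H"
begin

lemma aut_indicator_null:
  assumes \<phi>: "nat_end \<phi>" and \<psi>: "nat_end \<psi>" and inv: "\<And>r. r \<in> obj R F \<Longrightarrow> \<phi> F (\<psi> F r) = r"
    and H: "H \<in> \<S>" and L: "L \<in> \<S>" and ne: "H \<noteq> L"
  shows "\<phi> F (indicator H) L = null F L"
proof (cases "\<exists>a\<in>carrier G. \<forall>l\<in>L. inv a \<otimes> l \<otimes> a \<in> H")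
  case False
  then show ?thesis using end_indicator_null[OF \<phi> H L clar[OF L]] by blast
next
  case True
  then obtain a where a: "a \<in> carrier G" "\<And>l. l \<in> L \<Longrightarrow> inv a \<otimes> l \<otimes> a \<in> H" by blast
  have "\<exists>h\<in>H. inv b \<otimes> h \<otimes> b \<notin> L" if b: "b \<in> carrier G" for b
  proof (rule ccontr)
    assume "\<not> (\<exists>h\<in>H. inv b \<otimes> h \<otimes> b \<notin> L)"
    then have "inv a <# L #> inv (inv a) = H"
      using conjugate_in_each_other[OF fin subgrp[OF H] subgrp[OF L] a b] by blast
    then show False using conj[OF L inv_closed[OF a(1)]] H ne by simp
  qed
  then have null_H: "\<psi> F (indicator L) H = null F H"
    using end_indicator_null[OF \<psi> L H clar[OF H]] by blast
  note d = end_closed[OF \<psi> F indicator(1)[OF L]]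
  show ?thesis
  proof (rule end_null_of_orthogonal[OF \<phi> L d inv[OF indicator(1)[OF L]] indicator(1)[OF H]])
    fix g assume g: "g \<in> carrier G"
    note r = rmul_closed[OF g indicator(1)[OF H]]
    show "mult F (\<psi> F (indicator L)) (rmul g (indicator H)) = null F"
    proof (rule obj_R_eqI[OF mult_in[OF F d r] null_in[OF F]])
      fix K assume K: "K \<in> \<S>"
      show "mult F (\<psi> F (indicator L)) (rmul g (indicator H)) K = null F K"
      proof (cases "K = H")
        case True
        then show ?thesis
          using null_H ring_laws(3)[OF H F obj_R_component[OF r H]] H by (simp add: mult_def)
      next
        case False
        have "indicator H K = null F K"
          using indicator(2)[OF H K] False
          by (intro val_eqI[OF K indicator(1)[OF H] null_in[OF F]]) (simp add: val_null[OF K])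
        then have "rmul g (indicator H) K = null F K" by (rule res_R_null[OF F F rmul_gmaps[OF g] K])
        then show ?thesis
          using ring_laws(2)[OF K F obj_R_component[OF d K]] K by (simp add: mult_def)
      qed
    qed
  qed
qed

text \<open>
  The complement \<open>c = 1 - e\<close> is the easier element: \<open>\<psi>\<close> maps the indicator of \<open>H\<close> into the factor \<open>H\<close>,
  where all translates of \<open>c\<close> vanish.  So \<open>\<phi> c\<close> is \<open>0\<close> in the factor \<open>H\<close>, and \<open>e + c = 1\<close> gives the
  claim.
\<close>

lemma aut_fixes_factor_unit:
  assumes \<phi>: "nat_end \<phi>" and \<psi>: "nat_end \<psi>"
    and inv: "\<And>r. r \<in> obj R F \<Longrightarrow> \<phi> F (\<psi> F r) = r" "\<And>r. r \<in> obj R F \<Longrightarrow> \<psi> F (\<phi> F r) = r"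
    and H: "H \<in> \<S>"
  shows "\<phi> F (extend H F (unit F H)) H = unit F H"
proof -
  define e where "e = extend H F (unit F H)"
  define c where "c = (unit F)(H := null F H)"
  have e: "e \<in> obj R F" unfolding e_def by (rule extend[OF H F obj_R_component[OF unit_in[OF F] H]])
  have c: "c \<in> obj R F"
    using unit_in[OF F] obj_R_component[OF null_in[OF F] H] H
    by (auto simp: c_def obj_R PiE_iff extensional_def)
  have c_null: "\<phi> F c H = null F H"
  proof -
    note d = end_closed[OF \<psi> F indicator(1)[OF H]]
    show ?thesis
    proof (rule end_null_of_orthogonal[OF \<phi> H d inv(1)[OF indicator(1)[OF H]] c])
      fix g assume g: "g \<in> carrier G"
      note r = rmul_closed[OF g c]
      show "mult F (\<psi> F (indicator H)) (rmul g c) = null F"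
      proof (rule obj_R_eqI[OF mult_in[OF F d r] null_in[OF F]])
        fix K assume K: "K \<in> \<S>"
        show "mult F (\<psi> F (indicator H)) (rmul g c) K = null F K"
        proof (cases "K = H")
          case True
          have "rmul g c K = null F K"
            by (rule res_R_null[OF F F rmul_gmaps[OF g] K]) (simp add: c_def True)
          then show ?thesis
            using ring_laws(2)[OF K F obj_R_component[OF d K]] K by (simp add: mult_def)
        next
          case False
          have "\<psi> F (indicator H) K = null F K"
            using aut_indicator_null[OF \<psi> \<phi> inv(2) H K] False by blast
          then show ?thesis
            using ring_laws(3)[OF K F obj_R_component[OF r K]] K by (simp add: mult_def)
        qed
      qed
    qed
  qed
  have "add F e c = unit F"
  proof (rule obj_R_eqI[OF add_in[OF F e c] unit_in[OF F]])
    fix K assume K: "K \<in> \<S>"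
    show "add F e c K = unit F K"
      using ring_laws(4,5)[OF K F obj_R_component[OF unit_in[OF F] K]] K
      by (cases "K = H") (simp_all add: add_def e_def c_def)
  qed
  then have "add F (\<phi> F e) (\<phi> F c) H = unit F H"
    using end_add[OF \<phi> F e c] end_unit[OF \<phi> F] by simp
  then show ?thesis
    using ring_laws(4)[OF H F obj_R_component[OF end_closed[OF \<phi> F e] H]] c_null H
    by (simp add: add_def e_def)
qed

lemma one_point_gset: "is_gset G \<lparr>points = {0}, act = (\<lambda>g\<in>carrier G. \<lambda>x\<in>{0}. x)\<rparr>"
  by (rule is_gsetI) simp_all

text \<open>
  The element \<open>u\<close> below is the unit of the factor \<open>H\<close> of \<open>R(X)\<close>, constructed from the one of \<open>R(G/e)\<close> by
  operations that commute with \<open>\<phi>\<close>.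
\<close>

lemma aut_component:
  assumes \<phi>: "nat_end \<phi>" and \<psi>: "nat_end \<psi>"
    and inv: "\<And>r. r \<in> obj R F \<Longrightarrow> \<phi> F (\<psi> F r) = r" "\<And>r. r \<in> obj R F \<Longrightarrow> \<psi> F (\<phi> F r) = r"
    and H: "H \<in> \<S>" and X: "is_gset G X" and x: "x \<in> obj R X" and y: "y \<in> obj R X" and eq: "x H = y H"
  shows "\<phi> X x H = \<phi> X y H"
proof -
  define P where "P = \<lparr>points = {0}, act = (\<lambda>g\<in>carrier G. \<lambda>x\<in>{0 :: nat}. x)\<rparr>"
  have P: "is_gset G P" unfolding P_def by (rule one_point_gset)
  define p where "p Y = (\<lambda>n\<in>points Y. 0 :: nat)" for Y :: "'g gset"
  have p: "p Y \<in> gmaps G Y P" if "is_gset G Y" for Y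
    using gset_act_closed[OF that] by (intro gmapsI) (simp_all add: p_def P_def)
  have surj: "p F ` points F = points P"
    using enc_in[OF one_closed] by (auto simp: p_def P_def)
  define e where "e = extend H F (unit F H)"
  have e: "e \<in> obj R F" unfolding e_def by (rule extend[OF H F obj_R_component[OF unit_in[OF F] H]])
  define n where "n = mor R (norm_map G F P (p F)) e"
  define u where "u = mor R (restriction G X P (p X)) n"
  have n: "n \<in> obj R P" unfolding n_def by (rule nrm_R_closed[OF F P p[OF F] F P e])
  have u: "u \<in> obj R X" unfolding u_def by (rule res_R_closed[OF X P p[OF X] P X n])
  have u_H: "u H = unit X H"
    unfolding u_def n_def
    by (rule res_R_unit[OF X P p[OF X] H], rule nrm_R_unit[OF F P p[OF F] H]) (simp add: e_def)
  have u_L: "u L = null X L" if "L \<in> \<S>" "L \<noteq> H" for L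
    unfolding u_def n_def
    by (rule res_R_null[OF X P p[OF X] that(1)], rule nrm_R_null[OF F P p[OF F] that(1) _ surj])
       (simp add: e_def that)
  have "\<phi> X u = mor R (restriction G X P (p X)) (mor R (norm_map G F P (p F)) (\<phi> F e))"
    unfolding u_def n_def
    using end_natural[OF \<phi> P X restriction_in_Hom[OF X P p[OF X]] n[unfolded n_def]]
      end_natural[OF \<phi> F P norm_in_Hom[OF F P p[OF F]] e] by simp
  moreover have "\<phi> F e H = unit F H"
    unfolding e_def by (rule aut_fixes_factor_unit[OF \<phi> \<psi> inv H])
  ultimately have \<phi>u: "\<phi> X u H = unit X H"
    by (simp add: res_R_unit[OF X P p[OF X] H] nrm_R_unit[OF F P p[OF F] H])
  have cut: "\<phi> X z H = \<phi> X (mult X z u) H" if z: "z \<in> obj R X" for z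
    using ring_laws(1)[OF H X obj_R_component[OF end_closed[OF \<phi> X z] H]] \<phi>u H
    by (simp add: end_mult[OF \<phi> X z u]) (simp add: mult_def)
  have "mult X x u = mult X y u"
  proof (rule obj_R_eqI[OF mult_in[OF X x u] mult_in[OF X y u]])
    fix L assume L: "L \<in> \<S>"
    show "mult X x u L = mult X y u L"
      using ring_laws(2)[OF L X obj_R_component[OF x L]] ring_laws(2)[OF L X obj_R_component[OF y L]]
        eq u_L[OF L] L by (cases "L = H") (simp_all add: mult_def)
  qed
  then show ?thesis using cut[OF x] cut[OF y] by simp
qed

theorem aut_diagonal:
  assumes aut: "tambara_aut G R \<phi>"
  shows "\<exists>\<Phi>. (\<forall>H\<in>\<S>. tambara_hom G (coind G H (T H)) (coind G H (T H)) (\<Phi> H)) \<and>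
             (\<forall>H\<in>\<S>. \<forall>X\<in>Ob (bispan_cat G). \<forall>r\<in>obj R X. \<phi> X r H = \<Phi> H X (r H)) \<and>
             (\<forall>X\<in>Ob (bispan_cat G). \<forall>r\<in>obj R X. \<phi> X r = tambara_prod_hom \<S> \<Phi> X r)"
proof -
  obtain \<psi> where \<phi>: "nat_end \<phi>" and \<psi>: "nat_end \<psi>"
    and inv: "\<And>X r. X \<in> Ob (bispan_cat G) \<Longrightarrow> r \<in> obj R X \<Longrightarrow> \<psi> X (\<phi> X r) = r \<and> \<phi> X (\<psi> X r) = r"
    using aut unfolding tambara_aut_def is_nat_aut_def by blast
  have F_Ob: "F \<in> Ob (bispan_cat G)" using F by simp
  have comp: "\<phi> X x H = \<phi> X y H"
    if "H \<in> \<S>" "is_gset G X" "x \<in> obj R X" "y \<in> obj R X" "x H = y H" for H X x y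
    using aut_component[OF \<phi> \<psi> _ _ that] inv[OF F_Ob] by blast
  define \<Phi> where "\<Phi> H X x = \<phi> X (extend H X x) H" for H X x
  have \<Phi>: "\<phi> X r H = \<Phi> H X (r H)" if H: "H \<in> \<S>" and X: "is_gset G X" and r: "r \<in> obj R X" for H X r
    unfolding \<Phi>_def
    using comp[OF H X r extend[OF H X obj_R_component[OF r H]]] by simp
  have hom: "tambara_hom G (coind G H (T H)) (coind G H (T H)) (\<Phi> H)" if H: "H \<in> \<S>" for H
    unfolding tambara_hom_def is_nat_trans_def
  proof (intro conjI ballI)
    fix X assume "X \<in> Ob (bispan_cat G)"
    then have X: "is_gset G X" by simp
    show "\<Phi> H X \<in> obj (coind G H (T H)) X \<rightarrow> obj (coind G H (T H)) X"
      using obj_R_component[OF end_closed[OF \<phi> X extend[OF H X]] H]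
      by (auto simp: \<Phi>_def coind_def)
  next
    fix X Y c x assume "X \<in> Ob (bispan_cat G)" "Y \<in> Ob (bispan_cat G)"
      and c: "c \<in> Hom (bispan_cat G) X Y" and x: "x \<in> obj (coind G H (T H)) X"
    then have X: "is_gset G X" and Y: "is_gset G Y" by simp_all
    have ex: "extend H X x \<in> obj R X" using extend[OF H X] x by (simp add: coind_def)
    have "mor (coind G H (T H)) c x = mor R c (extend H X x) H"
      unfolding mor_R[OF H] by (simp add: coind_def)
    then have "\<Phi> H Y (mor (coind G H (T H)) c x) = \<phi> Y (mor R c (extend H X x)) H"
      using \<Phi>[OF H Y mor_R_closed[OF c X Y ex]] by simp
    also have "\<dots> = mor R c (\<phi> X (extend H X x)) H"
      using end_natural[OF \<phi> X Y c ex] by simp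
    also have "\<dots> = mor (coind G H (T H)) c (\<Phi> H X x)"
      unfolding mor_R[OF H] by (simp add: coind_def \<Phi>_def)
    finally show "\<Phi> H Y (mor (coind G H (T H)) c x) = mor (coind G H (T H)) c (\<Phi> H X x)" .
  qed
  have "\<phi> X r = tambara_prod_hom \<S> \<Phi> X r" if X: "is_gset G X" and r: "r \<in> obj R X" for X r
  proof (rule extensionalityI[where A = \<S>])
    show "\<phi> X r \<in> extensional \<S>" using end_closed[OF \<phi> X r] by (simp add: obj_R PiE_def)
  qed (simp_all add: tambara_prod_hom_def \<Phi>[OF _ X r])
  then show ?thesis using hom \<Phi> by (intro exI[of _ \<Phi>]) simp
qed

end

end

theorem proposition4p10:
  fixes G :: "('g, 'b) monoid_scheme" (structure)
    and \<S> :: "'g set set"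
    and T :: "'g set \<Rightarrow> ('g, 'r) tambara"
    and \<phi> :: "'g gset \<Rightarrow> ('g set \<Rightarrow> 'r) \<Rightarrow> ('g set \<Rightarrow> 'r)"
  defines "R \<equiv> tambara_prod \<S> (\<lambda>H. coind G H (T H))"
  assumes "group G" and "finite (carrier G)"
    and "\<And>H. H \<in> \<S> \<Longrightarrow> subgroup H G"
    and "\<And>H g. H \<in> \<S> \<Longrightarrow> g \<in> carrier G \<Longrightarrow> g <# H #> (inv g) \<in> \<S> \<Longrightarrow> g <# H #> (inv g) = H"
    and "\<And>H. H \<in> \<S> \<Longrightarrow> is_tambara (G\<lparr>carrier := H\<rparr>) (T H)"
    and "\<And>H. H \<in> \<S> \<Longrightarrow> clarified (G\<lparr>carrier := H\<rparr>) (T H)"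
    and "tambara_aut G R \<phi>"
  shows "\<exists>\<Phi>. (\<forall>H\<in>\<S>. tambara_hom G (coind G H (T H)) (coind G H (T H)) (\<Phi> H)) \<and>
             (\<forall>H\<in>\<S>. \<forall>X\<in>Ob (bispan_cat G). \<forall>r\<in>obj R X. \<phi> X r H = \<Phi> H X (r H)) \<and>
             (\<forall>X\<in>Ob (bispan_cat G). \<forall>r\<in>obj R X. \<phi> X r = tambara_prod_hom \<S> \<Phi> X r)"
proof -
  have "coinduced_product G \<S> T"
    using assms by (simp add: coinduced_product_def coinduced_product_axioms_def)
  from coinduced_product.aut_diagonal[OF this assms(7,5) assms(8)[unfolded R_def]]
  show ?thesis unfolding R_def .
qed

end
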